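(* Let $\gamma\in\mathbb R$ and let the coupling constant $\alpha>0$ be arbitrary. (i) If $2\omega_0+\gamma$ (resp. $2\omega_1+\gamma$) is the bottom (resp. top) of the essential spectrum of $\mathcal A$, then it cannot be an accumulation point of the discrete spectrum of $\mathcal A$ provided that $$\frac{\lambda}{\omega-\omega_0}\in L^2(\mathbb R^d)\qquad\Bigl(\text{resp. }\frac{\lambda}{\omega_1-\omega}\in L^2(\mathbb R^d)\Bigr).$$ (ii) If $2\omega_0+\gamma$ (resp. $2\omega_1+\gamma$) is an edge but not the bottom (resp. top) of the essential spectrum of $\mathcal A$, then it cannot be an accumulation point of the discrete spectrum of $\mathcal A$ provided that $$\frac{\lambda}{\sqrt{(\omega-\omega_0)(\omega_1-\omega)}}\in L^2(\mathbb R^d).$$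
   Context: Standing assumptions: $d\ge1$; $\omega:\mathbb R^d\to[0,\infty)$ is a non-constant, bounded, continuous function; $\lambda\in L^2(\mathbb R^d)$ is complex-valued and not identically zero (as an element of $L^2$). Put $\omega_0:=\inf_{\mathbb R^d}\omega$ and $\omega_1:=\sup_{\mathbb R^d}\omega$. Let $L^2_s(\mathbb R^d\times\mathbb R^d)$ be the subspace of symmetric functions in $L^2(\mathbb R^d\times\mathbb R^d)$, equipped with $\frac12$ times the inner product of the latter. For $\gamma\in\mathbb R$, $\alpha>0$ the operator matrix $\mathcal A=\begin{pmatrix}A&B\\ C&D\end{pmatrix}$ acts in $L^2(\mathbb R^d)\oplus L^2_s(\mathbb R^d\times\mathbb R^d)$ by $(Af)(k)=(-\gamma+\omega(k))f(k)$, $(Bg)(k)=\alpha\int_{\mathbb R^d} g(k,q)\lambda(q)\,dq$, $(Cf)(k,q)=\alpha\overline{\lambda(k)}f(q)+\alpha\overline{\lambda(q)}f(k)$, $(Dg)(k,q)=(\gamma+\omega(k)+\omega(q))g(k,q)$. It is bounded and self-adjoint. The discrete spectrum is the set of isolated eigenvalues of finite multiplicity; the essential spectrum is the rest of the spectrum. The essential spectrum of $\mathcal A$ is a finite union of disjoint compact intervals; an edge is an endpoint of one of these intervals, and bottom/top mean minimum/maximum of the essential spectrum. At points where a denominator in an integrability condition vanishes, the modulus of the quotient is understood as $0$ if $\lambda=0$ there and $+\infty$ otherwise. *)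

theory Defs
  imports "HOL-Analysis.Analysis"
begin

section \<open>Complex inner product spaces\<close>

text \<open>
  The library only has real scalars. The real norm, metric and topology of \<^class>\<open>real_inner\<close>
  are kept; the complex inner product is linear in its first argument.
\<close>

class complex_inner = real_inner +
  fixes scaleC :: "complex \<Rightarrow> 'a \<Rightarrow> 'a"  (infixr \<open>*\<^sub>C\<close> 75)
    and cinner :: "'a \<Rightarrow> 'a \<Rightarrow> complex"
  assumes scaleC_add_right: "a *\<^sub>C (x + y) = a *\<^sub>C x + a *\<^sub>C y"
    and scaleC_add_left: "(a + b) *\<^sub>C x = a *\<^sub>C x + b *\<^sub>C x"
    and scaleC_scaleC: "a *\<^sub>C (b *\<^sub>C x) = (a * b) *\<^sub>C x"
    and scaleR_scaleC: "r *\<^sub>R x = complex_of_real r *\<^sub>C x"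
    and cinner_commute: "cinner x y = cnj (cinner y x)"
    and cinner_add_left: "cinner (x + y) z = cinner x z + cinner y z"
    and cinner_scaleC_left: "cinner (a *\<^sub>C x) y = a * cinner x y"
    and inner_eq_Re_cinner: "inner x y = Re (cinner x y)"

global_interpretation complex_vector: vector_space "scaleC :: complex \<Rightarrow> 'a \<Rightarrow> 'a::complex_inner"
proof
  fix x :: 'a
  show "1 *\<^sub>C x = x"
    using scaleR_scaleC[of 1 x] by simp
qed (simp_all add: scaleC_add_right scaleC_add_left scaleC_scaleC)

text \<open>The (orthogonal) direct sum of two spaces.\<close>

instantiation prod :: (complex_inner, complex_inner) complex_inner
begin

definition scaleC_prod_def: "a *\<^sub>C p = (a *\<^sub>C fst p, a *\<^sub>C snd p)"

definition cinner_prod_def: "cinner p q = cinner (fst p) (fst q) + cinner (snd p) (snd q)"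

instance
proof
  fix x y z :: "'a \<times> 'b" and a b :: complex and r :: real
  show "a *\<^sub>C (x + y) = a *\<^sub>C x + a *\<^sub>C y"
    by (simp add: scaleC_prod_def scaleC_add_right)
  show "(a + b) *\<^sub>C x = a *\<^sub>C x + b *\<^sub>C x"
    by (simp add: scaleC_prod_def scaleC_add_left)
  show "a *\<^sub>C (b *\<^sub>C x) = (a * b) *\<^sub>C x"
    by (simp add: scaleC_prod_def scaleC_scaleC)
  show "r *\<^sub>R x = complex_of_real r *\<^sub>C x"
    by (simp add: scaleC_prod_def scaleR_prod_def scaleR_scaleC)
  show "cinner x y = cnj (cinner y x)"
    using cinner_commute[of "fst x" "fst y"] cinner_commute[of "snd x" "snd y"]
    by (simp add: cinner_prod_def)
  show "cinner (x + y) z = cinner x z + cinner y z"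
    by (simp add: cinner_prod_def cinner_add_left)
  show "cinner (a *\<^sub>C x) y = a * cinner x y"
    by (simp add: cinner_prod_def scaleC_prod_def cinner_scaleC_left algebra_simps)
  show "inner x y = Re (cinner x y)"
    by (simp add: cinner_prod_def inner_prod_def inner_eq_Re_cinner)
qed

end


section \<open>Spectra of bounded operators\<close>

text \<open>
  The operators below are complex-linear, and so are then the inverses; hence the (real) library
  notion \<^const>\<open>bounded_linear\<close> only adds boundedness of the inverse.
\<close>

definition resolvent_set :: "('h::complex_inner \<Rightarrow> 'h) \<Rightarrow> complex set" where
  "resolvent_set T =
     {z. bij (\<lambda>x. T x - z *\<^sub>C x) \<and> bounded_linear (inv (\<lambda>x. T x - z *\<^sub>C x))}"

definition spectrum :: "('h::complex_inner \<Rightarrow> 'h) \<Rightarrow> complex set" where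
  "spectrum T = - resolvent_set T"

definition eigenspace :: "('h::complex_inner \<Rightarrow> 'h) \<Rightarrow> complex \<Rightarrow> 'h set" where
  "eigenspace T z = {x. T x = z *\<^sub>C x}"

definition finite_dimensional :: "'h::complex_inner set \<Rightarrow> bool" where
  "finite_dimensional S \<longleftrightarrow> (\<exists>B. finite B \<and> S \<subseteq> complex_vector.span B)"

text \<open>
  Multiplicity is the dimension of the eigenspace, which for self-adjoint operators is also
  the algebraic multiplicity.
\<close>

definition discrete_spectrum :: "('h::complex_inner \<Rightarrow> 'h) \<Rightarrow> complex set" where
  "discrete_spectrum T =
     {z. z isolated_in spectrum T \<and> eigenspace T z \<noteq> {0} \<and> finite_dimensional (eigenspace T z)}"

definition essential_spectrum :: "('h::complex_inner \<Rightarrow> 'h) \<Rightarrow> complex set" where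
  "essential_spectrum T = spectrum T - discrete_spectrum T"

text \<open>
  The spectrum of a self-adjoint operator is real; bottom, top and edges are formulated for the
  corresponding set of real numbers.
\<close>

definition real_essential_spectrum :: "('h::complex_inner \<Rightarrow> 'h) \<Rightarrow> real set" where
  "real_essential_spectrum T = {x. complex_of_real x \<in> essential_spectrum T}"

definition is_bottom :: "real \<Rightarrow> real set \<Rightarrow> bool" where
  "is_bottom x S \<longleftrightarrow> x \<in> S \<and> (\<forall>y\<in>S. x \<le> y)"

definition is_top :: "real \<Rightarrow> real set \<Rightarrow> bool" where
  "is_top x S \<longleftrightarrow> x \<in> S \<and> (\<forall>y\<in>S. y \<le> x)"

text \<open>
  If a set of reals is a finite union of disjoint compact intervals, then these intervals are
  its connected components.
\<close>

definition is_edge :: "real \<Rightarrow> real set \<Rightarrow> bool" where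
  "is_edge x S \<longleftrightarrow> (\<exists>a b. a \<le> b \<and> {a..b} \<in> components S \<and> (x = a \<or> x = b))"


section \<open>Square-integrable functions\<close>

text \<open>
  Representatives are taken Borel measurable; every Lebesgue measurable function is almost
  everywhere equal to such a function.
\<close>

definition square_integrable :: "('a::euclidean_space \<Rightarrow> complex) \<Rightarrow> bool" where
  "square_integrable f \<longleftrightarrow>
     f \<in> borel_measurable lborel \<and> integrable lborel (\<lambda>x. (cmod (f x))\<^sup>2)"

lemma square_integrable_zero: "square_integrable (\<lambda>x. 0)"
  by (simp add: square_integrable_def)

lemma square_integrable_measurable:
  "square_integrable f \<Longrightarrow> f \<in> borel_measurable borel"
  by (simp add: square_integrable_def)

lemma square_integrable_add:
  assumes "square_integrable f" "square_integrable g"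
  shows "square_integrable (\<lambda>x. f x + g x)"
proof -
  note [measurable] = assms[THEN square_integrable_measurable]
  have "integrable lborel (\<lambda>x. (cmod (f x + g x))\<^sup>2)"
  proof (rule Bochner_Integration.integrable_bound)
    show "integrable lborel (\<lambda>x. 2 * (cmod (f x))\<^sup>2 + 2 * (cmod (g x))\<^sup>2)"
      using assms by (simp add: square_integrable_def)
    show "AE x in lborel. norm ((cmod (f x + g x))\<^sup>2)
            \<le> norm (2 * (cmod (f x))\<^sup>2 + 2 * (cmod (g x))\<^sup>2)"
    proof (rule AE_I2)
      fix x
      have "(cmod (f x + g x))\<^sup>2 \<le> (cmod (f x) + cmod (g x))\<^sup>2"
        by (intro power_mono norm_triangle_ineq norm_ge_zero)
      also have "\<dots> \<le> 2 * (cmod (f x))\<^sup>2 + 2 * (cmod (g x))\<^sup>2"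
        using sum_squares_bound[of "cmod (f x)" "cmod (g x)"] by (simp add: power2_sum)
      finally show "norm ((cmod (f x + g x))\<^sup>2)
            \<le> norm (2 * (cmod (f x))\<^sup>2 + 2 * (cmod (g x))\<^sup>2)" by simp
    qed
  qed simp
  then show ?thesis by (simp add: square_integrable_def)
qed

lemma square_integrable_cmult:
  "square_integrable f \<Longrightarrow> square_integrable (\<lambda>x. a * f x)"
  by (auto simp: square_integrable_def norm_mult power_mult_distrib
      intro!: borel_measurable_times)

lemma square_integrable_uminus:
  "square_integrable f \<Longrightarrow> square_integrable (\<lambda>x. - f x)"
  using square_integrable_cmult[of f "-1"] by simp

lemma square_integrable_prod:
  assumes "square_integrable f" "square_integrable g"
  shows "integrable lborel (\<lambda>x. f x * g x)"
proof (rule Bochner_Integration.integrable_bound)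
  note [measurable] = assms[THEN square_integrable_measurable]
  show "(\<lambda>x. f x * g x) \<in> borel_measurable lborel" by simp
  show "integrable lborel (\<lambda>x. (cmod (f x))\<^sup>2 + (cmod (g x))\<^sup>2)"
    using assms by (simp add: square_integrable_def)
  show "AE x in lborel. norm (f x * g x) \<le> norm ((cmod (f x))\<^sup>2 + (cmod (g x))\<^sup>2)"
  proof (rule AE_I2)
    fix x
    have "2 * (cmod (f x) * cmod (g x)) \<le> (cmod (f x))\<^sup>2 + (cmod (g x))\<^sup>2"
      using sum_squares_bound[of "cmod (f x)" "cmod (g x)"] by (simp add: mult.assoc)
    moreover have "0 \<le> cmod (f x) * cmod (g x)" by simp
    ultimately have "cmod (f x) * cmod (g x) \<le> (cmod (f x))\<^sup>2 + (cmod (g x))\<^sup>2" by linarith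
    then show "norm (f x * g x) \<le> norm ((cmod (f x))\<^sup>2 + (cmod (g x))\<^sup>2)"
      by (simp add: norm_mult)
  qed
qed

lemma square_integrable_cnj:
  assumes "square_integrable f"
  shows "square_integrable (\<lambda>x. cnj (f x))"
proof -
  have "cnj \<in> borel_measurable borel"
    by (intro borel_measurable_continuous_onI continuous_intros)
  then have "(\<lambda>x. cnj (f x)) \<in> borel_measurable borel"
    using measurable_compose[OF square_integrable_measurable[OF assms]] by blast
  then show ?thesis
    using assms by (simp add: square_integrable_def)
qed

definition l2_eq :: "('a::euclidean_space \<Rightarrow> complex) \<Rightarrow> ('a \<Rightarrow> complex) \<Rightarrow> bool" where
  "l2_eq f g \<longleftrightarrow>
     square_integrable f \<and> square_integrable g \<and> (AE x in lborel. f x = g x)"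

lemma part_equivp_l2_eq: "part_equivp l2_eq"
proof (rule part_equivpI)
  show "\<exists>f. l2_eq f f"
    using square_integrable_zero by (auto simp: l2_eq_def)
  show "symp l2_eq"
    by (rule sympI) (auto simp: l2_eq_def elim: eventually_mono)
  show "transp l2_eq"
    by (rule transpI) (auto simp: l2_eq_def elim: eventually_elim2)
qed

quotient_type (overloaded) 'a l2 = "'a::euclidean_space \<Rightarrow> complex" / partial: l2_eq
  by (rule part_equivp_l2_eq)

lemma square_integrable_rep_l2: "square_integrable (rep_l2 f)"
  using Quotient3_rep_reflp[OF Quotient3_l2, of f] by (simp add: l2_eq_def)

lemma abs_rep_l2: "abs_l2 (rep_l2 f) = f"
  using Quotient3_l2 by (rule Quotient3_abs_rep)

lemma abs_l2_eq_iff: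
  "square_integrable f \<Longrightarrow> square_integrable g
    \<Longrightarrow> abs_l2 f = abs_l2 g \<longleftrightarrow> (AE x in lborel. f x = g x)"
  using Quotient3_rel[OF Quotient3_l2, of f g] by (auto simp: l2_eq_def)

lemma rep_abs_l2:
  assumes "square_integrable f"
  shows "AE x in lborel. rep_l2 (abs_l2 f) x = f x"
  using abs_l2_eq_iff[OF square_integrable_rep_l2 assms] abs_rep_l2 by blast

instantiation l2 :: (euclidean_space) complex_inner
begin

lift_definition zero_l2 :: "'a l2" is "\<lambda>x. 0"
  by (simp add: l2_eq_def square_integrable_zero)

lift_definition plus_l2 :: "'a l2 \<Rightarrow> 'a l2 \<Rightarrow> 'a l2" is "\<lambda>f g x. f x + g x"
  by (auto simp: l2_eq_def square_integrable_add elim: eventually_elim2)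

lift_definition uminus_l2 :: "'a l2 \<Rightarrow> 'a l2" is "\<lambda>f x. - f x"
  by (auto simp: l2_eq_def square_integrable_uminus)

lift_definition scaleC_l2 :: "complex \<Rightarrow> 'a l2 \<Rightarrow> 'a l2" is "\<lambda>a f x. a * f x"
  by (auto simp: l2_eq_def square_integrable_cmult elim: eventually_mono)

definition minus_l2 :: "'a l2 \<Rightarrow> 'a l2 \<Rightarrow> 'a l2" where
  "minus_l2 f g = f + - g"

definition scaleR_l2 :: "real \<Rightarrow> 'a l2 \<Rightarrow> 'a l2" where
  "scaleR_l2 r f = complex_of_real r *\<^sub>C f"

lift_definition cinner_l2 :: "'a l2 \<Rightarrow> 'a l2 \<Rightarrow> complex"
  is "\<lambda>f g. LINT x|lborel. f x * cnj (g x)"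
proof -
  fix f f' g g' :: "'a \<Rightarrow> complex"
  assume *: "l2_eq f f'" "l2_eq g g'"
  then have [measurable]:
    "f \<in> borel_measurable borel" "f' \<in> borel_measurable borel"
    "(\<lambda>x. cnj (g x)) \<in> borel_measurable borel" "(\<lambda>x. cnj (g' x)) \<in> borel_measurable borel"
    by (auto simp: l2_eq_def intro!: square_integrable_measurable square_integrable_cnj)
  show "(LINT x|lborel. f x * cnj (g x)) = (LINT x|lborel. f' x * cnj (g' x))"
  proof (rule integral_cong_AE)
    show "AE x in lborel. f x * cnj (g x) = f' x * cnj (g' x)"
      using * by (auto simp: l2_eq_def elim: eventually_elim2)
  qed simp_all
qed

definition inner_l2 :: "'a l2 \<Rightarrow> 'a l2 \<Rightarrow> real" where
  "inner_l2 f g = Re (cinner f g)"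

definition norm_l2 :: "'a l2 \<Rightarrow> real" where
  "norm_l2 f = sqrt (inner f f)"

definition sgn_l2 :: "'a l2 \<Rightarrow> 'a l2" where
  "sgn_l2 f = scaleR (inverse (norm f)) f"

definition dist_l2 :: "'a l2 \<Rightarrow> 'a l2 \<Rightarrow> real" where
  "dist_l2 f g = norm (f - g)"

definition uniformity_l2 :: "('a l2 \<times> 'a l2) filter" where
  "uniformity_l2 = (INF e\<in>{0<..}. principal {(x, y). dist x y < e})"

definition open_l2 :: "'a l2 set \<Rightarrow> bool" where
  "open_l2 U \<longleftrightarrow>
    (\<forall>x\<in>U. eventually (\<lambda>(x', y). x' = x \<longrightarrow> y \<in> U) uniformity)"

instance
proof
  fix f g h :: "'a l2" and a b :: complex and r s :: real and U :: "'a l2 set"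
  have C_add_right: "a *\<^sub>C (f + g) = a *\<^sub>C f + a *\<^sub>C g" for a and f g :: "'a l2"
    by transfer (auto simp: l2_eq_def algebra_simps
        intro!: square_integrable_add square_integrable_cmult)
  have C_add_left: "(a + b) *\<^sub>C f = a *\<^sub>C f + b *\<^sub>C f" for a b and f :: "'a l2"
    by transfer (auto simp: l2_eq_def algebra_simps
        intro!: square_integrable_add square_integrable_cmult)
  have C_C: "a *\<^sub>C (b *\<^sub>C f) = (a * b) *\<^sub>C f" for a b and f :: "'a l2"
    by transfer (auto simp: l2_eq_def algebra_simps
        intro!: square_integrable_cmult)
  have C_1: "1 *\<^sub>C f = f" for f :: "'a l2"
    by transfer (auto simp: l2_eq_def)
  have ci_commute: "cinner f g = cnj (cinner g f)" for f g :: "'a l2"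
  proof transfer
    fix f g :: "'a \<Rightarrow> complex"
    show "(LINT x|lborel. f x * cnj (g x)) = cnj (LINT x|lborel. g x * cnj (f x))"
      using Bochner_Integration.integral_cnj[of lborel "\<lambda>x. g x * cnj (f x)"] by (simp add: mult.commute)
  qed
  have ci_add: "cinner (f + g) h = cinner f h + cinner g h" for f g h :: "'a l2"
  proof transfer
    fix f g h :: "'a \<Rightarrow> complex"
    assume "l2_eq f f" "l2_eq g g" "l2_eq h h"
    then have "integrable lborel (\<lambda>x. f x * cnj (h x))" "integrable lborel (\<lambda>x. g x * cnj (h x))"
      by (auto simp: l2_eq_def intro!: square_integrable_prod square_integrable_cnj)
    then show "(LINT x|lborel. (f x + g x) * cnj (h x)) =
        (LINT x|lborel. f x * cnj (h x)) + (LINT x|lborel. g x * cnj (h x))"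
      by (simp add: algebra_simps)
  qed
  have ci_C: "cinner (a *\<^sub>C f) g = a * cinner f g" for a and f g :: "'a l2"
    by transfer (simp add: mult.assoc)
  have ci_pos: "0 \<le> Re (cinner f f) \<and> (Re (cinner f f) = 0 \<longleftrightarrow> f = 0)" for f :: "'a l2"
  proof transfer
    fix f :: "'a \<Rightarrow> complex"
    assume "l2_eq f f"
    then have f: "square_integrable f" by (simp add: l2_eq_def)
    have eq: "(LINT x|lborel. f x * cnj (f x)) = complex_of_real (LINT x|lborel. (cmod (f x))\<^sup>2)"
      by (simp only: integral_complex_of_real[symmetric] complex_norm_square)
    have "(LINT x|lborel. (cmod (f x))\<^sup>2) = 0 \<longleftrightarrow> (AE x in lborel. (cmod (f x))\<^sup>2 = 0)"
      using f by (intro integral_nonneg_eq_0_iff_AE) (auto simp: square_integrable_def)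
    then show "0 \<le> Re (LINT x|lborel. f x * cnj (f x)) \<and>
        (Re (LINT x|lborel. f x * cnj (f x)) = 0 \<longleftrightarrow> l2_eq f (\<lambda>x. 0))"
      unfolding eq using f by (simp add: l2_eq_def square_integrable_zero)
  qed
  show "f + g + h = f + (g + h)"
    by transfer (auto simp: l2_eq_def algebra_simps intro!: square_integrable_add)
  show "f + g = g + f"
    by transfer (auto simp: l2_eq_def algebra_simps intro!: square_integrable_add)
  show "0 + f = f"
    by transfer (auto simp: l2_eq_def)
  show "- f + f = 0"
    by transfer (auto simp: l2_eq_def square_integrable_zero)
  show "f - g = f + - g"
    by (rule minus_l2_def)
  show "r *\<^sub>R (f + g) = r *\<^sub>R f + r *\<^sub>R g" "(r + s) *\<^sub>R f = r *\<^sub>R f + s *\<^sub>R f"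
    "r *\<^sub>R (s *\<^sub>R f) = (r * s) *\<^sub>R f" "1 *\<^sub>R f = f"
    by (simp_all add: scaleR_l2_def C_add_right C_add_left C_C C_1)
  show "dist f g = norm (f - g)" by (rule dist_l2_def)
  show "sgn f = scaleR (inverse (norm f)) f" by (rule sgn_l2_def)
  show "(uniformity :: ('a l2 \<times> 'a l2) filter) = (INF e\<in>{0<..}. principal {(x, y). dist x y < e})"
    by (rule uniformity_l2_def)
  show "open U \<longleftrightarrow> (\<forall>x\<in>U. eventually (\<lambda>(x', y). x' = x \<longrightarrow> y \<in> U) uniformity)"
    by (rule open_l2_def)
  show "inner f g = inner g f"
    by (metis inner_l2_def ci_commute cnj.simps(1))
  show "inner (f + g) h = inner f h + inner g h"
    by (simp add: inner_l2_def ci_add)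
  show "inner (r *\<^sub>R f) g = r * inner f g"
    by (simp add: inner_l2_def scaleR_l2_def ci_C)
  show "0 \<le> inner f f" "inner f f = 0 \<longleftrightarrow> f = 0"
    using ci_pos[of f] by (simp_all add: inner_l2_def)
  show "norm f = sqrt (inner f f)" by (rule norm_l2_def)
  show "inner f g = Re (cinner f g)" by (rule inner_l2_def)
  show "r *\<^sub>R f = complex_of_real r *\<^sub>C f" by (rule scaleR_l2_def)
  show "cinner f g = cnj (cinner g f)" by (rule ci_commute)
  show "a *\<^sub>C (f + g) = a *\<^sub>C f + a *\<^sub>C g" "(a + b) *\<^sub>C f = a *\<^sub>C f + b *\<^sub>C f"
    "a *\<^sub>C (b *\<^sub>C f) = (a * b) *\<^sub>C f" "cinner (f + g) h = cinner f h + cinner g h"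
    "cinner (a *\<^sub>C f) g = a * cinner f g"
    by (fact C_add_right C_add_left C_C ci_add ci_C)+
qed

end


subsection \<open>Symmetric functions of two variables\<close>

lemma swap_measurable [measurable]:
  "(prod.swap :: 'a \<times> 'a \<Rightarrow> _) \<in> (borel :: ('a::euclidean_space \<times> 'a) measure) \<rightarrow>\<^sub>M borel"
  by (intro borel_measurable_continuous_onI continuous_on_swap)

lemma AE_lborel_swap:
  fixes P :: "'a::euclidean_space \<times> 'a \<Rightarrow> bool"
  assumes "AE p in lborel. P p"
  shows "AE p in lborel. P (prod.swap p)"
proof -
  have "distr (lborel \<Otimes>\<^sub>M lborel) (lborel \<Otimes>\<^sub>M lborel) (\<lambda>(x, y). (y, x))
      = (lborel \<Otimes>\<^sub>M lborel :: ('a \<times> 'a) measure)"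
    by (rule lborel_pair.distr_pair_swap[symmetric])
  moreover have "(\<lambda>(x, y). (y, x)) = (prod.swap :: 'a \<times> 'a \<Rightarrow> _)"
    by auto
  ultimately have "distr lborel lborel prod.swap = (lborel :: ('a \<times> 'a) measure)"
    by (simp only: lborel_prod)
  then have "AE p in distr lborel lborel prod.swap. P p"
    using assms by metis
  then show ?thesis
    by (rule AE_distrD[rotated]) simp
qed

lift_definition symmetric_l2 :: "('a::euclidean_space \<times> 'a) l2 \<Rightarrow> bool"
  is "\<lambda>g. AE p in lborel. g p = g (prod.swap p)"
proof -
  fix f g :: "'a \<times> 'a \<Rightarrow> complex"
  assume "l2_eq f g"
  then have eq: "AE p in lborel. f p = g p"
    by (simp add: l2_eq_def)
  show "(AE p in lborel. f p = f (prod.swap p)) \<longleftrightarrow> (AE p in lborel. g p = g (prod.swap p))"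
  proof
    assume "AE p in lborel. f p = f (prod.swap p)"
    with eq AE_lborel_swap[OF eq] show "AE p in lborel. g p = g (prod.swap p)"
      by eventually_elim simp
  next
    assume "AE p in lborel. g p = g (prod.swap p)"
    with eq AE_lborel_swap[OF eq] show "AE p in lborel. f p = f (prod.swap p)"
      by eventually_elim simp
  qed
qed

lemma symmetric_abs_l2:
  assumes "square_integrable g"
  shows "symmetric_l2 (abs_l2 g) \<longleftrightarrow> (AE p in lborel. g p = g (prod.swap p))"
proof -
  have "l2_eq g g" using assms by (simp add: l2_eq_def)
  then show ?thesis by (simp add: symmetric_l2.abs_eq)
qed

typedef (overloaded) 'a l2_sym = "{g :: ('a::euclidean_space \<times> 'a) l2. symmetric_l2 g}"
proof
  show "0 \<in> {g :: ('a \<times> 'a) l2. symmetric_l2 g}"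
    by simp (transfer, simp)
qed

setup_lifting type_definition_l2_sym

instantiation l2_sym :: (euclidean_space) complex_inner
begin

lift_definition zero_l2_sym :: "'a l2_sym" is "0"
  by transfer simp

lift_definition plus_l2_sym :: "'a l2_sym \<Rightarrow> 'a l2_sym \<Rightarrow> 'a l2_sym" is "\<lambda>f g. f + g"
  by transfer (erule (1) eventually_elim2, simp)

lift_definition uminus_l2_sym :: "'a l2_sym \<Rightarrow> 'a l2_sym" is "\<lambda>f. - f"
  by transfer (erule eventually_mono, simp)

lift_definition minus_l2_sym :: "'a l2_sym \<Rightarrow> 'a l2_sym \<Rightarrow> 'a l2_sym" is "\<lambda>f g. f - g"
  unfolding minus_l2_def by transfer (erule (1) eventually_elim2, simp)

lift_definition scaleC_l2_sym :: "complex \<Rightarrow> 'a l2_sym \<Rightarrow> 'a l2_sym" is "\<lambda>a f. a *\<^sub>C f"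
  by transfer (erule eventually_mono, simp)

lift_definition scaleR_l2_sym :: "real \<Rightarrow> 'a l2_sym \<Rightarrow> 'a l2_sym" is "\<lambda>r f. r *\<^sub>R f"
  unfolding scaleR_l2_def by transfer (erule eventually_mono, simp)

lift_definition cinner_l2_sym :: "'a l2_sym \<Rightarrow> 'a l2_sym \<Rightarrow> complex"
  is "\<lambda>f g. 1 / 2 * cinner f g" .

lift_definition inner_l2_sym :: "'a l2_sym \<Rightarrow> 'a l2_sym \<Rightarrow> real"
  is "\<lambda>f g. 1 / 2 * inner f g" .

definition norm_l2_sym :: "'a l2_sym \<Rightarrow> real" where
  "norm_l2_sym f = sqrt (inner f f)"

definition sgn_l2_sym :: "'a l2_sym \<Rightarrow> 'a l2_sym" where
  "sgn_l2_sym f = scaleR (inverse (norm f)) f"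

definition dist_l2_sym :: "'a l2_sym \<Rightarrow> 'a l2_sym \<Rightarrow> real" where
  "dist_l2_sym f g = norm (f - g)"

definition uniformity_l2_sym :: "('a l2_sym \<times> 'a l2_sym) filter" where
  "uniformity_l2_sym = (INF e\<in>{0<..}. principal {(x, y). dist x y < e})"

definition open_l2_sym :: "'a l2_sym set \<Rightarrow> bool" where
  "open_l2_sym U \<longleftrightarrow> (\<forall>x\<in>U. eventually (\<lambda>(x', y). x' = x \<longrightarrow> y \<in> U) uniformity)"

instance
proof
  fix f g h :: "'a l2_sym" and a b :: complex and r s :: real and U :: "'a l2_sym set"
  show "f + g + h = f + (g + h)" by transfer (rule add.assoc)
  show "f + g = g + f" by transfer (rule add.commute)
  show "0 + f = f" by transfer simp
  show "- f + f = 0" by transfer simp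
  show "f - g = f + - g" by transfer simp
  show "r *\<^sub>R (f + g) = r *\<^sub>R f + r *\<^sub>R g" by transfer (rule scaleR_add_right)
  show "(r + s) *\<^sub>R f = r *\<^sub>R f + s *\<^sub>R f" by transfer (rule scaleR_add_left)
  show "r *\<^sub>R (s *\<^sub>R f) = (r * s) *\<^sub>R f" by transfer simp
  show "1 *\<^sub>R f = f" by transfer simp
  show "dist f g = norm (f - g)" by (rule dist_l2_sym_def)
  show "sgn f = scaleR (inverse (norm f)) f" by (rule sgn_l2_sym_def)
  show "(uniformity :: ('a l2_sym \<times> 'a l2_sym) filter) =
      (INF e\<in>{0<..}. principal {(x, y). dist x y < e})"
    by (rule uniformity_l2_sym_def)
  show "open U \<longleftrightarrow> (\<forall>x\<in>U. eventually (\<lambda>(x', y). x' = x \<longrightarrow> y \<in> U) uniformity)"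
    by (rule open_l2_sym_def)
  show "inner f g = inner g f" by transfer (simp add: inner_commute)
  show "inner (f + g) h = inner f h + inner g h" by transfer (simp add: inner_add_left)
  show "inner (r *\<^sub>R f) g = r * inner f g" by transfer simp
  show "0 \<le> inner f f" by transfer simp
  show "inner f f = 0 \<longleftrightarrow> f = 0" by transfer simp
  show "norm f = sqrt (inner f f)" by (rule norm_l2_sym_def)
  show "a *\<^sub>C (f + g) = a *\<^sub>C f + a *\<^sub>C g" by transfer (rule scaleC_add_right)
  show "(a + b) *\<^sub>C f = a *\<^sub>C f + b *\<^sub>C f" by transfer (rule scaleC_add_left)
  show "a *\<^sub>C (b *\<^sub>C f) = (a * b) *\<^sub>C f" by transfer (rule scaleC_scaleC)
  show "r *\<^sub>R f = complex_of_real r *\<^sub>C f" by transfer (rule scaleR_scaleC)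
  show "cinner f g = cnj (cinner g f)" by transfer (simp add: cinner_commute[symmetric])
  show "cinner (f + g) h = cinner f h + cinner g h"
    by transfer (simp add: cinner_add_left add_divide_distrib)
  show "cinner (a *\<^sub>C f) g = a * cinner f g" by transfer (simp add: cinner_scaleC_left)
  show "inner f g = Re (cinner f g)" by transfer (simp add: inner_eq_Re_cinner)
qed

end

definition rep_l2_sym :: "'a::euclidean_space l2_sym \<Rightarrow> 'a \<times> 'a \<Rightarrow> complex" where
  "rep_l2_sym g = rep_l2 (Rep_l2_sym g)"

definition abs_l2_sym :: "('a::euclidean_space \<times> 'a \<Rightarrow> complex) \<Rightarrow> 'a l2_sym" where
  "abs_l2_sym g = Abs_l2_sym (abs_l2 g)"

lemma square_integrable_rep_l2_sym: "square_integrable (rep_l2_sym g)"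
  by (simp add: rep_l2_sym_def square_integrable_rep_l2)

lemma rep_l2_sym_swap: "AE p in lborel. rep_l2_sym g p = rep_l2_sym g (prod.swap p)"
  using Rep_l2_sym[of g] symmetric_abs_l2[OF square_integrable_rep_l2, of "Rep_l2_sym g"]
  by (simp add: rep_l2_sym_def abs_rep_l2)

lemma abs_rep_l2_sym: "abs_l2_sym (rep_l2_sym g) = g"
  by (simp add: abs_l2_sym_def rep_l2_sym_def abs_rep_l2 Rep_l2_sym_inverse)

lemma rep_abs_l2_sym:
  assumes "square_integrable g" "AE p in lborel. g p = g (prod.swap p)"
  shows "AE p in lborel. rep_l2_sym (abs_l2_sym g) p = g p"
  using assms rep_abs_l2[of g]
  by (simp add: rep_l2_sym_def abs_l2_sym_def Abs_l2_sym_inverse symmetric_abs_l2)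


section \<open>The operator matrix\<close>

definition block_A :: "real \<Rightarrow> ('a::euclidean_space \<Rightarrow> real) \<Rightarrow> 'a l2 \<Rightarrow> 'a l2" where
  "block_A \<gamma> \<omega> f = abs_l2 (\<lambda>k. complex_of_real (- \<gamma> + \<omega> k) * rep_l2 f k)"

definition block_B :: "real \<Rightarrow> ('a::euclidean_space \<Rightarrow> complex) \<Rightarrow> 'a l2_sym \<Rightarrow> 'a l2" where
  "block_B \<alpha> lam g =
     abs_l2 (\<lambda>k. complex_of_real \<alpha> * (LINT q|lborel. rep_l2_sym g (k, q) * lam q))"

definition block_C :: "real \<Rightarrow> ('a::euclidean_space \<Rightarrow> complex) \<Rightarrow> 'a l2 \<Rightarrow> 'a l2_sym" where
  "block_C \<alpha> lam f =
     abs_l2_sym (\<lambda>(k, q). complex_of_real \<alpha> * cnj (lam k) * rep_l2 f q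
                        + complex_of_real \<alpha> * cnj (lam q) * rep_l2 f k)"

definition block_D :: "real \<Rightarrow> ('a::euclidean_space \<Rightarrow> real) \<Rightarrow> 'a l2_sym \<Rightarrow> 'a l2_sym" where
  "block_D \<gamma> \<omega> g =
     abs_l2_sym (\<lambda>(k, q). complex_of_real (\<gamma> + \<omega> k + \<omega> q) * rep_l2_sym g (k, q))"

definition block_op ::
  "real \<Rightarrow> real \<Rightarrow> ('a::euclidean_space \<Rightarrow> real) \<Rightarrow> ('a \<Rightarrow> complex)
    \<Rightarrow> 'a l2 \<times> 'a l2_sym \<Rightarrow> 'a l2 \<times> 'a l2_sym" where
  "block_op \<gamma> \<alpha> \<omega> lam = (\<lambda>(f, g).
     (block_A \<gamma> \<omega> f + block_B \<alpha> lam g, block_C \<alpha> lam f + block_D \<gamma> \<omega> g))"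


subsection \<open>The entries are given by the stated formulas for every choice of representatives\<close>

lemma square_integrable_bounded_mult:
  fixes w :: "'a::euclidean_space \<Rightarrow> real"
  assumes "w \<in> borel_measurable borel" "bounded (range w)" "square_integrable f"
  shows "square_integrable (\<lambda>x. complex_of_real (w x) * f x)"
proof -
  note [measurable] = assms(1) square_integrable_measurable[OF assms(3)]
  obtain M where M: "\<And>x. \<bar>w x\<bar> \<le> M"
    using assms(2) by (auto simp: bounded_iff)
  have "integrable lborel (\<lambda>x. (cmod (complex_of_real (w x) * f x))\<^sup>2)"
  proof (rule Bochner_Integration.integrable_bound)
    show "integrable lborel (\<lambda>x. M\<^sup>2 * (cmod (f x))\<^sup>2)"
      using assms(3) by (simp add: square_integrable_def)
    show "AE x in lborel. norm ((cmod (complex_of_real (w x) * f x))\<^sup>2)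
        \<le> norm (M\<^sup>2 * (cmod (f x))\<^sup>2)"
    proof (rule AE_I2)
      fix x
      have "(w x)\<^sup>2 \<le> M\<^sup>2"
        using power_mono[OF M[of x], of 2] by simp
      then show "norm ((cmod (complex_of_real (w x) * f x))\<^sup>2) \<le> norm (M\<^sup>2 * (cmod (f x))\<^sup>2)"
        by (simp add: norm_mult power_mult_distrib mult_right_mono)
    qed
  qed simp
  then show ?thesis by (simp add: square_integrable_def)
qed

lemma cmod_integral_prod_le:
  assumes f: "square_integrable f" and g: "square_integrable g"
  shows "(cmod (LINT x|lborel. f x * g x))\<^sup>2
    \<le> (LINT x|lborel. (cmod (f x))\<^sup>2) * (LINT x|lborel. (cmod (g x))\<^sup>2)"
proof -
  have sq: "square_integrable (\<lambda>x. complex_of_real (cmod (h x)))" if "square_integrable h"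
    for h :: "'a \<Rightarrow> complex"
    using that by (auto simp: square_integrable_def intro!: borel_measurable_of_real borel_measurable_norm)
  define F where "F h = abs_l2 (\<lambda>x. complex_of_real (cmod (h x)))" for h :: "'a \<Rightarrow> complex"
  have inner_F: "inner (F h) (F h') = (LINT x|lborel. cmod (h x) * cmod (h' x))"
    if "square_integrable h" "square_integrable h'" for h h'
  proof -
    have "cinner (F h) (F h')
        = (LINT x|lborel. complex_of_real (cmod (h x)) * cnj (complex_of_real (cmod (h' x))))"
      unfolding F_def using sq[OF that(1)] sq[OF that(2)]
      by (intro cinner_l2.abs_eq) (simp_all add: l2_eq_def)
    also have "\<dots> = complex_of_real (LINT x|lborel. cmod (h x) * cmod (h' x))"
      by (simp flip: of_real_mult)
    finally show ?thesis by (simp add: inner_eq_Re_cinner)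
  qed
  have "cmod (LINT x|lborel. f x * g x) \<le> (LINT x|lborel. cmod (f x) * cmod (g x))"
    using integral_norm_bound[of lborel "\<lambda>x. f x * g x"] by (simp add: norm_mult)
  then have "(cmod (LINT x|lborel. f x * g x))\<^sup>2 \<le> (inner (F f) (F g))\<^sup>2"
    by (simp add: inner_F f g power_mono)
  also have "\<dots> \<le> inner (F f) (F f) * inner (F g) (F g)"
    by (rule Cauchy_Schwarz_ineq)
  finally show ?thesis by (simp add: inner_F f g power2_eq_square)
qed

lemma square_integrable_section:
  fixes G :: "'a::euclidean_space \<times> 'a \<Rightarrow> complex"
  assumes G: "square_integrable G"
  shows "AE k in lborel. square_integrable (\<lambda>q. G (k, q))"
proof -
  have G': "integrable (lborel \<Otimes>\<^sub>M lborel) (\<lambda>p. (cmod (G p))\<^sup>2)"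
    using G by (simp add: square_integrable_def lborel_prod)
  have [measurable]: "G \<in> borel_measurable (lborel \<Otimes>\<^sub>M lborel)"
    using G by (simp add: square_integrable_def lborel_prod)
  have "AE k in lborel. integrable lborel (\<lambda>q. (cmod (G (k, q)))\<^sup>2)"
    using lborel_pair.AE_integrable_fst'[OF G'] by simp
  moreover have "(\<lambda>q. G (k, q)) \<in> borel_measurable lborel" for k
    by measurable
  ultimately show ?thesis by (simp add: square_integrable_def)
qed

lemma square_integrable_partial_integral:
  fixes G :: "'a::euclidean_space \<times> 'a \<Rightarrow> complex"
  assumes G: "square_integrable G" and lam: "square_integrable lam"
  shows "AE k in lborel. integrable lborel (\<lambda>q. G (k, q) * lam q)"
    and "square_integrable (\<lambda>k. LINT q|lborel. G (k, q) * lam q)"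
proof -
  have G': "integrable (lborel \<Otimes>\<^sub>M lborel) (\<lambda>p. (cmod (G p))\<^sup>2)"
    using G by (simp add: square_integrable_def lborel_prod)
  have [measurable]: "G \<in> borel_measurable (lborel \<Otimes>\<^sub>M lborel)" "lam \<in> borel_measurable lborel"
    using G lam by (simp_all add: square_integrable_def lborel_prod)
  show "AE k in lborel. integrable lborel (\<lambda>q. G (k, q) * lam q)"
    using square_integrable_section[OF G]
    by eventually_elim (rule square_integrable_prod[OF _ lam])
  have m: "(\<lambda>k. LINT q|lborel. G (k, q) * lam q) \<in> borel_measurable lborel"
    by measurable
  have "integrable lborel (\<lambda>k. (cmod (LINT q|lborel. G (k, q) * lam q))\<^sup>2)"
  proof (rule Bochner_Integration.integrable_bound)
    show "integrable lborel (\<lambda>k. (LINT q|lborel. (cmod (G (k, q)))\<^sup>2) * (LINT q|lborel. (cmod (lam q))\<^sup>2))"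
      using lborel_pair.integrable_fst'[OF G'] by simp
    show "(\<lambda>k. (cmod (LINT q|lborel. G (k, q) * lam q))\<^sup>2) \<in> borel_measurable lborel"
      using m by measurable
    show "AE k in lborel. norm ((cmod (LINT q|lborel. G (k, q) * lam q))\<^sup>2)
        \<le> norm ((LINT q|lborel. (cmod (G (k, q)))\<^sup>2) * (LINT q|lborel. (cmod (lam q))\<^sup>2))"
      using square_integrable_section[OF G]
    proof eventually_elim
      case (elim k)
      from cmod_integral_prod_le[OF elim lam] show ?case by simp
    qed
  qed
  then show "square_integrable (\<lambda>k. LINT q|lborel. G (k, q) * lam q)"
    using m by (simp add: square_integrable_def)
qed

lemma square_integrable_tensor:
  fixes f g :: "'a::euclidean_space \<Rightarrow> complex"
  assumes f: "square_integrable f" and g: "square_integrable g"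
  shows "square_integrable (\<lambda>(k, q). f k * g q)"
proof -
  have [measurable]: "f \<in> borel_measurable lborel" "g \<in> borel_measurable lborel"
    using f g by (simp_all add: square_integrable_def)
  have m: "(\<lambda>(k, q). f k * g q) \<in> borel_measurable (lborel \<Otimes>\<^sub>M lborel)"
    by measurable
  have "integrable (lborel \<Otimes>\<^sub>M lborel) (\<lambda>p. (cmod (case p of (k, q) \<Rightarrow> f k * g q))\<^sup>2)"
  proof (rule lborel_pair.Fubini_integrable)
    show "(\<lambda>p. (cmod (case p of (k, q) \<Rightarrow> f k * g q))\<^sup>2) \<in> borel_measurable (lborel \<Otimes>\<^sub>M lborel)"
      using m by measurable
    show "integrable lborel
        (\<lambda>k. LINT q|lborel. norm ((cmod (case (k, q) of (k, q) \<Rightarrow> f k * g q))\<^sup>2))"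
      using f by (simp add: square_integrable_def norm_mult power_mult_distrib)
    show "AE k in lborel.
        integrable lborel (\<lambda>q. (cmod (case (k, q) of (k, q) \<Rightarrow> f k * g q))\<^sup>2)"
      using g by (simp add: square_integrable_def norm_mult power_mult_distrib)
  qed
  then show ?thesis
    using m by (simp add: square_integrable_def lborel_prod)
qed

lemma AE_lborel_fst:
  assumes "AE x in lborel. P x"
  shows "AE p in (lborel :: ('a::euclidean_space \<times> 'a) measure). P (fst p)"
proof -
  have "AE p in (lborel :: 'a measure) \<Otimes>\<^sub>M (lborel :: 'a measure). P (fst p)"
  proof -
    obtain N where N: "{x. \<not> P x} \<subseteq> N" "N \<in> null_sets lborel"
      using assms by (auto elim!: AE_E simp: null_sets_def)
    have "N \<times> (UNIV :: 'a set) \<in> null_sets (lborel \<Otimes>\<^sub>M lborel)"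
      using N(2) lborel.emeasure_pair_measure_Times[of N lborel UNIV]
      by (auto simp: null_sets_def)
    then show ?thesis
      by (rule AE_I') (use N(1) in auto)
  qed
  then show ?thesis by (simp only: lborel_prod)
qed

lemma AE_lborel_snd:
  assumes "AE x in lborel. P x"
  shows "AE p in (lborel :: ('a::euclidean_space \<times> 'a) measure). P (snd p)"
  using AE_lborel_swap[OF AE_lborel_fst[OF assms]] by simp

lemma block_A_abs_l2:
  fixes \<omega> :: "'a::euclidean_space \<Rightarrow> real"
  assumes w: "continuous_on UNIV \<omega>" "bounded (range \<omega>)" and f: "square_integrable f"
  shows "square_integrable (\<lambda>k. complex_of_real (- \<gamma> + \<omega> k) * f k)" (is ?s)
    and "block_A \<gamma> \<omega> (abs_l2 f) = abs_l2 (\<lambda>k. complex_of_real (- \<gamma> + \<omega> k) * f k)"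
proof -
  have m: "(\<lambda>k. - \<gamma> + \<omega> k) \<in> borel_measurable borel"
    by (intro borel_measurable_continuous_onI continuous_intros w)
  have "range (\<lambda>k. - \<gamma> + \<omega> k) = (+) (- \<gamma>) ` range \<omega>"
    by auto
  then have b: "bounded (range (\<lambda>k. - \<gamma> + \<omega> k))"
    using bounded_translation[OF w(2), of "- \<gamma>"] by metis
  note s = square_integrable_bounded_mult[OF m b]
  show ?s by (rule s[OF f])
  show "block_A \<gamma> \<omega> (abs_l2 f) = abs_l2 (\<lambda>k. complex_of_real (- \<gamma> + \<omega> k) * f k)"
    unfolding block_A_def abs_l2_eq_iff[OF s[OF square_integrable_rep_l2] s[OF f]]
    using rep_abs_l2[OF f] by eventually_elim simp
qed

lemma block_B_abs_l2_sym:
  fixes g :: "'a::euclidean_space \<times> 'a \<Rightarrow> complex"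
  assumes lam: "square_integrable lam"
    and g: "square_integrable g" "AE p in lborel. g p = g (prod.swap p)"
  shows "AE k in lborel. integrable lborel (\<lambda>q. g (k, q) * lam q)"
    and "square_integrable (\<lambda>k. complex_of_real \<alpha> * (LINT q|lborel. g (k, q) * lam q))" (is ?s)
    and "block_B \<alpha> lam (abs_l2_sym g) =
      abs_l2 (\<lambda>k. complex_of_real \<alpha> * (LINT q|lborel. g (k, q) * lam q))"
proof -
  show "AE k in lborel. integrable lborel (\<lambda>q. g (k, q) * lam q)"
    by (rule square_integrable_partial_integral(1)[OF g(1) lam])
  note s = square_integrable_cmult[OF square_integrable_partial_integral(2)[OF _ lam]]
  show ?s by (rule s[OF g(1)])
  have [measurable]: "g \<in> borel_measurable (lborel \<Otimes>\<^sub>M lborel)"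
    "rep_l2_sym h \<in> borel_measurable (lborel \<Otimes>\<^sub>M lborel)"
    "lam \<in> borel_measurable lborel" for h :: "'a l2_sym"
    using g(1) square_integrable_rep_l2_sym[of h] lam by (simp_all add: square_integrable_def lborel_prod)
  have "AE p in lborel \<Otimes>\<^sub>M lborel. rep_l2_sym (abs_l2_sym g) p = g p"
    using rep_abs_l2_sym[OF g] by (simp only: lborel_prod)
  then have "AE k in lborel. AE q in lborel. rep_l2_sym (abs_l2_sym g) (k, q) = g (k, q)"
    by (rule lborel_pair.AE_pair)
  then have "AE k in lborel. complex_of_real \<alpha> * (LINT q|lborel. rep_l2_sym (abs_l2_sym g) (k, q) * lam q)
      = complex_of_real \<alpha> * (LINT q|lborel. g (k, q) * lam q)"
  proof eventually_elim
    case (elim k)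
    have "(LINT q|lborel. rep_l2_sym (abs_l2_sym g) (k, q) * lam q) = (LINT q|lborel. g (k, q) * lam q)"
    proof (rule integral_cong_AE)
      show "AE q in lborel. rep_l2_sym (abs_l2_sym g) (k, q) * lam q = g (k, q) * lam q"
        using elim by eventually_elim simp
    qed measurable
    then show ?case by simp
  qed
  then show "block_B \<alpha> lam (abs_l2_sym g) =
      abs_l2 (\<lambda>k. complex_of_real \<alpha> * (LINT q|lborel. g (k, q) * lam q))"
    unfolding block_B_def abs_l2_eq_iff[OF s[OF square_integrable_rep_l2_sym] s[OF g(1)]] .
qed

lemma abs_l2_sym_eqI:
  assumes "square_integrable f" "square_integrable g" "AE p in lborel. f p = g p"
  shows "abs_l2_sym f = abs_l2_sym g"
  unfolding abs_l2_sym_def abs_l2_eq_iff[THEN iffD2, OF assms] by (rule refl)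

lemma block_C_abs_l2:
  fixes f :: "'a::euclidean_space \<Rightarrow> complex" and \<alpha> :: real
  assumes lam: "square_integrable lam" and f: "square_integrable f"
  defines "G \<equiv> \<lambda>h (k, q). complex_of_real \<alpha> * cnj (lam k) * h q + complex_of_real \<alpha> * cnj (lam q) * h k"
  shows "square_integrable (G f)" "G f (prod.swap p) = G f p"
    and "block_C \<alpha> lam (abs_l2 f) = abs_l2_sym (G f)"
proof -
  have s: "square_integrable (G h)" if h: "square_integrable h" for h
  proof -
    have 1: "square_integrable (\<lambda>k. complex_of_real \<alpha> * cnj (lam k))"
      by (intro square_integrable_cmult square_integrable_cnj lam)
    have "G h = (\<lambda>p. (case p of (k, q) \<Rightarrow> complex_of_real \<alpha> * cnj (lam k) * h q)
        + (case p of (k, q) \<Rightarrow> h k * (complex_of_real \<alpha> * cnj (lam q))))"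
    proof
      fix p :: "'a \<times> 'a"
      obtain k q where "p = (k, q)" by (cases p)
      then show "G h p = (case p of (k, q) \<Rightarrow> complex_of_real \<alpha> * cnj (lam k) * h q)
        + (case p of (k, q) \<Rightarrow> h k * (complex_of_real \<alpha> * cnj (lam q)))"
        by (simp add: G_def)
    qed
    then show ?thesis
      using square_integrable_add[OF square_integrable_tensor[OF 1 h] square_integrable_tensor[OF h 1]]
      by simp
  qed
  show "square_integrable (G f)" by (rule s[OF f])
  show "G f (prod.swap p) = G f p" by (cases p) (simp add: G_def)
  have "AE p in lborel. G (rep_l2 (abs_l2 f)) p = G f p"
    using AE_lborel_fst[OF rep_abs_l2[OF f]] AE_lborel_snd[OF rep_abs_l2[OF f]]
  proof eventually_elim
    case (elim p)
    then show ?case by (cases p) (simp add: G_def)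
  qed
  from abs_l2_sym_eqI[OF s[OF square_integrable_rep_l2] s[OF f] this]
  show "block_C \<alpha> lam (abs_l2 f) = abs_l2_sym (G f)"
    by (simp only: block_C_def G_def)
qed

lemma block_D_abs_l2_sym:
  fixes \<omega> :: "'a::euclidean_space \<Rightarrow> real" and \<gamma> :: real
  assumes w: "continuous_on UNIV \<omega>" "bounded (range \<omega>)"
    and g: "square_integrable g" "AE p in lborel. g p = g (prod.swap p)"
  defines "G \<equiv> \<lambda>h (k, q). complex_of_real (\<gamma> + \<omega> k + \<omega> q) * h (k, q)"
  shows "square_integrable (G g)" "AE p in lborel. G g p = G g (prod.swap p)"
    and "block_D \<gamma> \<omega> (abs_l2_sym g) = abs_l2_sym (G g)"
proof -
  define W where "W = (\<lambda>p. \<gamma> + \<omega> (fst p) + \<omega> (snd p))"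
  have m: "W \<in> borel_measurable borel"
    unfolding W_def
    by (intro borel_measurable_continuous_onI continuous_intros continuous_on_compose2[OF w(1)]) auto
  obtain M where M: "\<And>k. \<bar>\<omega> k\<bar> \<le> M"
    using w(2) by (auto simp: bounded_iff)
  have b: "bounded (range W)"
  proof -
    have "\<bar>W p\<bar> \<le> \<bar>\<gamma>\<bar> + M + M" for p
      using M[of "fst p"] M[of "snd p"] unfolding W_def by linarith
    then show ?thesis by (auto simp: bounded_iff)
  qed
  have G: "G h = (\<lambda>p. complex_of_real (W p) * h p)" for h
    by (auto simp: G_def W_def)
  have s: "square_integrable (G h)" if "square_integrable h" for h
    unfolding G by (rule square_integrable_bounded_mult[OF m b that])
  show "square_integrable (G g)" by (rule s[OF g(1)])
  show "AE p in lborel. G g p = G g (prod.swap p)"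
    using g(2) by eventually_elim (simp add: G W_def)
  have "AE p in lborel. G (rep_l2_sym (abs_l2_sym g)) p = G g p"
    using rep_abs_l2_sym[OF g] by eventually_elim (simp add: G)
  from abs_l2_sym_eqI[OF s[OF square_integrable_rep_l2_sym] s[OF g(1)] this]
  show "block_D \<gamma> \<omega> (abs_l2_sym g) = abs_l2_sym (G g)"
    by (simp only: block_D_def G_def)
qed


section \<open>Square-integrability of quotients\<close>

text \<open>
  Division in \<^typ>\<open>ennreal\<close> satisfies \<open>0 / 0 = 0\<close> and \<open>a / 0 = \<infinity>\<close> for \<open>a \<noteq> 0\<close>.
\<close>

definition quotient_in_L2 :: "('a::euclidean_space \<Rightarrow> complex) \<Rightarrow> ('a \<Rightarrow> real) \<Rightarrow> bool" where
  "quotient_in_L2 lam d \<longleftrightarrow>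
     (\<integral>\<^sup>+ k. (ennreal (cmod (lam k)) / ennreal (d k))\<^sup>2 \<partial>lborel) < \<infinity>"

end

theory Submission
  imports Defs
begin

text \<open>
  Let \<open>m = 2 \<omega>\<^sub>0 + \<gamma>\<close>. For \<open>z < m\<close> the spectral problem reduces to the Schur complement
  \<open>S z = A - z - B (D - z)\<^sup>-\<^sup>1 C\<close>, which is multiplication by a function \<open>\<Delta> z\<close> minus a
  Hilbert--Schmidt operator and strictly decreases in \<open>z\<close>. Moreover \<open>\<Delta> z k = - \<gamma> - \<Phi> (z - \<omega> k)\<close> with
  a strictly increasing \<open>\<Phi>\<close>. If \<open>\<Phi> t = - \<gamma>\<close>, then Weyl sequences put the part of
  \<open>(t + \<omega>\<^sub>0, t + \<omega>\<^sub>1)\<close> below \<open>m\<close> into the spectrum. If there is no root, \<open>\<Delta> z\<close> is positive and there is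
  no essential spectrum below \<open>m\<close>.

  By monotonicity, the kernels of \<open>S\<close> at \<open>N\<close> eigenvalues below (above) \<open>z\<close> span an \<open>N\<close>-dimensional space
  on which \<open>S z\<close> is negative (positive). When \<open>\<Delta> z\<close> has the opposite sign, Bessel's
  inequality bounds \<open>N\<close> by the squared Hilbert--Schmidt norm of \<open>\<bar>\<Delta> z\<bar>\<^sup>-\<^sup>1\<^sup>/\<^sup>2 K z \<bar>\<Delta> z\<bar>\<^sup>-\<^sup>1\<^sup>/\<^sup>2\<close>.
  At the bottom, the kernel of this operator is dominated, uniformly in \<open>z\<close>, by half the product of
  \<open>\<alpha> \<bar>\<lambda>\<bar> / (\<omega> - \<omega>\<^sub>0)\<close> at the two points. The upper edges follow by reflection, since \<open>- \<A>\<close> is unitarily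
  equivalent to the operator for \<open>(- \<gamma>, - \<omega>)\<close>.
\<close>

section \<open>Complex inner product spaces\<close>

text \<open>The essential spectrum is never computed. Two facts about it suffice: an interval filled
  with spectrum has no isolated point and is therefore essential, and without a root there is no
  essential spectrum below \<open>m\<close>. The obstacle is the threshold itself. As
  \<open>z\<close> increases to \<open>m\<close>, the lower bounds of \<open>D - z\<close> and,
  where \<omega> is close to \<open>\<omega>\<^sub>0\<close>, of \<open>\<Delta> z\<close> may
  degenerate, so a count of eigenvalues below each single \<open>z\<close> could grow without limit.
  At the bottom the count has to be uniform in \<open>z\<close>. This is possible because \<Phi> has
  slope at least one, whence \<open>\<Delta> z k \<ge> \<omega> k - \<omega>\<^sub>0\<close>, and
  because \<open>D - z\<close> multiplies by more than the sum of
  \<open>\<omega> - \<omega>\<^sub>0\<close> at the two points, which is at least twice their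
  geometric mean; this 2 is the origin of the half. Away from the bottom there is a root, and when
  its branch ends before \<open>m\<close>, one fixed \<open>z\<close> in between is enough. To the
  right of \<open>m\<close> there is no discrete spectrum nearby, because
  \<open>(m, 2 * \<omega>\<^sub>1 + \<gamma>)\<close> is filled with spectrum.\<close>

lemma cinner_add_right: "cinner x (y + z) = cinner x y + cinner x (z :: 'h::complex_inner)"
  by (subst (1 2 3) cinner_commute) (simp add: cinner_add_left)

lemma cinner_scaleC_right: "cinner x (a *\<^sub>C y) = cnj a * cinner x (y :: 'h::complex_inner)"
  by (subst (1 2) cinner_commute) (simp add: cinner_scaleC_left)

lemma cinner_zero_left [simp]: "cinner 0 (y :: 'h::complex_inner) = 0"
  using cinner_add_left[of 0 0 y] by simp

lemma cinner_zero_right [simp]: "cinner (y :: 'h::complex_inner) 0 = 0"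
  using cinner_add_right[of y 0 0] by simp

lemma cinner_minus_left: "cinner (- x) (y :: 'h::complex_inner) = - cinner x y"
  using cinner_add_left[of x "- x" y] by (simp add: eq_neg_iff_add_eq_0 add.commute)

lemma cinner_minus_right: "cinner y (- x :: 'h::complex_inner) = - cinner y x"
  using cinner_add_right[of y x "- x"] by (simp add: eq_neg_iff_add_eq_0 add.commute)

lemma cinner_diff_left: "cinner (x - y) (z :: 'h::complex_inner) = cinner x z - cinner y z"
  using cinner_add_left[of x "- y" z] by (simp add: cinner_minus_left)

lemma cinner_diff_right: "cinner z (x - y :: 'h::complex_inner) = cinner z x - cinner z y"
  using cinner_add_right[of z x "- y"] by (simp add: cinner_minus_right)

lemma cinner_sum_left: "cinner (\<Sum>i\<in>I. f i) (z :: 'h::complex_inner) = (\<Sum>i\<in>I. cinner (f i) z)"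
  by (induction I rule: infinite_finite_induct) (simp_all add: cinner_add_left)

lemma cinner_sum_right: "cinner (z :: 'h::complex_inner) (\<Sum>i\<in>I. f i) = (\<Sum>i\<in>I. cinner z (f i))"
  by (induction I rule: infinite_finite_induct) (simp_all add: cinner_add_right)

lemmas cinner_simps = cinner_add_left cinner_add_right cinner_diff_left cinner_diff_right
  cinner_minus_left cinner_minus_right cinner_scaleC_left cinner_scaleC_right

lemma cinner_self: "cinner x x = complex_of_real ((norm (x :: 'h::complex_inner))\<^sup>2)"
proof -
  have "Im (cinner x x) = 0"
    using arg_cong[OF cinner_commute[of x x], of Im] by simp
  moreover have "Re (cinner x x) = (norm x)\<^sup>2"
    by (simp add: power2_norm_eq_inner inner_eq_Re_cinner)
  ultimately show ?thesis by (simp add: complex_eq_iff)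
qed

lemma norm_scaleC [simp]: "norm (a *\<^sub>C (x :: 'h::complex_inner)) = cmod a * norm x"
proof -
  have "complex_of_real ((norm (a *\<^sub>C x))\<^sup>2) = (a * cnj a) * cinner x x"
    unfolding cinner_self[symmetric] by (simp add: cinner_scaleC_left cinner_scaleC_right)
  also have "\<dots> = complex_of_real ((cmod a * norm x)\<^sup>2)"
    by (simp only: complex_norm_square[symmetric] cinner_self of_real_mult power_mult_distrib)
  finally have "(norm (a *\<^sub>C x))\<^sup>2 = (cmod a * norm x)\<^sup>2"
    by (simp only: of_real_eq_iff)
  then show ?thesis
    by (simp add: power2_eq_iff_nonneg)
qed

lemma cmod_cinner_le: "cmod (cinner x y) \<le> norm x * norm (y :: 'h::complex_inner)"
proof -
  obtain a where a: "cmod a = 1" "a * cinner x y = complex_of_real (cmod (cinner x y))"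
  proof (cases "cinner x y = 0")
    case False
    then show ?thesis
      by (intro that[of "cnj (cinner x y) / complex_of_real (cmod (cinner x y))"])
         (auto simp: norm_divide complex_norm_square[symmetric] mult.commute power2_eq_square)
  qed (use that[of 1] in auto)
  have "cmod (cinner x y) = inner (a *\<^sub>C x) y"
    by (simp add: inner_eq_Re_cinner cinner_scaleC_left a)
  also have "\<dots> \<le> norm (a *\<^sub>C x) * norm y"
    by (rule norm_cauchy_schwarz)
  finally show ?thesis by (simp add: a)
qed

lemma cinner_ext:
  assumes "\<And>y. cinner x y = cinner x' (y :: 'h::complex_inner)"
  shows "x = x'"
proof -
  have "cinner (x - x') (x - x') = 0"
    by (simp add: cinner_diff_left assms)
  then show ?thesis by (simp add: cinner_self)
qed

text \<open>Lets images of operators be estimated through their pairings, where Fubini's theorem and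
  self-adjointness apply.\<close>

lemma norm_le_cinnerI:
  assumes "\<And>y. cmod (cinner x y) \<le> c * norm (y :: 'h::complex_inner)" and "0 \<le> c"
  shows "norm x \<le> c"
proof (cases "x = 0")
  case False
  have "norm x * norm x \<le> c * norm x"
    using assms(1)[of x] by (simp add: cinner_self norm_mult power2_eq_square)
  then show ?thesis using False by simp
qed (use assms(2) in simp)

definition clinear_map :: "('h::complex_inner \<Rightarrow> 'k::complex_inner) \<Rightarrow> bool" where
  "clinear_map T \<longleftrightarrow> (\<forall>x y. T (x + y) = T x + T y) \<and> (\<forall>a x. T (a *\<^sub>C x) = a *\<^sub>C T x)"

lemma clinear_mapD:
  assumes "clinear_map T"
  shows "T (x + y) = T x + T y" "T (a *\<^sub>C x) = a *\<^sub>C T x" "T 0 = 0" "T (- x) = - T x"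
    "T (x - y) = T x - T y"
proof -
  show add: "T (x + y) = T x + T y" for x y using assms by (simp add: clinear_map_def)
  show "T (a *\<^sub>C x) = a *\<^sub>C T x" using assms by (simp add: clinear_map_def)
  show 0: "T 0 = 0" using add[of 0 0] by simp
  show minus: "T (- x) = - T x" for x using add[of x "- x"] 0 by (simp add: eq_neg_iff_add_eq_0 add.commute)
  show "T (x - y) = T x - T y" using add[of x "- y"] minus[of y] by simp
qed

lemma clinear_map_bounded_linear:
  assumes "clinear_map T" "\<And>x. norm (T x) \<le> K * norm x"
  shows "bounded_linear T"
proof (rule bounded_linear_intro)
  show "T (x + y) = T x + T y" for x y by (rule clinear_mapD(1)[OF assms(1)])
  show "T (r *\<^sub>R x) = r *\<^sub>R T x" for r x
    by (simp add: scaleR_scaleC clinear_mapD(2)[OF assms(1)])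
  show "norm (T x) \<le> norm x * K" for x using assms(2)[of x] by (simp add: mult.commute)
qed

lemma clinear_map_span:
  assumes "clinear_map T"
  shows "complex_vector.span (T ` X) = T ` complex_vector.span X"
proof
  note T = clinear_mapD[OF assms]
  show "T ` complex_vector.span X \<subseteq> complex_vector.span (T ` X)"
  proof safe
    fix x assume "x \<in> complex_vector.span X"
    then show "T x \<in> complex_vector.span (T ` X)"
      by (induction rule: complex_vector.span_induct_alt)
         (auto simp: T intro!: complex_vector.span_zero complex_vector.span_add
            complex_vector.span_scale intro: complex_vector.span_base)
  qed
  have "complex_vector.subspace (T ` complex_vector.span X)"
    unfolding complex_vector.subspace_def
  proof (intro conjI ballI allI)
    show "0 \<in> T ` complex_vector.span X"
      using T(3) complex_vector.span_zero by (metis image_eqI)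
    show "x + y \<in> T ` complex_vector.span X"
      if "x \<in> T ` complex_vector.span X" "y \<in> T ` complex_vector.span X" for x y
      using that by (auto simp flip: T(1) intro: complex_vector.span_add)
    show "a *\<^sub>C x \<in> T ` complex_vector.span X" if "x \<in> T ` complex_vector.span X" for a x
      using that by (auto simp flip: T(2) intro: complex_vector.span_scale)
  qed
  then show "complex_vector.span (T ` X) \<subseteq> T ` complex_vector.span X"
    by (intro complex_vector.span_minimal) (auto intro: complex_vector.span_base)
qed

section \<open>Orthonormal families\<close>

definition orthonormal_on :: "'i set \<Rightarrow> ('i \<Rightarrow> 'h::complex_inner) \<Rightarrow> bool" where
  "orthonormal_on I e \<longleftrightarrow> (\<forall>i\<in>I. \<forall>j\<in>I. cinner (e i) (e j) = (if i = j then 1 else 0))"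

lemma Bessel_inequality:
  fixes x :: "'h::complex_inner"
  assumes "orthonormal_on I e" "finite I"
  shows "(\<Sum>i\<in>I. (cmod (cinner x (e i)))\<^sup>2) \<le> (norm x)\<^sup>2"
proof -
  define p where "p = (\<Sum>i\<in>I. cinner x (e i) *\<^sub>C e i)"
  have xp: "cinner x p = (\<Sum>i\<in>I. complex_of_real ((cmod (cinner x (e i)))\<^sup>2))"
    unfolding p_def cinner_sum_right
    by (intro sum.cong refl) (simp only: cinner_scaleC_right complex_norm_square mult.commute)
  have "cinner p (e j) = cinner x (e j)" if "j \<in> I" for j
  proof -
    have "cinner p (e j) = (\<Sum>i\<in>I. if i = j then cinner x (e j) else 0)"
      unfolding p_def cinner_sum_left
      by (intro sum.cong refl) (use assms(1) that in \<open>auto simp: cinner_scaleC_left orthonormal_on_def\<close>)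
    then show ?thesis using that assms(2) by simp
  qed
  \<comment> \<open>Only the second \<open>p\<close> is expanded; in the first slot the coefficients
    just computed are used.\<close>
  then have pp: "cinner p p = (\<Sum>i\<in>I. complex_of_real ((cmod (cinner x (e i)))\<^sup>2))"
    unfolding p_def[THEN arg_cong[of _ _ "cinner p"]] cinner_sum_right
    by (intro sum.cong refl) (simp only: cinner_scaleC_right complex_norm_square mult.commute)
  have "0 \<le> inner (x - p) (x - p)" by simp
  also have "inner (x - p) (x - p) = inner x x - 2 * inner x p + inner p p"
    by (simp add: inner_diff_left inner_diff_right inner_commute)
  also have "\<dots> = (norm x)\<^sup>2 - (\<Sum>i\<in>I. (cmod (cinner x (e i)))\<^sup>2)"
    unfolding power2_norm_eq_inner[of x] inner_eq_Re_cinner[of x p] inner_eq_Re_cinner[of p p] xp pp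
    by simp
  finally show ?thesis by simp
qed

text \<open>Independence is phrased as avoidance of the span of the predecessors. Eigenvalue
  counting and successive choice in an infinite-dimensional space deliver it in this form, and it is
  exactly what makes the remainder \<open>w\<close> nonzero.\<close>

lemma Gram_Schmidt:
  fixes v :: "nat \<Rightarrow> 'h::complex_inner"
  assumes "\<And>n. n < N \<Longrightarrow> v n \<notin> complex_vector.span (v ` {..<n})"
  shows "\<exists>e. orthonormal_on {..<N} e \<and> (\<forall>i<N. e i \<in> complex_vector.span (v ` {..<N}))"
  using assms
proof (induction N)
  case 0
  then show ?case by (simp add: orthonormal_on_def)
next
  case (Suc N)
  then obtain e where e: "orthonormal_on {..<N} e" "\<And>i. i < N \<Longrightarrow> e i \<in> complex_vector.span (v ` {..<N})"
    by (metis less_Suc_eq)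
  define p where "p = (\<Sum>i<N. cinner (v N) (e i) *\<^sub>C e i)"
  have p: "p \<in> complex_vector.span (v ` {..<N})"
    unfolding p_def by (intro complex_vector.span_sum complex_vector.span_scale e(2)) simp
  define w where "w = v N - p"
  have "w \<noteq> 0" using Suc.prems[of N] p by (auto simp: w_def)
  define u where "u = complex_of_real (1 / norm w) *\<^sub>C w"
  have "cinner w (e j) = 0" if "j < N" for j
  proof -
    have "cinner p (e j) = (\<Sum>i<N. if i = j then cinner (v N) (e j) else 0)"
      unfolding p_def cinner_sum_left
      by (intro sum.cong refl) (use e(1) that in \<open>auto simp: cinner_scaleC_left orthonormal_on_def\<close>)
    then show ?thesis using that by (simp add: w_def cinner_diff_left)
  qed
  then have uj: "cinner u (e j) = 0" if "j < N" for j using that by (simp add: u_def cinner_scaleC_left)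
  then have ju: "cinner (e j) u = 0" if "j < N" for j using that by (subst cinner_commute) simp
  have uu: "cinner u u = 1"
    using \<open>w \<noteq> 0\<close> by (simp add: cinner_self u_def norm_divide)
  have sub: "complex_vector.span (v ` {..<N}) \<subseteq> complex_vector.span (v ` {..<Suc N})"
    by (intro complex_vector.span_mono) auto
  have "u \<in> complex_vector.span (v ` {..<Suc N})"
    unfolding u_def w_def using p sub
    by (intro complex_vector.span_scale complex_vector.span_diff)
       (auto intro: complex_vector.span_base)
  then have "orthonormal_on {..<Suc N} (e(N := u)) \<and>
      (\<forall>i<Suc N. (e(N := u)) i \<in> complex_vector.span (v ` {..<Suc N}))"
    using e sub uu uj ju by (auto simp: orthonormal_on_def less_Suc_eq)
  then show ?case by blast
qed

section \<open>Bounded symmetric operators\<close>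

definition symmetric_op :: "('h::complex_inner \<Rightarrow> 'h) \<Rightarrow> bool" where
  "symmetric_op T \<longleftrightarrow> (\<forall>x y. cinner (T x) y = cinner x (T y))"

text \<open>For small \<open>t\<close>, the map \<open>x \<mapsto> x - t (A x - w)\<close> is a contraction.\<close>

lemma coercive_surj:
  fixes A :: "'h::{real_inner, complete_space} \<Rightarrow> 'h"
  assumes A: "bounded_linear A" and c: "c > 0" and coer: "\<And>x. c * (norm x)\<^sup>2 \<le> inner (A x) x"
  shows "surj A"
proof -
  interpret A: bounded_linear A by (rule A)
  obtain K0 where K0: "K0 > 0" "\<And>x. norm (A x) \<le> norm x * K0"
    using A.pos_bounded by blast
  \<comment> \<open>Adding \<open>c\<close> gives \<open>c < K\<close>, so the radicand in
    \<open>r\<close> is positive.\<close>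
  define K where "K = K0 + c"
  have K: "K > 0" "c < K" "norm (A x) \<le> K * norm x" for x
    using K0(1) K0(2)[of x] c by (simp_all add: K_def algebra_simps add_increasing2)
  \<comment> \<open>This \<open>t\<close> minimises
    \<open>1 - 2 * t * c + t\<^sup>2 * K\<^sup>2\<close>; the minimum is the square of
    \<open>r\<close>.\<close>
  define t where "t = c / K\<^sup>2"
  define r where "r = sqrt (1 - (c / K)\<^sup>2)"
  have cK: "0 < (c / K)\<^sup>2" "(c / K)\<^sup>2 < 1"
    using c K by (simp_all add: power_strict_mono[of "c / K" 1 2, simplified])
  have r: "0 \<le> r" "r < 1" using cK by (simp_all add: r_def real_sqrt_lt_1_iff)
  have contr: "norm (d - t *\<^sub>R A d) \<le> r * norm d" for d
  proof (rule power2_le_imp_le)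
    have "(norm (d - t *\<^sub>R A d))\<^sup>2 = (norm d)\<^sup>2 - 2 * t * inner (A d) d + t\<^sup>2 * (norm (A d))\<^sup>2"
      unfolding power2_norm_eq_inner
      by (simp add: inner_diff_left inner_diff_right inner_commute power2_eq_square)
    also have "\<dots> \<le> (norm d)\<^sup>2 - 2 * t * (c * (norm d)\<^sup>2) + t\<^sup>2 * (K * norm d)\<^sup>2"
      using coer[of d] K c
      by (intro add_mono diff_mono mult_left_mono power_mono) (auto simp: t_def)
    also have "\<dots> = (1 - (c / K)\<^sup>2) * (norm d)\<^sup>2"
      using K(1) by (simp add: t_def field_simps power2_eq_square)
    also have "\<dots> = (r * norm d)\<^sup>2"
      using cK by (simp add: r_def power_mult_distrib)
    finally show "(norm (d - t *\<^sub>R A d))\<^sup>2 \<le> (r * norm d)\<^sup>2" .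
  qed (use r in simp)
  have "\<exists>x. A x = w" for w
  proof -
    define F where "F x = x - t *\<^sub>R (A x - w)" for x
    have "dist (F x) (F y) \<le> r * dist x y" for x y
      using contr[of "x - y"] by (simp add: F_def dist_norm A.diff scaleR_diff_right algebra_simps)
    then have "\<exists>!x. F x = x"
      by (intro banach_fix_type[OF r]) auto
    then obtain x where "F x = x" by blast
    then show ?thesis using c K by (auto simp: F_def t_def)
  qed
  then show ?thesis by (metis surj_def)
qed

text \<open>The lower bound gives injectivity and a bounded inverse; the point is surjectivity for
  complex \<open>z\<close>. By symmetry of \<open>T\<close>, \<open>T - cnj z\<close> is the adjoint
  of \<open>T - z\<close>, so their product is coercive and hence onto; the factors commute, so
  \<open>T - z\<close> is onto as well.\<close>

lemma resolvent_setI: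
  fixes T :: "'h::{complex_inner, complete_space} \<Rightarrow> 'h"
  assumes lin: "clinear_map T" and bdd: "bounded_linear T" and sym: "symmetric_op T"
    and c: "c > 0" and bound: "\<And>x. c * norm x \<le> norm (T x - z *\<^sub>C x)"
  shows "z \<in> resolvent_set T"
proof -
  note Tl = clinear_mapD[OF lin]
  have blc: "bounded_linear (\<lambda>x. T x - a *\<^sub>C x)" for a
  proof (intro bounded_linear_sub bdd clinear_map_bounded_linear)
    show "clinear_map (\<lambda>x. a *\<^sub>C x :: 'h)"
      by (simp add: clinear_map_def scaleC_add_right scaleC_scaleC mult.commute)
    show "norm (a *\<^sub>C x) \<le> cmod a * norm x" for x :: 'h by simp
  qed
  define S where "S a x = T x - a *\<^sub>C x" for a x
  have adj: "cinner (S (cnj a) x) y = cinner x (S a y)" for a x y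
    using sym by (simp add: S_def symmetric_op_def cinner_simps)
  have comm: "S a (S b x) = S b (S a x)" for a b x
    by (simp add: S_def Tl complex_vector.scale_right_diff_distrib scaleC_scaleC mult.commute algebra_simps)
  have bl: "bounded_linear (S a)" for a
    using blc by (simp add: S_def[abs_def])
  have "c\<^sup>2 * (norm x)\<^sup>2 \<le> inner (S (cnj z) (S z x)) x" for x
  proof -
    have "inner (S (cnj z) (S z x)) x = (norm (S z x))\<^sup>2"
      by (simp only: inner_eq_Re_cinner adj cinner_self Re_complex_of_real)
    then show ?thesis
      using bound[of x] c by (simp add: S_def power_mult_distrib[symmetric] power_mono)
  qed
  then have "surj (\<lambda>x. S (cnj z) (S z x))"
    by (intro coercive_surj[of _ "c\<^sup>2"] bounded_linear_compose[OF bl bl]) (use c in auto)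
  then have surj: "surj (S z)"
    unfolding comm[of "cnj z"] surj_def by blast
  have inj: "inj (S z)"
  proof (rule injI)
    fix x y assume "S z x = S z y"
    then have "S z (x - y) = 0" by (simp add: linear_diff[OF bounded_linear.linear[OF bl]])
    then have "c * norm (x - y) \<le> 0" using bound[of "x - y"] by (simp add: S_def)
    then show "x = y" using c by (simp add: mult_le_0_iff)
  qed
  have bij: "bij (S z)" using surj inj by (rule bijI[rotated])
  have S_inv: "S z (inv (S z) y) = y" for y by (rule surj_f_inv_f[OF surj])
  interpret S: bounded_linear "S z" by (rule bl)
  have "bounded_linear (inv (S z))"
  proof (rule bounded_linear_intro)
    show "inv (S z) (x + y) = inv (S z) x + inv (S z) y" for x y
      by (rule injD[OF inj]) (simp add: S_inv S.add)
    show "inv (S z) (r *\<^sub>R x) = r *\<^sub>R inv (S z) x" for r x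
      by (rule injD[OF inj]) (simp add: S_inv S.scaleR)
    show "norm (inv (S z) y) \<le> norm y * (1 / c)" for y
    proof -
      have "c * norm (inv (S z) y) \<le> norm y"
        using bound[of "inv (S z) y"] S_inv[of y] by (simp add: S_def)
      then show ?thesis using c by (simp add: field_simps)
    qed
  qed
  then show ?thesis using bij by (simp add: resolvent_set_def S_def[abs_def])
qed

lemma spectrumI:
  assumes approx: "\<And>\<epsilon>. \<epsilon> > 0 \<Longrightarrow> \<exists>x. x \<noteq> 0 \<and> norm (T x - z *\<^sub>C x) \<le> \<epsilon> * norm x"
  shows "z \<in> spectrum T"
proof (rule ccontr)
  define S where "S = (\<lambda>x. T x - z *\<^sub>C x)"
  assume "z \<notin> spectrum T"
  then have S: "bij S" "bounded_linear (inv S)"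
    by (auto simp: spectrum_def resolvent_set_def S_def)
  obtain K where K: "K > 0" "\<And>y. norm (inv S y) \<le> norm y * K"
    using bounded_linear.pos_bounded[OF S(2)] by blast
  obtain x where x: "x \<noteq> 0" "norm (S x) \<le> 1 / (2 * K) * norm x"
    using approx[of "1 / (2 * K)"] K(1) by (auto simp: S_def)
  have "norm x \<le> norm (S x) * K"
    using K(2)[of "S x"] S(1) by (simp add: bij_is_inj inv_f_f)
  also have "\<dots> \<le> (1 / (2 * K) * norm x) * K"
    using x(2) K(1) by (intro mult_right_mono) auto
  finally show False using K(1) x(1) by simp
qed

lemma spectrum_approx_eigenvector:
  fixes T :: "'h::{complex_inner, complete_space} \<Rightarrow> 'h"
  assumes "clinear_map T" "bounded_linear T" "symmetric_op T" "z \<in> spectrum T" "\<epsilon> > 0"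
  shows "\<exists>x. norm x = 1 \<and> norm (T x - z *\<^sub>C x) < \<epsilon>"
proof (rule ccontr)
  assume *: "\<not> ?thesis"
  note T = clinear_mapD[OF assms(1)]
  have "\<epsilon> * norm x \<le> norm (T x - z *\<^sub>C x)" for x
  proof (cases "x = 0")
    case False
    define a where "a = complex_of_real (1 / norm x)"
    have "norm (a *\<^sub>C x) = 1" using False by (simp add: a_def norm_divide)
    then have "\<epsilon> \<le> norm (T (a *\<^sub>C x) - z *\<^sub>C a *\<^sub>C x)" using * by (meson not_less)
    also have "T (a *\<^sub>C x) - z *\<^sub>C a *\<^sub>C x = a *\<^sub>C (T x - z *\<^sub>C x)"
      by (simp add: T complex_vector.scale_right_diff_distrib scaleC_scaleC mult.commute)
    finally have "\<epsilon> \<le> 1 / norm x * norm (T x - z *\<^sub>C x)"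
      by (simp only: norm_scaleC) (simp add: a_def norm_divide)
    then show ?thesis using False by (simp add: field_simps)
  qed simp
  then have "z \<in> resolvent_set T"
    using assms by (intro resolvent_setI[of T \<epsilon>]) auto
  then show False using assms(4) by (simp add: spectrum_def)
qed

lemma symmetric_op_Im: "symmetric_op T \<Longrightarrow> Im (cinner (T x) x) = 0"
  using arg_cong[OF cinner_commute[of "T x" x], of Im] by (simp add: symmetric_op_def)

lemma symmetric_op_eigenvalue_real:
  assumes "symmetric_op T" "T x = z *\<^sub>C x" "x \<noteq> 0"
  shows "Im z = 0"
  using symmetric_op_Im[OF assms(1), of x] assms(2,3) by (simp add: cinner_simps cinner_self)

lemma symmetric_op_spectrum_real:
  fixes T :: "'h::{complex_inner, complete_space} \<Rightarrow> 'h"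
  assumes "clinear_map T" "bounded_linear T" "symmetric_op T" "z \<in> spectrum T"
  shows "Im z = 0"
proof (rule ccontr)
  assume "Im z \<noteq> 0"
  then obtain x where x: "norm x = 1" "norm (T x - z *\<^sub>C x) < \<bar>Im z\<bar>"
    using spectrum_approx_eigenvector[OF assms, of "\<bar>Im z\<bar>"] by auto
  have "Im (cinner (T x - z *\<^sub>C x) x) = - Im z"
    using symmetric_op_Im[OF assms(3), of x] x(1) by (simp add: cinner_simps cinner_self)
  then have "\<bar>Im z\<bar> \<le> cmod (cinner (T x - z *\<^sub>C x) x)"
    using abs_Im_le_cmod[of "cinner (T x - z *\<^sub>C x) x"] by simp
  also have "\<dots> \<le> norm (T x - z *\<^sub>C x)"
    using cmod_cinner_le[of "T x - z *\<^sub>C x" x] x(1) by simp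
  finally show False using x(2) by simp
qed

lemma symmetric_op_eigenvectors_orthogonal:
  assumes "symmetric_op T" "T x = complex_of_real a *\<^sub>C x" "T y = complex_of_real b *\<^sub>C y" "a \<noteq> b"
  shows "cinner x y = 0"
proof -
  have "complex_of_real a * cinner x y = complex_of_real b * cinner x y"
    using assms(1)[unfolded symmetric_op_def, rule_format, of x y] assms(2,3)
    by (simp add: cinner_simps)
  then show ?thesis using assms(4) by simp
qed

section \<open>Operators bounded below up to finite rank\<close>

text \<open>Bolzano--Weierstrass, one scalar sequence at a time. It will be applied to the finitely
  many coefficients \<open>cinner (x n) (e i)\<close>.\<close>

lemma convergent_finite_subsequence:
  fixes f :: "nat \<Rightarrow> nat \<Rightarrow> complex"
  assumes "\<And>i n. i < r \<Longrightarrow> cmod (f i n) \<le> K i"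
  shows "\<exists>\<sigma>. strict_mono \<sigma> \<and> (\<forall>i<r. convergent (f i \<circ> \<sigma>))"
  using assms
proof (induction r)
  case 0
  then show ?case using strict_mono_id by blast
next
  case (Suc r)
  then obtain \<sigma> where \<sigma>: "strict_mono \<sigma>" "\<And>i. i < r \<Longrightarrow> convergent (f i \<circ> \<sigma>)"
    by (metis less_Suc_eq)
  have "bounded (range (f r \<circ> \<sigma>))"
    using Suc.prems[of r] by (auto simp: bounded_iff)
  then obtain l \<rho> where \<rho>: "strict_mono \<rho>" "((f r \<circ> \<sigma>) \<circ> \<rho>) \<longlonglongrightarrow> l"
    using bounded_imp_convergent_subsequence by blast
  have "convergent (f i \<circ> (\<sigma> \<circ> \<rho>))" if "i < Suc r" for i
  proof (cases "i = r")
    case True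
    then show ?thesis using \<rho>(2) by (auto simp: convergent_def o_assoc)
  next
    case False
    then show ?thesis
      using convergent_subseq_convergent[OF \<sigma>(2) \<rho>(1), of i] that by (simp add: o_assoc)
  qed
  then show ?case using strict_mono_o[OF \<sigma>(1) \<rho>(1)] by blast
qed

lemma sequence_outside_spans:
  assumes "\<not> finite_dimensional S"
  shows "\<exists>v :: nat \<Rightarrow> 'h::complex_inner. \<forall>n<N. v n \<in> S \<and> v n \<notin> complex_vector.span (v ` {..<n})"
proof (induction N)
  case (Suc N)
  then obtain v :: "nat \<Rightarrow> 'h" where v: "\<And>n. n < N \<Longrightarrow> v n \<in> S \<and> v n \<notin> complex_vector.span (v ` {..<n})"
    by blast
  obtain x where x: "x \<in> S" "x \<notin> complex_vector.span (v ` {..<N})"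
    using assms unfolding finite_dimensional_def by (metis finite_imageI finite_lessThan subsetI)
  have im: "(v(N := x)) ` {..<n} = v ` {..<n}" if "n \<le> N" for n
    using that by (intro image_cong) auto
  have "(v(N := x)) n \<in> S \<and> (v(N := x)) n \<notin> complex_vector.span ((v(N := x)) ` {..<n})" if "n < Suc N" for n
    using that v[of n] x im[of n] by (cases "n = N") auto
  then show ?case by blast
qed simp

text \<open>Double counting: after the sums are interchanged, Bessel's inequality for the
  orthonormal \<open>u j\<close> bounds the contribution of each \<open>e i\<close>.\<close>

lemma orthonormal_card_bound:
  assumes "orthonormal_on J u" "finite J"
    and "\<And>j. j \<in> J \<Longrightarrow> \<delta> \<le> (\<Sum>i<r. (cmod (cinner (u j) (e i)))\<^sup>2)"
  shows "real (card J) * \<delta> \<le> (\<Sum>i<r. (norm (e i))\<^sup>2)"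
proof -
  have "real (card J) * \<delta> = (\<Sum>j\<in>J. \<delta>)" by simp
  also have "\<dots> \<le> (\<Sum>j\<in>J. \<Sum>i<r. (cmod (cinner (u j) (e i)))\<^sup>2)"
    by (intro sum_mono assms(3))
  also have "\<dots> = (\<Sum>i<r. \<Sum>j\<in>J. (cmod (cinner (e i) (u j)))\<^sup>2)"
    by (subst sum.swap, subst cinner_commute) simp
  also have "\<dots> \<le> (\<Sum>i<r. (norm (e i))\<^sup>2)"
    by (intro sum_mono Bessel_inequality assms)
  finally show ?thesis .
qed

text \<open>The inequality says that \<open>T\<close> plus the positive finite-rank operator mapping
  \<open>x\<close> to the sum of the \<open>cinner x (e i) *\<^sub>C e i\<close> is at least
  \<open>b\<close>. Hence \<open>T\<close> has only discrete spectrum below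
  \<open>b\<close>.\<close>

locale finite_rank_bounded_below =
  fixes T :: "'h::{complex_inner, complete_space} \<Rightarrow> 'h" and b :: real and r :: nat and e :: "nat \<Rightarrow> 'h"
  assumes lin: "clinear_map T" and bdd: "bounded_linear T" and sym: "symmetric_op T"
    and below: "\<And>x. b * (norm x)\<^sup>2 \<le> inner (T x) x + (\<Sum>i<r. (cmod (cinner x (e i)))\<^sup>2)"
begin

text \<open>Approximate eigenvectors become Cauchy along a subsequence: on differences, the form
  inequality bounds \<open>b - y\<close> times the squared distance by the residuals and by
  differences of the finite-rank coefficients, and both tend to 0.\<close>

lemma eigenvector_exists:
  assumes y: "y < b" "complex_of_real y \<in> spectrum T"
  shows "\<exists>x. norm x = 1 \<and> T x = complex_of_real y *\<^sub>C x"
proof -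
  define S where "S x = T x - complex_of_real y *\<^sub>C x" for x
  have blS: "bounded_linear S"
    unfolding S_def scaleR_scaleC[symmetric]
    by (intro bounded_linear_sub bdd bounded_linear_scaleR_right)
  interpret S: bounded_linear S by (rule blS)
  have "\<exists>x. norm x = 1 \<and> norm (S x) < 1 / real (Suc n)" for n
    using spectrum_approx_eigenvector[OF lin bdd sym y(2), of "1 / real (Suc n)"] by (simp add: S_def)
  then obtain x where x: "\<And>n. norm (x n) = 1" "\<And>n. norm (S (x n)) < 1 / real (Suc n)"
    by metis
  have "cmod (cinner (x n) (e i)) \<le> norm (e i)" for n i
    using cmod_cinner_le[of "x n" "e i"] x(1)[of n] by simp
  then obtain \<sigma> where \<sigma>: "strict_mono \<sigma>" "\<And>i. i < r \<Longrightarrow> convergent ((\<lambda>n. cinner (x n) (e i)) \<circ> \<sigma>)"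
    using convergent_finite_subsequence[of r "\<lambda>i n. cinner (x n) (e i)" "\<lambda>i. norm (e i)"] by blast
  define l where "l i = lim ((\<lambda>n. cinner (x n) (e i)) \<circ> \<sigma>)" for i
  have l: "(\<lambda>n. cinner (x (\<sigma> n)) (e i)) \<longlonglongrightarrow> l i" if "i < r" for i
    using \<sigma>(2)[OF that] unfolding l_def convergent_LIMSEQ_iff by (simp add: o_def)
  \<comment> \<open>Chosen so that the estimate for a difference splits as
    \<open>\<beta> n + \<beta> m\<close>: the factors 2 come from \<open>\<bar>p - q\<bar>\<^sup>2
    \<le> 2 \<bar>p\<bar>\<^sup>2 + 2 \<bar>q\<bar>\<^sup>2\<close> and from
    \<open>norm d \<le> 2\<close>.\<close>
  define \<beta> where "\<beta> n = 2 * (\<Sum>i<r. (cmod (cinner (x (\<sigma> n)) (e i) - l i))\<^sup>2) + 2 * norm (S (x (\<sigma> n)))" for n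
  have Sx0: "(\<lambda>n. S (x n)) \<longlonglongrightarrow> 0"
    by (rule Lim_null_comparison[OF _ LIMSEQ_inverse_real_of_nat])
       (use x(2) in \<open>auto intro!: always_eventually less_imp_le simp: inverse_eq_divide\<close>)
  have Sx0': "(\<lambda>n. S (x (\<sigma> n))) \<longlonglongrightarrow> 0"
    using LIMSEQ_subseq_LIMSEQ[OF Sx0 \<sigma>(1)] by (simp add: o_def)
  have "\<beta> \<longlonglongrightarrow> 2 * (\<Sum>i<r. (cmod (l i - l i))\<^sup>2) + 2 * norm (0 :: 'h)"
    unfolding \<beta>_def by (intro tendsto_intros l Sx0') auto
  then have \<beta>: "\<beta> \<longlonglongrightarrow> 0" by simp
  have diff: "(b - y) * (norm (x (\<sigma> n) - x (\<sigma> m)))\<^sup>2 \<le> \<beta> n + \<beta> m" for n m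
  proof -
    define d where "d = x (\<sigma> n) - x (\<sigma> m)"
    have "(b - y) * (norm d)\<^sup>2 \<le> inner (S d) d + (\<Sum>i<r. (cmod (cinner d (e i)))\<^sup>2)"
      using below[of d] by (simp add: S_def inner_diff_left scaleR_scaleC[symmetric] power2_norm_eq_inner algebra_simps)
    also have "inner (S d) d \<le> (norm (S (x (\<sigma> n))) + norm (S (x (\<sigma> m)))) * 2"
    proof -
      have "inner (S d) d \<le> norm (S d) * norm d" by (rule norm_cauchy_schwarz)
      also have "\<dots> \<le> (norm (S (x (\<sigma> n))) + norm (S (x (\<sigma> m)))) * 2"
      proof (intro mult_mono)
        show "norm (S d) \<le> norm (S (x (\<sigma> n))) + norm (S (x (\<sigma> m)))"
          unfolding d_def S.diff by (rule norm_triangle_ineq4)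
        show "norm d \<le> 2"
          using norm_triangle_ineq4[of "x (\<sigma> n)" "x (\<sigma> m)"] x(1) by (simp add: d_def)
      qed auto
      finally show ?thesis .
    qed
    also have "(\<Sum>i<r. (cmod (cinner d (e i)))\<^sup>2) \<le> (\<Sum>i<r. 2 * (cmod (cinner (x (\<sigma> n)) (e i) - l i))\<^sup>2
        + 2 * (cmod (cinner (x (\<sigma> m)) (e i) - l i))\<^sup>2)"
    proof (rule sum_mono)
      fix i
      define p q where "p = cinner (x (\<sigma> n)) (e i) - l i" and "q = cinner (x (\<sigma> m)) (e i) - l i"
      have "cmod (cinner d (e i)) = cmod (p - q)" by (simp add: d_def p_def q_def cinner_diff_left)
      also have "\<dots> \<le> cmod p + cmod q" by (rule norm_triangle_ineq4)
      finally have "(cmod (cinner d (e i)))\<^sup>2 \<le> (cmod p + cmod q)\<^sup>2" by (intro power_mono) auto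
      also have "\<dots> \<le> 2 * (cmod p)\<^sup>2 + 2 * (cmod q)\<^sup>2"
        using sum_squares_bound[of "cmod p" "cmod q"] by (simp add: power2_sum)
      finally show "(cmod (cinner d (e i)))\<^sup>2 \<le> 2 * (cmod p)\<^sup>2 + 2 * (cmod q)\<^sup>2" .
    qed
    finally show ?thesis by (simp add: \<beta>_def d_def sum.distrib sum_distrib_left)
  qed
  have "Cauchy (\<lambda>n. x (\<sigma> n))"
  proof (rule metric_CauchyI)
    fix \<epsilon> :: real assume \<epsilon>: "0 < \<epsilon>"
    have "0 < (b - y) * \<epsilon>\<^sup>2 / 2" using y(1) \<epsilon> by simp
    then have "eventually (\<lambda>n. \<beta> n < (b - y) * \<epsilon>\<^sup>2 / 2) sequentially"
      using \<beta> by (rule order_tendstoD(2)[rotated])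
    then obtain N where N: "\<And>n. n \<ge> N \<Longrightarrow> \<beta> n < (b - y) * \<epsilon>\<^sup>2 / 2"
      by (auto simp: eventually_sequentially)
    have "dist (x (\<sigma> m)) (x (\<sigma> n)) < \<epsilon>" if "m \<ge> N" "n \<ge> N" for m n
    proof -
      have "(b - y) * (norm (x (\<sigma> m) - x (\<sigma> n)))\<^sup>2 < (b - y) * \<epsilon>\<^sup>2"
        using diff[of m n] N[OF that(1)] N[OF that(2)] by linarith
      then have "(norm (x (\<sigma> m) - x (\<sigma> n)))\<^sup>2 < \<epsilon>\<^sup>2"
        using y(1) by simp
      then show ?thesis using \<epsilon> power2_less_imp_less by (fastforce simp: dist_norm)
    qed
    then show "\<exists>M. \<forall>m\<ge>M. \<forall>n\<ge>M. dist (x (\<sigma> m)) (x (\<sigma> n)) < \<epsilon>" by blast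
  qed
  then obtain u where u: "(\<lambda>n. x (\<sigma> n)) \<longlonglongrightarrow> u"
    using Cauchy_convergent unfolding convergent_def by blast
  have "norm u = 1"
    using tendsto_norm[OF u] x(1) by (simp add: LIMSEQ_const_iff)
  moreover have "S u = 0"
    using LIMSEQ_unique[OF S.tendsto[OF u] Sx0'] .
  ultimately show ?thesis by (auto simp: S_def)
qed

lemma eigenvector_estimate:
  assumes "T x = complex_of_real y *\<^sub>C x" "norm x = 1"
  shows "b - y \<le> (\<Sum>i<r. (cmod (cinner x (e i)))\<^sup>2)"
  using below[of x] assms by (simp add: scaleR_scaleC[symmetric] power2_norm_eq_inner[symmetric])

text \<open>Unit eigenvectors at distinct points are orthogonal, and on each of them the finite-rank
  form is at least \<open>b - y\<close>, so \<open>orthonormal_card_bound\<close> limits their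
  number.\<close>

lemma finite_spectrum_below:
  assumes "y < b"
  shows "finite {t. t \<le> y \<and> complex_of_real t \<in> spectrum T}" (is "finite ?P")
proof -
  obtain u where u: "\<And>t. t \<in> ?P \<Longrightarrow> norm (u t) = 1 \<and> T (u t) = complex_of_real t *\<^sub>C u t"
    using eigenvector_exists assms by (metis (mono_tags, lifting) mem_Collect_eq order_le_less_trans)
  define Q where "Q = (\<Sum>i<r. (norm (e i))\<^sup>2)"
  have "card G \<le> nat \<lceil>Q / (b - y)\<rceil>" if G: "G \<subseteq> ?P" "finite G" for G
  proof -
    have "orthonormal_on G u"
      unfolding orthonormal_on_def
    proof (intro ballI)
      fix s t assume st: "s \<in> G" "t \<in> G"
      then have "norm (u s) = 1" "T (u s) = complex_of_real s *\<^sub>C u s" "T (u t) = complex_of_real t *\<^sub>C u t"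
        using u[of s] u[of t] G by auto
      then show "cinner (u s) (u t) = (if s = t then 1 else 0)"
        using symmetric_op_eigenvectors_orthogonal[OF sym, of "u s" s "u t" t] by (auto simp: cinner_self)
    qed
    moreover have "b - y \<le> (\<Sum>i<r. (cmod (cinner (u t) (e i)))\<^sup>2)" if "t \<in> G" for t
      using eigenvector_estimate[of "u t" t] u[of t] G that by fastforce
    ultimately have "real (card G) * (b - y) \<le> Q"
      unfolding Q_def by (intro orthonormal_card_bound[of G u] G)
    then have "real (card G) \<le> Q / (b - y)" using assms by (simp add: field_simps)
    then show ?thesis by linarith
  qed
  then show ?thesis using finite_if_finite_subsets_card_bdd by blast
qed

lemma finite_dimensional_eigenspace:
  assumes "y < b"
  shows "finite_dimensional (eigenspace T (complex_of_real y))"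
proof (rule ccontr)
  define E where "E = eigenspace T (complex_of_real y)"
  note Tl = clinear_mapD[OF lin]
  have E: "complex_vector.subspace E"
    by (simp add: E_def eigenspace_def complex_vector.subspace_def Tl scaleC_add_right scaleC_scaleC mult.commute)
  define Q where "Q = (\<Sum>i<r. (norm (e i))\<^sup>2)"
  \<comment> \<open>More than the counting bound \<open>Q / (b - y)\<close> allows.\<close>
  define N where "N = nat \<lfloor>Q / (b - y)\<rfloor> + 1"
  assume "\<not> finite_dimensional (eigenspace T (complex_of_real y))"
  then obtain v where v: "\<And>n. n < N \<Longrightarrow> v n \<in> E \<and> v n \<notin> complex_vector.span (v ` {..<n})"
    using sequence_outside_spans[of E N] unfolding E_def by blast
  have span: "complex_vector.span (v ` {..<N}) \<subseteq> E"
    using v E by (intro complex_vector.span_minimal) auto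
  obtain u where u: "orthonormal_on {..<N} u" "\<And>i. i < N \<Longrightarrow> u i \<in> complex_vector.span (v ` {..<N})"
    using Gram_Schmidt[of N v] v by blast
  have "b - y \<le> (\<Sum>i<r. (cmod (cinner (u j) (e i)))\<^sup>2)" if "j < N" for j
  proof (rule eigenvector_estimate)
    show "T (u j) = complex_of_real y *\<^sub>C u j"
      using u(2)[OF that] span by (auto simp: E_def eigenspace_def)
    have "complex_of_real ((norm (u j))\<^sup>2) = 1"
      unfolding cinner_self[symmetric] using u(1) that by (simp add: orthonormal_on_def)
    then have "(norm (u j))\<^sup>2 = 1" using of_real_eq_1_iff by metis
    then show "norm (u j) = 1" by (simp add: power2_eq_1_iff) (smt (verit) norm_ge_zero)
  qed
  then have "real (card {..<N}) * (b - y) \<le> Q"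
    unfolding Q_def by (intro orthonormal_card_bound[of _ u] u(1)) auto
  then have "real N \<le> Q / (b - y)" using assms by (simp add: field_simps)
  then show False unfolding N_def by linarith
qed

lemma not_essential_spectrum:
  assumes "y < b"
  shows "complex_of_real y \<notin> essential_spectrum T"
proof
  assume "complex_of_real y \<in> essential_spectrum T"
  then have y: "complex_of_real y \<in> spectrum T" "complex_of_real y \<notin> discrete_spectrum T"
    by (auto simp: essential_spectrum_def)
  obtain x where x: "norm x = 1" "T x = complex_of_real y *\<^sub>C x"
    using eigenvector_exists[OF assms y(1)] by blast
  then have "x \<in> eigenspace T (complex_of_real y)" "x \<noteq> 0" by (auto simp: eigenspace_def)
  then have "eigenspace T (complex_of_real y) \<noteq> {0}" by blast
  moreover have "complex_of_real y isolated_in spectrum T"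
  proof -
    \<comment> \<open>The room between \<open>y\<close> and \<open>b\<close> yields an isolating
      neighbourhood: a half-plane with the finitely many other spectral points up to
      \<open>y'\<close> removed.\<close>
    obtain y' where y': "y < y'" "y' < b" using dense[OF assms] by blast
    define P where "P = {t. t \<le> y' \<and> complex_of_real t \<in> spectrum T}"
    define U where "U = {z. Re z < y'} - complex_of_real ` (P - {y})"
    have "finite P" unfolding P_def by (rule finite_spectrum_below[OF y'(2)])
    then have "open U"
      unfolding U_def by (intro open_Diff open_halfspace_Re_lt finite_imp_closed) auto
    moreover have "U \<inter> spectrum T = {complex_of_real y}"
    proof (intro equalityI subsetI)
      fix z assume z: "z \<in> U \<inter> spectrum T"
      then have "z = complex_of_real (Re z)"
        using symmetric_op_spectrum_real[OF lin bdd sym, of z] by (simp add: complex_eq_iff)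
      moreover from this have "Re z \<in> P" using z by (simp add: P_def U_def)
      ultimately show "z \<in> {complex_of_real y}" using z by (auto simp: U_def)
    qed (use y y' in \<open>auto simp: U_def\<close>)
    ultimately show ?thesis using y(1) by (auto simp: isolated_in_def)
  qed
  ultimately show False
    using y(2) finite_dimensional_eigenspace[OF assms] by (simp add: discrete_spectrum_def)
qed

end

section \<open>Completeness of the spaces of square-integrable functions\<close>

lemma cinner_abs_l2:
  assumes "square_integrable f" "square_integrable g"
  shows "cinner (abs_l2 f) (abs_l2 g) = (LINT x|lborel. f x * cnj (g x))"
  by (intro cinner_l2.abs_eq) (use assms in \<open>simp_all add: l2_eq_def\<close>)

lemma cinner_rep_l2: "cinner f g = (LINT x|lborel. rep_l2 f x * cnj (rep_l2 g x))"
  using cinner_abs_l2[OF square_integrable_rep_l2 square_integrable_rep_l2, of f g] by (simp add: abs_rep_l2)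

lemma norm_abs_l2:
  assumes "square_integrable f"
  shows "(norm (abs_l2 f))\<^sup>2 = (LINT x|lborel. (cmod (f x))\<^sup>2)"
proof -
  have "complex_of_real ((norm (abs_l2 f))\<^sup>2) = (LINT x|lborel. complex_of_real ((cmod (f x))\<^sup>2))"
    unfolding cinner_self[symmetric] cinner_abs_l2[OF assms assms] complex_norm_square ..
  then show ?thesis by (simp only: integral_complex_of_real of_real_eq_iff)
qed

lemma rep_l2_measurable [measurable]: "rep_l2 f \<in> borel_measurable borel"
  by (rule square_integrable_measurable[OF square_integrable_rep_l2])

lemma l2_eqI:
  assumes "AE x in lborel. rep_l2 f x = rep_l2 g x"
  shows "f = g"
  using assms abs_l2_eq_iff[OF square_integrable_rep_l2 square_integrable_rep_l2, of f g]
  by (simp add: abs_rep_l2)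

lemma abs_l2_add:
  assumes "square_integrable f" "square_integrable g"
  shows "abs_l2 f + abs_l2 g = abs_l2 (\<lambda>x. f x + g x)"
  by (intro plus_l2.abs_eq) (use assms in \<open>simp_all add: l2_eq_def\<close>)

lemma abs_l2_scaleC:
  assumes "square_integrable f"
  shows "a *\<^sub>C abs_l2 f = abs_l2 (\<lambda>x. a * f x)"
  by (intro scaleC_l2.abs_eq) (use assms in \<open>simp_all add: l2_eq_def\<close>)

lemma rep_l2_add: "AE x in lborel. rep_l2 (f + g) x = rep_l2 f x + rep_l2 g x"
  using abs_l2_add[OF square_integrable_rep_l2 square_integrable_rep_l2, of f g]
    rep_abs_l2[OF square_integrable_add[OF square_integrable_rep_l2 square_integrable_rep_l2], of f g]
  by (simp add: abs_rep_l2)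

lemma rep_l2_scaleC: "AE x in lborel. rep_l2 (a *\<^sub>C f) x = a * rep_l2 f x"
  using abs_l2_scaleC[OF square_integrable_rep_l2, of a f]
    rep_abs_l2[OF square_integrable_cmult[OF square_integrable_rep_l2], of a f]
  by (simp add: abs_rep_l2)

lemma rep_l2_diff: "AE x in lborel. rep_l2 (f - g) x = rep_l2 f x - rep_l2 g x"
proof -
  have eq: "f - g = f + (- 1) *\<^sub>C g"
    by (simp add: complex_vector.scale_minus_left)
  show ?thesis
    unfolding eq using rep_l2_add[of f "(- 1) *\<^sub>C g"] rep_l2_scaleC[of "- 1" g]
    by eventually_elim simp
qed

lemma nn_integral_norm_l2:
  "(\<integral>\<^sup>+x. ennreal ((cmod (rep_l2 f x))\<^sup>2) \<partial>lborel) = ennreal ((norm f)\<^sup>2)"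
  using norm_abs_l2[OF square_integrable_rep_l2, of f] square_integrable_rep_l2[of f]
  by (simp add: abs_rep_l2 nn_integral_eq_integral square_integrable_def)

lemma nn_integral_dist_l2:
  "(\<integral>\<^sup>+x. ennreal ((cmod (rep_l2 f x - rep_l2 g x))\<^sup>2) \<partial>lborel) = ennreal ((dist f g)\<^sup>2)"
proof -
  have "(\<integral>\<^sup>+x. ennreal ((cmod (rep_l2 f x - rep_l2 g x))\<^sup>2) \<partial>lborel)
      = (\<integral>\<^sup>+x. ennreal ((cmod (rep_l2 (f - g) x))\<^sup>2) \<partial>lborel)"
    by (rule nn_integral_cong_AE) (use rep_l2_diff[of f g] in \<open>eventually_elim, simp\<close>)
  then show ?thesis by (simp add: nn_integral_norm_l2 dist_norm)
qed

lemma rapidly_Cauchy_subsequence: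
  fixes X :: "nat \<Rightarrow> 'm::metric_space" and c :: "nat \<Rightarrow> real"
  assumes "Cauchy X" and pos: "\<And>n. 0 < c n"
  obtains \<sigma> where "strict_mono \<sigma>" "\<And>n m. m \<ge> n \<Longrightarrow> dist (X (\<sigma> n)) (X (\<sigma> m)) < c n"
proof -
  have "\<exists>N. \<forall>m\<ge>N. \<forall>k\<ge>N. dist (X m) (X k) < c n" for n
    using assms by (auto simp: Cauchy_def)
  then obtain N where N: "\<And>n m k. m \<ge> N n \<Longrightarrow> k \<ge> N n \<Longrightarrow> dist (X m) (X k) < c n"
    by metis
  \<comment> \<open>The summand \<open>n\<close> gives strict monotonicity, the partial sum gives
    \<open>\<sigma> n \<ge> N n\<close>.\<close>
  define \<sigma> where "\<sigma> n = n + (\<Sum>i\<le>n. N i)" for n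
  have sm: "strict_mono \<sigma>" by (rule strict_monoI_Suc) (simp add: \<sigma>_def)
  have ge: "\<sigma> n \<ge> N n" for n
    using member_le_sum[where f = N and A = "{..n}" and i = n] by (simp add: \<sigma>_def trans_le_add2)
  have "dist (X (\<sigma> n)) (X (\<sigma> m)) < c n" if "m \<ge> n" for n m
    using N ge[of n] strict_mono_leD[OF sm that] by (meson order_trans)
  with sm show ?thesis by (rule that)
qed

text \<open>
  Along a subsequence with \<open>dist (X n) (X m) < 2\<^sup>-\<^sup>n\<close> the increments \<open>d n\<close> satisfy
  \<open>\<integral> (\<Sum>n. 2\<^sup>n \<bar>d n\<bar>\<^sup>2) < \<infinity>\<close>, and \<open>\<bar>d n\<bar> \<le> 2\<^sup>-\<^sup>n + 2\<^sup>n \<bar>d n\<bar>\<^sup>2\<close> gives pointwise convergence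
  almost everywhere; Fatou's lemma does the rest.
\<close>

instance l2 :: (euclidean_space) complete_space
proof
  fix X :: "nat \<Rightarrow> 'a l2" assume X: "Cauchy X"
  obtain \<sigma> where \<sigma>: "strict_mono \<sigma>" "\<And>n m. m \<ge> n \<Longrightarrow> dist (X (\<sigma> n)) (X (\<sigma> m)) < (1/2) ^ n"
    using rapidly_Cauchy_subsequence[OF X, of "\<lambda>n. (1/2) ^ n"] by auto
  define f where "f n = rep_l2 (X (\<sigma> n))" for n
  have f_meas [measurable]: "f n \<in> borel_measurable borel" for n unfolding f_def by measurable
  define d where "d n x = f (Suc n) x - f n x" for n x
  have d_meas [measurable]: "d n \<in> borel_measurable borel" for n unfolding d_def[abs_def] by measurable
  have int_d: "(\<integral>\<^sup>+x. ennreal (2 ^ n * (cmod (d n x))\<^sup>2) \<partial>lborel) \<le> ennreal ((1/2) ^ n)" for n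
  proof -
    have "(\<integral>\<^sup>+x. ennreal (2 ^ n * (cmod (d n x))\<^sup>2) \<partial>lborel)
        = ennreal (2 ^ n) * (\<integral>\<^sup>+x. ennreal ((cmod (d n x))\<^sup>2) \<partial>lborel)"
      by (simp add: ennreal_mult nn_integral_cmult)
    also have "\<dots> = ennreal (2 ^ n * (dist (X (\<sigma> n)) (X (\<sigma> (Suc n))))\<^sup>2)"
      unfolding d_def f_def nn_integral_dist_l2 by (simp add: ennreal_mult dist_commute)
    also have "\<dots> \<le> ennreal (2 ^ n * ((1/2) ^ n)\<^sup>2)"
      using \<sigma>(2)[of n "Suc n"] by (intro ennreal_leI mult_left_mono power_mono) auto
    also have "2 ^ n * ((1/2) ^ n)\<^sup>2 = ((1/2) ^ n :: real)"
      by (simp add: power2_eq_square power_divide)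
    finally show ?thesis .
  qed
  have "(\<integral>\<^sup>+x. (\<Sum>n. ennreal (2 ^ n * (cmod (d n x))\<^sup>2)) \<partial>lborel)
      = (\<Sum>n. \<integral>\<^sup>+x. ennreal (2 ^ n * (cmod (d n x))\<^sup>2) \<partial>lborel)"
    by (rule nn_integral_suminf) measurable
  also have "\<dots> \<le> (\<Sum>n. ennreal ((1/2) ^ n))"
    by (intro suminf_le int_d) auto
  also have "\<dots> < \<infinity>"
    by (subst suminf_ennreal2) (simp_all add: summable_geometric)
  finally have "AE x in lborel. (\<Sum>n. ennreal (2 ^ n * (cmod (d n x))\<^sup>2)) \<noteq> \<infinity>"
    by (intro nn_integral_PInf_AE) auto
  then have conv: "AE x in lborel. convergent (\<lambda>n. f n x)"
  proof eventually_elim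
    case (elim x)
    have "summable (\<lambda>n. 2 ^ n * (cmod (d n x))\<^sup>2)"
      by (rule summable_suminf_not_top) (use elim in auto)
    then have "summable (\<lambda>n. (1/2) ^ n + 2 ^ n * (cmod (d n x))\<^sup>2)"
      by (intro summable_add summable_geometric) auto
    then have "summable (\<lambda>n. d n x)"
    proof (rule summable_comparison_test'[where N = 0])
      fix n
      \<comment> \<open>Completing the square gives the bound even with
        \<open>2 * cmod (d n x)\<close> on the left.\<close>
      have "0 \<le> ((1/2) ^ n) * (2 ^ n * cmod (d n x) - 1)\<^sup>2" by simp
      also have "\<dots> = (1/2) ^ n - 2 * cmod (d n x) + 2 ^ n * (cmod (d n x))\<^sup>2"
        by (simp add: power2_eq_square power_divide field_simps)
      finally show "norm (d n x) \<le> (1/2) ^ n + 2 ^ n * (cmod (d n x))\<^sup>2"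
        using norm_ge_zero[of "d n x"] by linarith
    qed
    then have "convergent (\<lambda>n. f 0 x + (\<Sum>i<n. d i x))"
      by (intro convergent_add convergent_const) (simp add: summable_iff_convergent)
    moreover have "f 0 x + (\<Sum>i<n. d i x) = f n x" for n
      by (induction n) (simp_all add: d_def flip: add.assoc)
    ultimately show ?case by simp
  qed
  define g where "g x = lim (\<lambda>n. f n x)" for x
  have g_meas [measurable]: "g \<in> borel_measurable borel"
    unfolding g_def[abs_def] by (rule borel_measurable_lim_metric) measurable
  have fg: "(\<integral>\<^sup>+x. ennreal ((cmod (f n x - g x))\<^sup>2) \<partial>lborel) \<le> ennreal (((1/2) ^ n)\<^sup>2)" for n
  proof -
    have "(\<integral>\<^sup>+x. ennreal ((cmod (f n x - g x))\<^sup>2) \<partial>lborel)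
        = (\<integral>\<^sup>+x. liminf (\<lambda>m. ennreal ((cmod (f n x - f m x))\<^sup>2)) \<partial>lborel)"
    proof (rule nn_integral_cong_AE, use conv in eventually_elim)
      case (elim x)
      then have "(\<lambda>m. f m x) \<longlonglongrightarrow> g x" by (simp add: g_def convergent_LIMSEQ_iff)
      then have "(\<lambda>m. ennreal ((cmod (f n x - f m x))\<^sup>2)) \<longlonglongrightarrow> ennreal ((cmod (f n x - g x))\<^sup>2)"
        by (intro tendsto_intros)
      then show ?case by (rule lim_imp_Liminf[OF trivial_limit_sequentially, symmetric])
    qed
    also have "\<dots> \<le> liminf (\<lambda>m. \<integral>\<^sup>+x. ennreal ((cmod (f n x - f m x))\<^sup>2) \<partial>lborel)"
      by (rule nn_integral_liminf) measurable
    also have "\<dots> = liminf (\<lambda>m. ennreal ((dist (X (\<sigma> n)) (X (\<sigma> m)))\<^sup>2))"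
      by (simp add: f_def nn_integral_dist_l2)
    also have "\<dots> \<le> ennreal (((1/2) ^ n)\<^sup>2)"
    proof (rule Liminf_le)
      show "\<forall>\<^sub>F m in sequentially. ennreal ((dist (X (\<sigma> n)) (X (\<sigma> m)))\<^sup>2) \<le> ennreal (((1/2) ^ n)\<^sup>2)"
        using eventually_ge_at_top[of n]
      proof eventually_elim
        case (elim m)
        then show ?case using \<sigma>(2)[OF elim] by (intro ennreal_leI power_mono) simp_all
      qed
    qed simp
    finally show ?thesis .
  qed
  have sq_fg: "square_integrable (\<lambda>x. f n x - g x)" for n
    unfolding square_integrable_def
    using fg[of n] by (auto intro!: integrableI_bounded intro: le_less_trans simp: )
  have sq_g: "square_integrable g"
    using square_integrable_add[OF square_integrable_uminus[OF sq_fg[of 0]] square_integrable_rep_l2[of "X (\<sigma> 0)"]]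
    by (simp add: f_def)
  have "dist (X (\<sigma> n)) (abs_l2 g) \<le> (1/2) ^ n" for n
  proof -
    have "ennreal ((dist (X (\<sigma> n)) (abs_l2 g))\<^sup>2) = (\<integral>\<^sup>+x. ennreal ((cmod (f n x - g x))\<^sup>2) \<partial>lborel)"
      unfolding nn_integral_dist_l2[symmetric] f_def
      by (rule nn_integral_cong_AE) (use rep_abs_l2[OF sq_g] in \<open>eventually_elim, simp\<close>)
    then have "ennreal ((dist (X (\<sigma> n)) (abs_l2 g))\<^sup>2) \<le> ennreal (((1/2) ^ n)\<^sup>2)"
      using fg[of n] by (rule ssubst)
    then have "(dist (X (\<sigma> n)) (abs_l2 g))\<^sup>2 \<le> ((1/2) ^ n)\<^sup>2"
      by (subst (asm) ennreal_le_iff) simp_all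
    then show ?thesis by (rule power2_le_imp_le) simp
  qed
  then have "(\<lambda>n. dist (X (\<sigma> n)) (abs_l2 g)) \<longlonglongrightarrow> 0"
    by (intro Lim_null_comparison[OF _ LIMSEQ_power_zero[of "1/2 :: real"]]) auto
  then have "(X \<circ> \<sigma>) \<longlonglongrightarrow> abs_l2 g"
    by (subst tendsto_dist_iff) (simp add: o_def)
  then show "convergent X"
    using Cauchy_converges_subseq[OF X \<sigma>(1)] by (auto simp: convergent_def)
qed

section \<open>The exchange of variables and completeness of its fixed space\<close>

lemma distr_lborel_swap: "distr lborel lborel prod.swap = (lborel :: ('a::euclidean_space \<times> 'a) measure)"
proof -
  have "distr (lborel \<Otimes>\<^sub>M lborel) (lborel \<Otimes>\<^sub>M lborel) (\<lambda>(x, y). (y, x))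
      = (lborel \<Otimes>\<^sub>M lborel :: ('a \<times> 'a) measure)"
    by (rule lborel_pair.distr_pair_swap[symmetric])
  moreover have "(\<lambda>(x, y). (y, x)) = (prod.swap :: 'a \<times> 'a \<Rightarrow> _)"
    by auto
  ultimately show ?thesis by (simp only: lborel_prod)
qed

lemma square_integrable_swap:
  fixes g :: "'a::euclidean_space \<times> 'a \<Rightarrow> complex"
  assumes "square_integrable g"
  shows "square_integrable (\<lambda>p. g (prod.swap p))"
proof -
  note [measurable] = square_integrable_measurable[OF assms]
  have "integrable (distr lborel lborel prod.swap) (\<lambda>p. (cmod (g p))\<^sup>2)"
    using assms unfolding distr_lborel_swap by (simp add: square_integrable_def)
  then have "integrable lborel (\<lambda>p. (cmod (g (prod.swap p)))\<^sup>2)"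
    by (subst (asm) integrable_distr_eq) simp_all
  then show ?thesis by (simp add: square_integrable_def)
qed

definition swap_l2 :: "('a::euclidean_space \<times> 'a) l2 \<Rightarrow> ('a \<times> 'a) l2" where
  "swap_l2 g = abs_l2 (\<lambda>p. rep_l2 g (prod.swap p))"

lemma rep_swap_l2: "AE p in lborel. rep_l2 (swap_l2 g) p = rep_l2 g (prod.swap p)"
  unfolding swap_l2_def by (rule rep_abs_l2[OF square_integrable_swap[OF square_integrable_rep_l2]])

lemma cinner_swap_l2: "cinner (swap_l2 f) (swap_l2 g) = cinner f g"
proof -
  have "cinner (swap_l2 f) (swap_l2 g)
      = (LINT p|lborel. rep_l2 f (prod.swap p) * cnj (rep_l2 g (prod.swap p)))"
    unfolding swap_l2_def
    by (intro cinner_abs_l2 square_integrable_swap square_integrable_rep_l2)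
  also have "\<dots> = (LINT p|distr lborel lborel prod.swap. rep_l2 f p * cnj (rep_l2 g p))"
    by (rule integral_distr[symmetric])
       (simp_all add: borel_measurable_times square_integrable_measurable[OF square_integrable_cnj[OF square_integrable_rep_l2]])
  finally show ?thesis by (simp add: distr_lborel_swap cinner_rep_l2)
qed

lemma symmetric_l2_iff_swap: "symmetric_l2 g \<longleftrightarrow> swap_l2 g = g"
proof -
  have "symmetric_l2 g \<longleftrightarrow> (AE p in lborel. rep_l2 g p = rep_l2 g (prod.swap p))"
    using symmetric_abs_l2[OF square_integrable_rep_l2, of g] by (simp add: abs_rep_l2)
  also have "\<dots> \<longleftrightarrow> abs_l2 (rep_l2 g) = swap_l2 g"
    unfolding swap_l2_def
    by (rule abs_l2_eq_iff[symmetric, OF square_integrable_rep_l2 square_integrable_swap[OF square_integrable_rep_l2]])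
  finally show ?thesis by (auto simp: abs_rep_l2)
qed

lemma clinear_swap_l2: "clinear_map swap_l2"
  unfolding clinear_map_def
proof (intro conjI allI)
  fix f g :: "('a \<times> 'a) l2" and a
  show "swap_l2 (f + g) = swap_l2 f + swap_l2 g"
    by (rule l2_eqI)
       (use rep_swap_l2[of "f + g"] AE_lborel_swap[OF rep_l2_add[of f g]] rep_l2_add[of "swap_l2 f" "swap_l2 g"]
          rep_swap_l2[of f] rep_swap_l2[of g] in \<open>eventually_elim, simp\<close>)
  show "swap_l2 (a *\<^sub>C f) = a *\<^sub>C swap_l2 f"
    by (rule l2_eqI)
       (use rep_swap_l2[of "a *\<^sub>C f"] AE_lborel_swap[OF rep_l2_scaleC[of a f]] rep_l2_scaleC[of a "swap_l2 f"]
          rep_swap_l2[of f] in \<open>eventually_elim, simp\<close>)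
qed

lemma norm_swap_l2 [simp]: "norm (swap_l2 g) = norm g"
  using cinner_swap_l2[of g g] by (simp add: norm_eq_sqrt_inner inner_eq_Re_cinner)

lemma swap_Rep_l2_sym [simp]: "swap_l2 (Rep_l2_sym g) = Rep_l2_sym g"
  using Rep_l2_sym[of g] by (simp add: symmetric_l2_iff_swap)

lemma norm_l2_sym_Rep: "(norm g)\<^sup>2 = 1 / 2 * (norm (Rep_l2_sym g))\<^sup>2"
  by (simp add: power2_norm_eq_inner inner_l2_sym.rep_eq)

text \<open>Symmetric functions are the fixed points of the isometry \<open>swap_l2\<close>, hence a
  closed subspace; the weight 1/2 in the inner product rescales distances by the constant
  \<open>sqrt 2\<close>.\<close>

instance l2_sym :: (euclidean_space) complete_space
proof
  fix X :: "nat \<Rightarrow> 'a l2_sym" assume X: "Cauchy X"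
  have dist: "(dist (Rep_l2_sym f) (Rep_l2_sym g))\<^sup>2 = 2 * (dist f g)\<^sup>2" for f g :: "'a l2_sym"
    by (simp add: dist_norm minus_l2_sym.rep_eq norm_l2_sym_Rep)
  have "Cauchy (\<lambda>n. Rep_l2_sym (X n))"
  proof (rule metric_CauchyI)
    fix \<epsilon> :: real assume \<epsilon>: "0 < \<epsilon>"
    obtain M where M: "\<And>m n. m \<ge> M \<Longrightarrow> n \<ge> M \<Longrightarrow> dist (X m) (X n) < \<epsilon> / 2"
      using metric_CauchyD[OF X, of "\<epsilon> / 2"] \<epsilon> by auto
    have "dist (Rep_l2_sym (X m)) (Rep_l2_sym (X n)) < \<epsilon>" if "m \<ge> M" "n \<ge> M" for m n
    proof (rule power2_less_imp_less)
      have "(dist (X m) (X n))\<^sup>2 < (\<epsilon> / 2)\<^sup>2"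
        using M[OF that] by (intro power_strict_mono) auto
      then have "4 * (dist (X m) (X n))\<^sup>2 < \<epsilon>\<^sup>2" by (simp add: power_divide)
      then show "(dist (Rep_l2_sym (X m)) (Rep_l2_sym (X n)))\<^sup>2 < \<epsilon>\<^sup>2"
        unfolding dist using zero_le_power2[of "dist (X m) (X n)"] by linarith
    qed (use \<epsilon> in simp)
    then show "\<exists>M. \<forall>m\<ge>M. \<forall>n\<ge>M. dist (Rep_l2_sym (X m)) (Rep_l2_sym (X n)) < \<epsilon>" by blast
  qed
  then obtain g where g: "(\<lambda>n. Rep_l2_sym (X n)) \<longlonglongrightarrow> g"
    using Cauchy_convergent unfolding convergent_def by blast
  have bl: "bounded_linear (swap_l2 :: ('a \<times> 'a) l2 \<Rightarrow> _)"
    by (rule clinear_map_bounded_linear[OF clinear_swap_l2, of 1]) simp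
  have "(\<lambda>n. Rep_l2_sym (X n)) \<longlonglongrightarrow> swap_l2 g"
    using bounded_linear.tendsto[OF bl g] by simp
  from LIMSEQ_unique[OF this g] have "swap_l2 g = g" .
  then have Rep: "Rep_l2_sym (Abs_l2_sym g) = g"
    by (simp add: Abs_l2_sym_inverse symmetric_l2_iff_swap)
  have "(\<lambda>n. (dist (Rep_l2_sym (X n)) g)\<^sup>2) \<longlonglongrightarrow> 0\<^sup>2"
    by (intro tendsto_power tendsto_dist_iff[THEN iffD1] g)
  then have "(\<lambda>n. 2 * (dist (X n) (Abs_l2_sym g))\<^sup>2 / 2) \<longlonglongrightarrow> 0 / 2"
    unfolding dist[symmetric] Rep by (intro tendsto_divide) auto
  then have "(\<lambda>n. sqrt ((dist (X n) (Abs_l2_sym g))\<^sup>2)) \<longlonglongrightarrow> sqrt 0"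
    by (intro tendsto_real_sqrt) simp
  then have "X \<longlonglongrightarrow> Abs_l2_sym g"
    by (subst tendsto_dist_iff) simp
  then show "convergent X" by (auto simp: convergent_def)
qed

section \<open>Multiplication operators and tensor products\<close>

definition bounded_measurable :: "('a::euclidean_space \<Rightarrow> real) \<Rightarrow> bool" where
  "bounded_measurable w \<longleftrightarrow> w \<in> borel_measurable borel \<and> bounded (range w)"

lemma bounded_measurableI:
  assumes "w \<in> borel_measurable borel" "\<And>x. \<bar>w x\<bar> \<le> M"
  shows "bounded_measurable w"
  using assms by (auto simp: bounded_measurable_def bounded_iff)

lemma bounded_measurableE:
  assumes "bounded_measurable w"
  obtains M where "w \<in> borel_measurable borel" "\<And>x. \<bar>w x\<bar> \<le> M" "0 \<le> M"
proof -
  obtain M where M: "\<And>x. \<bar>w x\<bar> \<le> M"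
    using assms by (auto simp: bounded_measurable_def bounded_iff)
  show ?thesis
    by (rule that[of M]) (use assms M order_trans[OF abs_ge_zero M] in \<open>auto simp: bounded_measurable_def\<close>)
qed

lemma bounded_measurable_const [simp]: "bounded_measurable (\<lambda>x. c)"
  by (rule bounded_measurableI[of _ "\<bar>c\<bar>"]) auto

lemma bounded_measurable_indicator [simp]: "E \<in> sets borel \<Longrightarrow> bounded_measurable (indicat_real E)"
  by (rule bounded_measurableI[of _ 1]) (auto simp: indicator_def)

lemma bounded_measurable_mult:
  assumes "bounded_measurable v" "bounded_measurable w"
  shows "bounded_measurable (\<lambda>x. v x * w x)"
proof -
  obtain M N where "v \<in> borel_measurable borel" "w \<in> borel_measurable borel"
    "\<And>x. \<bar>v x\<bar> \<le> M" "\<And>x. \<bar>w x\<bar> \<le> N" "0 \<le> M" "0 \<le> N"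
    using assms by (auto elim!: bounded_measurableE)
  then show ?thesis
    by (intro bounded_measurableI[of _ "M * N"]) (auto simp: abs_mult intro!: mult_mono)
qed

lemma bounded_measurable_add:
  assumes "bounded_measurable v" "bounded_measurable w"
  shows "bounded_measurable (\<lambda>x. v x + w x)"
proof -
  obtain M N where "v \<in> borel_measurable borel" "w \<in> borel_measurable borel"
    "\<And>x. \<bar>v x\<bar> \<le> M" "\<And>x. \<bar>w x\<bar> \<le> N"
    using assms by (auto elim!: bounded_measurableE)
  then show ?thesis
    by (intro bounded_measurableI[of _ "M + N"]) (auto intro: order_trans[OF abs_triangle_ineq] add_mono)
qed

lemma bounded_measurable_cmult: "bounded_measurable w \<Longrightarrow> bounded_measurable (\<lambda>x. c * w x)"
  by (rule bounded_measurable_mult[OF bounded_measurable_const])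

lemma bounded_measurable_diff:
  "bounded_measurable v \<Longrightarrow> bounded_measurable w \<Longrightarrow> bounded_measurable (\<lambda>x. v x - w x)"
  using bounded_measurable_add[of v "\<lambda>x. (- 1) * w x"] bounded_measurable_cmult[of w "- 1"] by simp

text \<open>Real multipliers keep the operator self-adjoint. Unless \<open>w\<close> is bounded and
  measurable, the argument of \<open>abs_l2\<close> may fail to be square-integrable; hence the
  hypothesis \<open>bounded_measurable\<close> throughout.\<close>

definition mult_l2 :: "('a::euclidean_space \<Rightarrow> real) \<Rightarrow> 'a l2 \<Rightarrow> 'a l2" where
  "mult_l2 w f = abs_l2 (\<lambda>x. complex_of_real (w x) * rep_l2 f x)"

context
  fixes w :: "'a::euclidean_space \<Rightarrow> real"
  assumes w: "bounded_measurable w"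
begin

lemma square_integrable_mult_l2: "square_integrable f \<Longrightarrow> square_integrable (\<lambda>x. complex_of_real (w x) * f x)"
  using w by (intro square_integrable_bounded_mult) (auto simp: bounded_measurable_def)

lemma rep_mult_l2: "AE x in lborel. rep_l2 (mult_l2 w f) x = complex_of_real (w x) * rep_l2 f x"
  unfolding mult_l2_def by (intro rep_abs_l2 square_integrable_mult_l2 square_integrable_rep_l2)

lemma mult_l2_abs:
  assumes "square_integrable f"
  shows "mult_l2 w (abs_l2 f) = abs_l2 (\<lambda>x. complex_of_real (w x) * f x)"
  unfolding mult_l2_def
    abs_l2_eq_iff[OF square_integrable_mult_l2[OF square_integrable_rep_l2] square_integrable_mult_l2[OF assms]]
  using rep_abs_l2[OF assms] by eventually_elim simp

lemma cinner_mult_l2: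
  "cinner (mult_l2 w f) g = (LINT x|lborel. complex_of_real (w x) * (rep_l2 f x * cnj (rep_l2 g x)))"
  using cinner_abs_l2[OF square_integrable_mult_l2[OF square_integrable_rep_l2] square_integrable_rep_l2, of f g]
  by (simp add: mult_l2_def[symmetric] abs_rep_l2 mult.assoc)

lemma mult_l2_selfadjoint: "cinner (mult_l2 w f) g = cinner f (mult_l2 w g)"
proof -
  have "cinner f (mult_l2 w g) = (LINT x|lborel. rep_l2 f x * cnj (complex_of_real (w x) * rep_l2 g x))"
    using cinner_abs_l2[OF square_integrable_rep_l2 square_integrable_mult_l2[OF square_integrable_rep_l2], of f g]
    by (simp add: mult_l2_def[symmetric] abs_rep_l2)
  then show ?thesis by (simp add: cinner_mult_l2 ac_simps)
qed

lemma clinear_mult_l2: "clinear_map (mult_l2 w)"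
  unfolding clinear_map_def
proof (intro conjI allI)
  fix f g :: "'a l2" and a
  show "mult_l2 w (f + g) = mult_l2 w f + mult_l2 w g"
    by (rule l2_eqI)
       (use rep_mult_l2[of "f + g"] rep_l2_add[of f g] rep_l2_add[of "mult_l2 w f" "mult_l2 w g"]
          rep_mult_l2[of f] rep_mult_l2[of g] in \<open>eventually_elim, simp add: distrib_left\<close>)
  show "mult_l2 w (a *\<^sub>C f) = a *\<^sub>C mult_l2 w f"
    by (rule l2_eqI)
       (use rep_mult_l2[of "a *\<^sub>C f"] rep_l2_scaleC[of a f] rep_l2_scaleC[of a "mult_l2 w f"]
          rep_mult_l2[of f] in \<open>eventually_elim, simp\<close>)
qed

lemma norm_mult_l2_le:
  assumes "\<And>x. \<bar>w x\<bar> \<le> c"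
  shows "norm (mult_l2 w f) \<le> c * norm f"
proof (rule power2_le_imp_le)
  have c: "0 \<le> c" using assms order_trans[OF abs_ge_zero] by blast
  have "ennreal ((norm (mult_l2 w f))\<^sup>2) = (\<integral>\<^sup>+x. ennreal ((cmod (complex_of_real (w x) * rep_l2 f x))\<^sup>2) \<partial>lborel)"
    unfolding nn_integral_norm_l2[symmetric]
    by (rule nn_integral_cong_AE) (use rep_mult_l2[of f] in \<open>eventually_elim, simp\<close>)
  also have "\<dots> \<le> (\<integral>\<^sup>+x. ennreal (c\<^sup>2) * ennreal ((cmod (rep_l2 f x))\<^sup>2) \<partial>lborel)"
  proof (rule nn_integral_mono)
    fix x
    have "(w x)\<^sup>2 \<le> c\<^sup>2" using power_mono[OF assms[of x], of 2] by simp
    then show "ennreal ((cmod (complex_of_real (w x) * rep_l2 f x))\<^sup>2)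
        \<le> ennreal (c\<^sup>2) * ennreal ((cmod (rep_l2 f x))\<^sup>2)"
      by (simp add: norm_mult power_mult_distrib ennreal_mult[symmetric] mult_right_mono)
  qed
  also have "\<dots> = ennreal ((c * norm f)\<^sup>2)"
    by (subst nn_integral_cmult) (simp_all add: nn_integral_norm_l2 ennreal_mult power_mult_distrib)
  finally show "(norm (mult_l2 w f))\<^sup>2 \<le> (c * norm f)\<^sup>2" by (simp add: ennreal_le_iff)
  show "0 \<le> c * norm f" using c by simp
qed

lemma inner_mult_l2_nonneg:
  assumes "\<And>x. 0 \<le> w x"
  shows "0 \<le> inner (mult_l2 w f) f"
proof -
  have "cinner (mult_l2 w f) f = (LINT x|lborel. complex_of_real (w x * (cmod (rep_l2 f x))\<^sup>2))"
    unfolding cinner_mult_l2 complex_norm_square of_real_mult ..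
  also have "\<dots> = complex_of_real (LINT x|lborel. w x * (cmod (rep_l2 f x))\<^sup>2)"
    by (rule integral_complex_of_real)
  finally show ?thesis
    using assms by (simp add: inner_eq_Re_cinner)
qed

lemma bounded_linear_mult_l2: "bounded_linear (mult_l2 w)"
  using w by (auto elim!: bounded_measurableE intro!: clinear_map_bounded_linear clinear_mult_l2 norm_mult_l2_le)

end

lemma mult_l2_compose:
  assumes "bounded_measurable v" "bounded_measurable w"
  shows "mult_l2 v (mult_l2 w f) = mult_l2 (\<lambda>x. v x * w x) f"
  by (rule l2_eqI)
     (use rep_mult_l2[OF assms(1), of "mult_l2 w f"] rep_mult_l2[OF assms(2), of f]
        rep_mult_l2[OF bounded_measurable_mult[OF assms], of f] in \<open>eventually_elim, simp\<close>)

lemma mult_l2_add: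
  assumes "bounded_measurable v" "bounded_measurable w"
  shows "mult_l2 (\<lambda>x. v x + w x) f = mult_l2 v f + mult_l2 w f"
  by (rule l2_eqI)
     (use rep_l2_add[of "mult_l2 v f" "mult_l2 w f"] rep_mult_l2[OF assms(1), of f] rep_mult_l2[OF assms(2), of f]
        rep_mult_l2[OF bounded_measurable_add[OF assms], of f] in \<open>eventually_elim, simp add: distrib_right\<close>)

lemma mult_l2_const: "mult_l2 (\<lambda>x. c) f = complex_of_real c *\<^sub>C f"
  by (rule l2_eqI)
     (use rep_l2_scaleC[of "complex_of_real c" f] rep_mult_l2[OF bounded_measurable_const, of c f]
        in \<open>eventually_elim, simp\<close>)

lemma mult_l2_cmult:
  assumes "bounded_measurable w"
  shows "mult_l2 (\<lambda>x. c * w x) f = complex_of_real c *\<^sub>C mult_l2 w f"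
  using mult_l2_compose[OF bounded_measurable_const assms, of c f] by (simp add: mult_l2_const)

lemma mult_l2_diff:
  assumes "bounded_measurable v" "bounded_measurable w"
  shows "mult_l2 (\<lambda>x. v x - w x) f = mult_l2 v f - mult_l2 w f"
  using mult_l2_add[OF assms(1) bounded_measurable_cmult[OF assms(2), of "- 1"], of f] mult_l2_cmult[OF assms(2), of "- 1" f]
  by simp

lemma inner_mult_l2_mono:
  assumes "bounded_measurable v" "bounded_measurable w" "\<And>x. v x \<le> w x"
  shows "inner (mult_l2 v f) f \<le> inner (mult_l2 w f) f"
  using inner_mult_l2_nonneg[OF bounded_measurable_diff[OF assms(2,1)], of f] assms(3)
  by (simp add: mult_l2_diff assms(1,2) inner_diff_left)

lemma swap_mult_l2:
  fixes w :: "'a::euclidean_space \<times> 'a \<Rightarrow> real"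
  assumes w: "bounded_measurable w" and sym: "\<And>p. w (prod.swap p) = w p"
  shows "swap_l2 (mult_l2 w g) = mult_l2 w (swap_l2 g)"
  by (rule l2_eqI)
     (use rep_swap_l2[of "mult_l2 w g"] AE_lborel_swap[OF rep_mult_l2[OF w, of g]] rep_mult_l2[OF w, of "swap_l2 g"]
        rep_swap_l2[of g] in \<open>eventually_elim, simp add: sym\<close>)

section \<open>Tensor products\<close>

definition tens :: "'a::euclidean_space l2 \<Rightarrow> 'a l2 \<Rightarrow> ('a \<times> 'a) l2" where
  "tens f g = abs_l2 (\<lambda>(k, q). rep_l2 f k * rep_l2 g q)"

lemma rep_tens: "AE p in lborel. rep_l2 (tens f g) p = rep_l2 f (fst p) * rep_l2 g (snd p)"
  using rep_abs_l2[OF square_integrable_tensor[OF square_integrable_rep_l2 square_integrable_rep_l2], of f g]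
  by (simp add: tens_def case_prod_unfold)

lemma tens_abs:
  assumes "square_integrable f" "square_integrable g"
  shows "tens (abs_l2 f) (abs_l2 g) = abs_l2 (\<lambda>(k, q). f k * g q)"
proof (rule l2_eqI)
  show "AE p in lborel. rep_l2 (tens (abs_l2 f) (abs_l2 g)) p = rep_l2 (abs_l2 (\<lambda>(k, q). f k * g q)) p"
    using rep_tens[of "abs_l2 f" "abs_l2 g"] rep_abs_l2[OF square_integrable_tensor[OF assms]]
      AE_lborel_fst[OF rep_abs_l2[OF assms(1)]] AE_lborel_snd[OF rep_abs_l2[OF assms(2)]]
    by eventually_elim (simp add: case_prod_unfold)
qed

lemma integral_lborel_prod:
  fixes F :: "'a::euclidean_space \<times> 'a \<Rightarrow> complex"
  assumes "integrable lborel F"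
  shows "(LINT p|lborel. F p) = (LINT k|lborel. LINT q|lborel. F (k, q))"
  using lborel_pair.integral_fst'[of F] assms by (simp add: lborel_prod)

lemma cinner_tens: "cinner (tens a b) (tens c d) = cinner a c * cinner b d"
proof -
  have sq: "square_integrable (\<lambda>(k, q). rep_l2 f k * rep_l2 g q)" for f g :: "'a l2"
    by (intro square_integrable_tensor square_integrable_rep_l2)
  have "cinner (tens a b) (tens c d)
      = (LINT p|lborel. (case p of (k, q) \<Rightarrow> rep_l2 a k * rep_l2 b q) * cnj (case p of (k, q) \<Rightarrow> rep_l2 c k * rep_l2 d q))"
    unfolding tens_def by (intro cinner_abs_l2 sq)
  also have "\<dots> = (LINT k|lborel. LINT q|lborel. (rep_l2 a k * rep_l2 b q) * cnj (rep_l2 c k * rep_l2 d q))"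
    using integral_lborel_prod[OF square_integrable_prod[OF sq square_integrable_cnj[OF sq]], of a b c d]
    by simp
  also have "\<dots> = (LINT k|lborel. (rep_l2 a k * cnj (rep_l2 c k)) * (LINT q|lborel. rep_l2 b q * cnj (rep_l2 d q)))"
    by (simp add: ac_simps flip: integral_mult_right_zero)
  finally show ?thesis by (simp add: cinner_rep_l2)
qed

lemma norm_tens: "norm (tens a b) = norm a * norm b"
proof -
  have "complex_of_real ((norm (tens a b))\<^sup>2) = complex_of_real ((norm a * norm b)\<^sup>2)"
    unfolding cinner_self[symmetric] cinner_tens
    by (simp only: cinner_self power_mult_distrib of_real_mult)
  then show ?thesis by (simp only: of_real_eq_iff) (simp add: power2_eq_iff_nonneg)
qed

lemma swap_tens: "swap_l2 (tens a b) = tens b a"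
  by (rule l2_eqI)
     (use rep_swap_l2[of "tens a b"] AE_lborel_swap[OF rep_tens[of a b]] rep_tens[of b a]
        in \<open>eventually_elim, simp\<close>)

lemma tens_add_left: "tens (a + a') b = tens a b + tens a' b"
  by (rule l2_eqI)
     (use rep_tens[of "a + a'" b] rep_tens[of a b] rep_tens[of a' b] AE_lborel_fst[OF rep_l2_add[of a a']]
        rep_l2_add[of "tens a b" "tens a' b"] in \<open>eventually_elim, simp add: distrib_right\<close>)

lemma tens_scaleC_left: "tens (c *\<^sub>C a) b = c *\<^sub>C tens a b"
  by (rule l2_eqI)
     (use rep_tens[of "c *\<^sub>C a" b] rep_tens[of a b] AE_lborel_fst[OF rep_l2_scaleC[of c a]]
        rep_l2_scaleC[of c "tens a b"] in \<open>eventually_elim, simp\<close>)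

lemma tens_add_right: "tens b (a + a') = tens b a + tens b a'"
  using arg_cong[OF tens_add_left[of a a' b], of swap_l2]
  by (simp add: swap_tens clinear_mapD[OF clinear_swap_l2])

lemma tens_scaleC_right: "tens b (c *\<^sub>C a) = c *\<^sub>C tens b a"
  using arg_cong[OF tens_scaleC_left[of c a b], of swap_l2]
  by (simp add: swap_tens clinear_mapD[OF clinear_swap_l2])

lemma bounded_measurable_fst:
  assumes "bounded_measurable w"
  shows "bounded_measurable (\<lambda>p :: 'a::euclidean_space \<times> 'a. w (fst p))"
proof -
  obtain M where M: "w \<in> borel_measurable borel" "\<And>x. \<bar>w x\<bar> \<le> M"
    using bounded_measurableE[OF assms] by metis
  have "(fst :: 'a \<times> 'a \<Rightarrow> 'a) \<in> borel_measurable borel"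
    by (intro borel_measurable_continuous_onI continuous_intros)
  from measurable_compose[OF this M(1)] show ?thesis
    by (rule bounded_measurableI) (rule M(2))
qed

lemma bounded_measurable_snd:
  assumes "bounded_measurable w"
  shows "bounded_measurable (\<lambda>p :: 'a::euclidean_space \<times> 'a. w (snd p))"
proof -
  obtain M where M: "w \<in> borel_measurable borel" "\<And>x. \<bar>w x\<bar> \<le> M"
    using bounded_measurableE[OF assms] by metis
  have "(snd :: 'a \<times> 'a \<Rightarrow> 'a) \<in> borel_measurable borel"
    by (intro borel_measurable_continuous_onI continuous_intros)
  from measurable_compose[OF this M(1)] show ?thesis
    by (rule bounded_measurableI) (rule M(2))
qed

lemma tens_mult_l2_left:
  assumes "bounded_measurable w"
  shows "tens (mult_l2 w a) b = mult_l2 (\<lambda>p. w (fst p)) (tens a b)"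
  by (rule l2_eqI)
     (use rep_tens[of "mult_l2 w a" b] rep_tens[of a b] AE_lborel_fst[OF rep_mult_l2[OF assms, of a]]
        rep_mult_l2[OF bounded_measurable_fst[OF assms], of "tens a b"] in \<open>eventually_elim, simp\<close>)

lemma tens_mult_l2_right:
  assumes "bounded_measurable w"
  shows "tens a (mult_l2 w b) = mult_l2 (\<lambda>p. w (snd p)) (tens a b)"
  by (rule l2_eqI)
     (use rep_tens[of a "mult_l2 w b"] rep_tens[of a b] AE_lborel_snd[OF rep_mult_l2[OF assms, of b]]
        rep_mult_l2[OF bounded_measurable_snd[OF assms], of "tens a b"] in \<open>eventually_elim, simp\<close>)

text \<open>With this conjugation, \<open>cinner \<kappa> (tens f (cnj_l2 f))\<close> is the
  quadratic form at \<open>f\<close> of the integral operator with kernel \<kappa>.\<close>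

definition cnj_l2 :: "'a::euclidean_space l2 \<Rightarrow> 'a l2" where
  "cnj_l2 f = abs_l2 (\<lambda>x. cnj (rep_l2 f x))"

lemma rep_cnj_l2: "AE x in lborel. rep_l2 (cnj_l2 f) x = cnj (rep_l2 f x)"
  unfolding cnj_l2_def by (intro rep_abs_l2 square_integrable_cnj square_integrable_rep_l2)

lemma cinner_cnj_l2: "cinner (cnj_l2 f) (cnj_l2 g) = cnj (cinner f g)"
proof -
  have "cinner (cnj_l2 f) (cnj_l2 g) = (LINT x|lborel. cnj (rep_l2 f x * cnj (rep_l2 g x)))"
    unfolding cnj_l2_def
    by (subst cinner_abs_l2) (auto intro!: square_integrable_cnj square_integrable_rep_l2)
  then show ?thesis by (simp add: cinner_rep_l2 del: complex_cnj_mult)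
qed

text \<open>
  If \<open>e i\<close> are orthonormal then so are the functions \<open>(k, q) \<mapsto> e i k * cnj (e i q)\<close>; Bessel's
  inequality for them bounds the dimension of the span by the Hilbert--Schmidt norm of the kernel.
\<close>

lemma Hilbert_Schmidt_dimension_bound:
  fixes \<kappa> :: "('a::euclidean_space \<times> 'a) l2"
  assumes "\<And>n. n < N \<Longrightarrow> h n \<notin> complex_vector.span (h ` {..<n})"
    and large: "\<And>f. f \<in> complex_vector.span (h ` {..<N}) \<Longrightarrow> (norm f)\<^sup>2 \<le> cmod (cinner \<kappa> (tens f (cnj_l2 f)))"
  shows "real N \<le> (norm \<kappa>)\<^sup>2"
proof -
  obtain e where e: "orthonormal_on {..<N} e" "\<And>i. i < N \<Longrightarrow> e i \<in> complex_vector.span (h ` {..<N})"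
    using Gram_Schmidt[of N h] assms(1) by blast
  define H where "H i = tens (e i) (cnj_l2 (e i))" for i
  have "orthonormal_on {..<N} H"
    using e(1) by (auto simp: orthonormal_on_def H_def cinner_tens cinner_cnj_l2)
  then have "(\<Sum>i<N. (cmod (cinner \<kappa> (H i)))\<^sup>2) \<le> (norm \<kappa>)\<^sup>2"
    by (rule Bessel_inequality) simp
  moreover have "1 \<le> (cmod (cinner \<kappa> (H i)))\<^sup>2" if "i < N" for i
  proof -
    have "complex_of_real ((norm (e i))\<^sup>2) = 1"
      unfolding cinner_self[symmetric] using e(1) that by (simp add: orthonormal_on_def)
    then have "(norm (e i))\<^sup>2 = 1" using of_real_eq_1_iff by metis
    then have "1 \<le> cmod (cinner \<kappa> (H i))"
      using large[OF e(2)[OF that]] unfolding H_def by (rule subst)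
    then show ?thesis by (rule one_le_power)
  qed
  then have "(\<Sum>i<N. 1) \<le> (\<Sum>i<N. (cmod (cinner \<kappa> (H i)))\<^sup>2)"
    by (intro sum_mono) simp
  ultimately show ?thesis by simp
qed

section \<open>The operator matrix and its Schur complement\<close>

text \<open>Meant for multipliers invariant under \<open>prod.swap\<close>: these map symmetric
  functions to symmetric ones, so that \<open>Abs_l2_sym\<close> can be undone.\<close>

definition mult_sym :: "('a::euclidean_space \<times> 'a \<Rightarrow> real) \<Rightarrow> 'a l2_sym \<Rightarrow> 'a l2_sym" where
  "mult_sym w g = Abs_l2_sym (mult_l2 w (Rep_l2_sym g))"

text \<open>The symbol may take either sign, so that \<open>- \<omega>\<close> is again an instance;
  this is what the reflection at the end relies on.\<close>

locale two_boson =
  fixes \<gamma> \<alpha> :: real and \<omega> :: "'a::euclidean_space \<Rightarrow> real" and lam :: "'a \<Rightarrow> complex"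
  assumes cont: "continuous_on UNIV \<omega>" and bdd: "bounded (range \<omega>)" and lam: "square_integrable lam"
begin

definition "\<omega>\<^sub>0 = (INF k. \<omega> k)"
definition "\<omega>\<^sub>1 = (SUP k. \<omega> k)"
text \<open>\<open>m\<close> is the infimum of \<open>W\<close>, the lower two-particle threshold.
  \<tau> is the corresponding one-particle quantity: \<open>t < \<tau>\<close> keeps the denominator
  of \<open>selfenergy t\<close> positive, and \<open>z < m\<close> gives
  \<open>z - \<omega> k < \<tau>\<close> for every \<open>k\<close>.\<close>

definition "m = 2 * \<omega>\<^sub>0 + \<gamma>"
definition "\<tau> = \<omega>\<^sub>0 + \<gamma>"
definition "u = abs_l2 (\<lambda>k. cnj (lam k))"
definition "W p = \<gamma> + \<omega> (fst p) + \<omega> (snd p)"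
definition "T = block_op \<gamma> \<alpha> \<omega> lam"
abbreviation "A \<equiv> block_A \<gamma> \<omega>"
abbreviation "B \<equiv> block_B \<alpha> lam"
abbreviation "C \<equiv> block_C \<alpha> lam"
abbreviation "D \<equiv> block_D \<gamma> \<omega>"

lemma \<omega>_ge: "\<omega>\<^sub>0 \<le> \<omega> k" and \<omega>_le: "\<omega> k \<le> \<omega>\<^sub>1"
  using bdd unfolding \<omega>\<^sub>0_def \<omega>\<^sub>1_def
  by (auto intro!: cINF_lower cSUP_upper simp: bounded_imp_bdd_below bounded_imp_bdd_above)

lemma \<omega>_measurable [measurable]: "\<omega> \<in> borel_measurable borel"
  by (rule borel_measurable_continuous_onI[OF cont])

lemma lam_measurable [measurable]: "lam \<in> borel_measurable borel"
  by (rule square_integrable_measurable[OF lam])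

lemma bounded_measurable_\<omega>: "bounded_measurable \<omega>"
  using bdd by (simp add: bounded_measurable_def)

lemma bounded_measurable_W: "bounded_measurable W"
  unfolding W_def
  by (intro bounded_measurable_add bounded_measurable_fst[OF bounded_measurable_\<omega>]
      bounded_measurable_snd[OF bounded_measurable_\<omega>] bounded_measurable_const)

lemma W_ge: "m \<le> W p"
  using \<omega>_ge[of "fst p"] \<omega>_ge[of "snd p"] by (simp add: W_def m_def)

lemma W_swap [simp]: "W (prod.swap p) = W p"
  by (simp add: W_def)

lemma bounded_measurable_inverse_W:
  assumes "z < m"
  shows "bounded_measurable (\<lambda>p. 1 / (W p - z))"
proof -
  have "W \<in> borel_measurable borel"
    using bounded_measurable_W by (simp add: bounded_measurable_def)
  moreover have "\<bar>1 / (W p - z)\<bar> \<le> 1 / (m - z)" for p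
    using W_ge[of p] assms by (simp add: frac_le)
  ultimately show ?thesis by (intro bounded_measurableI) auto
qed

lemma Rep_mult_sym:
  assumes "bounded_measurable w" "\<And>p. w (prod.swap p) = w p"
  shows "Rep_l2_sym (mult_sym w g) = mult_l2 w (Rep_l2_sym g)"
  unfolding mult_sym_def using swap_mult_l2[OF assms, of "Rep_l2_sym g"]
  by (subst Abs_l2_sym_inverse) (simp_all add: symmetric_l2_iff_swap)

lemma A_eq: "A f = mult_l2 (\<lambda>k. - \<gamma> + \<omega> k) f"
  by (simp add: block_A_def mult_l2_def)

lemma D_eq: "D g = mult_sym W g"
proof -
  have "(\<lambda>(k, q). complex_of_real (\<gamma> + \<omega> k + \<omega> q) * rep_l2_sym g (k, q))
      = (\<lambda>p. complex_of_real (W p) * rep_l2 (Rep_l2_sym g) p)"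
    by (auto simp: W_def rep_l2_sym_def)
  then show ?thesis by (simp add: block_D_def mult_sym_def mult_l2_def abs_l2_sym_def)
qed

lemma Rep_D: "Rep_l2_sym (D g) = mult_l2 W (Rep_l2_sym g)"
  unfolding D_eq by (rule Rep_mult_sym[OF bounded_measurable_W W_swap])

lemma Rep_C: "Rep_l2_sym (C f) = complex_of_real \<alpha> *\<^sub>C (tens u f + tens f u)"
proof -
  define f' where "f' = rep_l2 f"
  have f': "square_integrable f'" "f = abs_l2 f'"
    by (simp_all add: f'_def square_integrable_rep_l2 abs_rep_l2)
  note u = square_integrable_cnj[OF lam]
  have sq: "square_integrable (\<lambda>(k, q). cnj (lam k) * f' q)" "square_integrable (\<lambda>(k, q). f' k * cnj (lam q))"
    using square_integrable_tensor u f'(1) by blast+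
  have "complex_of_real \<alpha> *\<^sub>C (tens u f + tens f u)
      = abs_l2 (\<lambda>p. complex_of_real \<alpha> * ((case p of (k, q) \<Rightarrow> cnj (lam k) * f' q) + (case p of (k, q) \<Rightarrow> f' k * cnj (lam q))))"
    unfolding f'(2) u_def tens_abs[OF u f'(1)] tens_abs[OF f'(1) u] abs_l2_add[OF sq]
    by (rule abs_l2_scaleC[OF square_integrable_add[OF sq]])
  also have "(\<lambda>p. complex_of_real \<alpha> * ((case p of (k, q) \<Rightarrow> cnj (lam k) * f' q) + (case p of (k, q) \<Rightarrow> f' k * cnj (lam q))))
      = (\<lambda>(k, q). complex_of_real \<alpha> * cnj (lam k) * f' q + complex_of_real \<alpha> * cnj (lam q) * f' k)"
    by (auto simp: algebra_simps)
  finally have "C f = Abs_l2_sym (complex_of_real \<alpha> *\<^sub>C (tens u f + tens f u))"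
    by (simp add: block_C_def abs_l2_sym_def f'_def)
  moreover have "symmetric_l2 (complex_of_real \<alpha> *\<^sub>C (tens u f + tens f u))"
    by (simp add: symmetric_l2_iff_swap clinear_mapD[OF clinear_swap_l2] swap_tens add.commute)
  ultimately show ?thesis by (simp add: Abs_l2_sym_inverse)
qed

lemma cinner_Rep_sym: "cinner g h = 1 / 2 * cinner (Rep_l2_sym g) (Rep_l2_sym h)"
  by (rule cinner_l2_sym.rep_eq)

text \<open>A symmetric \<open>g\<close> pairs equally with \<open>tens u f\<close> and
  \<open>tens f u\<close>, and the factor 1/2 of the inner product cancels this doubling.\<close>

lemma cinner_C_right: "cinner g (C f) = complex_of_real \<alpha> * cinner (Rep_l2_sym g) (tens f u)"
proof -
  have "cinner (Rep_l2_sym g) (tens u f) = cinner (Rep_l2_sym g) (tens f u)"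
    using cinner_swap_l2[of "Rep_l2_sym g" "tens f u"] by (simp add: swap_tens)
  then show ?thesis
    by (simp add: cinner_Rep_sym Rep_C cinner_scaleC_right cinner_add_right)
qed

text \<open>Fubini's theorem. Linearity and boundedness of \<open>B\<close> are both derived from
  this duality with \<open>C\<close>.\<close>

lemma cinner_B: "cinner (B g) f = cinner g (C f)"
proof -
  define h where "h = rep_l2 (Rep_l2_sym g)"
  define f' where "f' = rep_l2 f"
  have sq: "square_integrable h" "square_integrable f'" "f = abs_l2 f'"
    by (simp_all add: h_def f'_def square_integrable_rep_l2 abs_rep_l2)
  note u = square_integrable_cnj[OF lam]
  have sqt: "square_integrable (\<lambda>(k, q). f' k * cnj (lam q))"
    by (intro square_integrable_tensor sq u)
  have "cinner (B g) f = (LINT k|lborel. complex_of_real \<alpha> * (LINT q|lborel. h (k, q) * lam q) * cnj (f' k))"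
    unfolding sq(3) block_B_def rep_l2_sym_def h_def[symmetric]
    by (intro cinner_abs_l2 square_integrable_cmult square_integrable_partial_integral(2) sq lam)
  also have "\<dots> = complex_of_real \<alpha> * (LINT k|lborel. LINT q|lborel. h (k, q) * cnj (f' k * cnj (lam q)))"
    by (simp add: ac_simps flip: integral_mult_right_zero)
  also have "(LINT k|lborel. LINT q|lborel. h (k, q) * cnj (f' k * cnj (lam q)))
      = (LINT p|lborel. h p * cnj (case p of (k, q) \<Rightarrow> f' k * cnj (lam q)))"
    by (subst integral_lborel_prod[OF square_integrable_prod[OF sq(1) square_integrable_cnj[OF sqt]]]) simp
  also have "\<dots> = cinner (Rep_l2_sym g) (tens f u)"
    using cinner_abs_l2[OF sq(1) sqt] by (simp add: h_def abs_rep_l2 u_def sq(3) tens_abs[OF sq(2) u])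
  finally show ?thesis by (simp add: cinner_C_right)
qed

lemma Rep_l2_sym_eqI: "Rep_l2_sym g = Rep_l2_sym h \<Longrightarrow> g = h"
  by (simp add: Rep_l2_sym_inject)

lemma clinear_A: "clinear_map A"
  using clinear_mult_l2[OF bounded_measurable_add[OF bounded_measurable_const bounded_measurable_\<omega>], of "- \<gamma>"]
  by (simp add: A_eq[abs_def])

lemma clinear_C: "clinear_map C"
  unfolding clinear_map_def
proof (intro conjI allI)
  fix f g a
  show "C (f + g) = C f + C g"
    by (rule Rep_l2_sym_eqI)
       (simp add: Rep_C plus_l2_sym.rep_eq tens_add_left tens_add_right scaleC_add_right)
  show "C (a *\<^sub>C f) = a *\<^sub>C C f"
    by (rule Rep_l2_sym_eqI)
       (simp add: Rep_C scaleC_l2_sym.rep_eq tens_scaleC_left tens_scaleC_right scaleC_add_right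
          scaleC_scaleC mult.commute)
qed

lemma clinear_mult_sym:
  assumes "bounded_measurable w" "\<And>p. w (prod.swap p) = w p"
  shows "clinear_map (mult_sym w)"
  unfolding clinear_map_def
  by (intro conjI allI; rule Rep_l2_sym_eqI)
     (simp_all add: Rep_mult_sym[OF assms] plus_l2_sym.rep_eq scaleC_l2_sym.rep_eq
        clinear_mapD(1,2)[OF clinear_mult_l2[OF assms(1)]])

lemma clinear_D: "clinear_map D"
  using clinear_mult_sym[OF bounded_measurable_W W_swap] by (simp add: D_eq[abs_def])

lemma clinear_B: "clinear_map B"
  unfolding clinear_map_def
  by (intro conjI allI; rule cinner_ext) (simp_all add: cinner_B cinner_add_left cinner_scaleC_left)

lemma norm_Rep_l2_sym: "norm (Rep_l2_sym g) = sqrt 2 * norm g"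
  by (rule power2_eq_imp_eq) (simp_all add: norm_l2_sym_Rep power_mult_distrib)

lemma norm_mult_sym_le:
  assumes w: "bounded_measurable w" "\<And>p. w (prod.swap p) = w p" and c: "\<And>p. \<bar>w p\<bar> \<le> c"
  shows "norm (mult_sym w g) \<le> c * norm g"
  using norm_mult_l2_le[OF w(1) c, of "Rep_l2_sym g"]
  by (simp add: Rep_mult_sym[OF w, symmetric] norm_Rep_l2_sym mult.left_commute)

lemma norm_C_le: "norm (C f) \<le> 2 * (\<bar>\<alpha>\<bar> * norm u) * norm f"
proof -
  have "norm (C f) \<le> norm (Rep_l2_sym (C f))"
    unfolding norm_Rep_l2_sym by (simp add: mult_le_cancel_right1)
  also have "\<dots> \<le> \<bar>\<alpha>\<bar> * (norm (tens u f) + norm (tens f u))"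
    unfolding Rep_C by (simp add: mult_left_mono norm_triangle_ineq)
  finally show ?thesis by (simp add: norm_tens algebra_simps)
qed

lemma norm_B_le: "norm (B g) \<le> 2 * (\<bar>\<alpha>\<bar> * norm u) * norm g"
proof (rule norm_le_cinnerI)
  fix f
  have "cmod (cinner (B g) f) \<le> norm g * norm (C f)"
    unfolding cinner_B by (rule cmod_cinner_le)
  also have "\<dots> \<le> norm g * (2 * (\<bar>\<alpha>\<bar> * norm u) * norm f)"
    by (intro mult_left_mono norm_C_le) simp
  finally show "cmod (cinner (B g) f) \<le> 2 * (\<bar>\<alpha>\<bar> * norm u) * norm g * norm f" by (simp add: ac_simps)
qed simp

lemma T_eq: "T x = (A (fst x) + B (snd x), C (fst x) + D (snd x))"
  by (simp add: T_def block_op_def case_prod_unfold)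

lemma clinear_T: "clinear_map T"
  unfolding clinear_map_def
  by (simp add: T_eq scaleC_prod_def clinear_mapD(1,2)[OF clinear_A] clinear_mapD(1,2)[OF clinear_B]
      clinear_mapD(1,2)[OF clinear_C] clinear_mapD(1,2)[OF clinear_D] scaleC_add_right)

lemma bounded_linear_T: "bounded_linear T"
proof -
  have "bounded_linear A"
    unfolding A_eq[abs_def] by (intro bounded_linear_mult_l2 bounded_measurable_add bounded_measurable_const bounded_measurable_\<omega>)
  moreover have "bounded_linear B" "bounded_linear C"
    by (rule clinear_map_bounded_linear[OF clinear_B norm_B_le] clinear_map_bounded_linear[OF clinear_C norm_C_le])+
  moreover have "bounded_linear D"
  proof -
    obtain M where "\<And>p. \<bar>W p\<bar> \<le> M" using bounded_measurableE[OF bounded_measurable_W] by metis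
    then show ?thesis
      unfolding D_eq[abs_def] using bounded_measurable_W
      by (intro clinear_map_bounded_linear[of _ M] clinear_mult_sym norm_mult_sym_le) auto
  qed
  ultimately show ?thesis
    unfolding T_eq[abs_def]
    by (intro bounded_linear_Pair bounded_linear_add bounded_linear_compose[OF _ bounded_linear_fst]
        bounded_linear_compose[OF _ bounded_linear_snd])
qed

lemma cinner_A: "cinner (A f) f' = cinner f (A f')"
  unfolding A_eq by (intro mult_l2_selfadjoint bounded_measurable_add bounded_measurable_const bounded_measurable_\<omega>)

lemma cinner_mult_sym:
  assumes "bounded_measurable w" "\<And>p. w (prod.swap p) = w p"
  shows "cinner (mult_sym w g) h = cinner g (mult_sym w h)"
  by (simp add: cinner_Rep_sym Rep_mult_sym[OF assms] mult_l2_selfadjoint[OF assms(1)])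

lemma cinner_D: "cinner (D g) h = cinner g (D h)"
  unfolding D_eq by (rule cinner_mult_sym[OF bounded_measurable_W W_swap])

lemma cinner_C_left: "cinner (C f) g = cinner f (B g)"
  by (subst cinner_commute, subst (2) cinner_commute) (simp add: cinner_B)

lemma symmetric_T: "symmetric_op T"
  by (simp add: symmetric_op_def T_eq cinner_prod_def cinner_add_left cinner_add_right cinner_A cinner_B
      cinner_C_left cinner_D)

section \<open>The Schur complement for \<open>z < m\<close>, with \<open>R z\<close> the inverse of
  \<open>D - z\<close>\<close>

definition "R z = mult_sym (\<lambda>p. 1 / (W p - z))"

definition "S z f = A f - complex_of_real z *\<^sub>C f - B (R z (C f))"

lemma Rep_R: "z < m \<Longrightarrow> Rep_l2_sym (R z g) = mult_l2 (\<lambda>p. 1 / (W p - z)) (Rep_l2_sym g)"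
  unfolding R_def by (intro Rep_mult_sym bounded_measurable_inverse_W) simp_all

lemma mult_W_minus_z: "mult_l2 (\<lambda>p. W p - z) G = mult_l2 W G - complex_of_real z *\<^sub>C G"
  using mult_l2_diff[OF bounded_measurable_W bounded_measurable_const, of z G] by (simp add: mult_l2_const)

lemma Rep_D_minus_z: "Rep_l2_sym (D g - complex_of_real z *\<^sub>C g) = mult_l2 (\<lambda>p. W p - z) (Rep_l2_sym g)"
  by (simp add: minus_l2_sym.rep_eq scaleC_l2_sym.rep_eq Rep_D mult_W_minus_z)

lemma mult_W_inverse:
  assumes "z < m"
  shows "mult_l2 (\<lambda>p. W p - z) (mult_l2 (\<lambda>p. 1 / (W p - z)) G) = G"
    "mult_l2 (\<lambda>p. 1 / (W p - z)) (mult_l2 (\<lambda>p. W p - z) G) = G"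
proof -
  have ne: "W p - z \<noteq> 0" for p using W_ge[of p] assms by simp
  have bm: "bounded_measurable (\<lambda>p. W p - z)"
    by (intro bounded_measurable_diff bounded_measurable_W bounded_measurable_const)
  have "mult_l2 (\<lambda>p. 1) G = G" by (simp add: mult_l2_const scaleR_scaleC[symmetric] del: of_real_1)
  then show "mult_l2 (\<lambda>p. W p - z) (mult_l2 (\<lambda>p. 1 / (W p - z)) G) = G"
    "mult_l2 (\<lambda>p. 1 / (W p - z)) (mult_l2 (\<lambda>p. W p - z) G) = G"
    using ne by (simp_all add: mult_l2_compose[OF bm bounded_measurable_inverse_W[OF assms]]
        mult_l2_compose[OF bounded_measurable_inverse_W[OF assms] bm])
qed

lemma D_R: "z < m \<Longrightarrow> D (R z g) - complex_of_real z *\<^sub>C R z g = g"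
  by (rule Rep_l2_sym_eqI) (simp add: Rep_D_minus_z Rep_R mult_W_inverse)

lemma R_D: "z < m \<Longrightarrow> R z (D g - complex_of_real z *\<^sub>C g) = g"
  by (rule Rep_l2_sym_eqI) (simp add: Rep_D_minus_z Rep_R mult_W_inverse)

lemma clinear_R: "z < m \<Longrightarrow> clinear_map (R z)"
  unfolding R_def by (intro clinear_mult_sym bounded_measurable_inverse_W) simp_all

lemma cinner_R: "z < m \<Longrightarrow> cinner (R z g) h = cinner g (R z h)"
  unfolding R_def by (intro cinner_mult_sym bounded_measurable_inverse_W) simp_all

lemma clinear_S:
  assumes "z < m"
  shows "clinear_map (S z)"
  unfolding clinear_map_def
proof (intro conjI allI)
  note lin = clinear_mapD(1,2)[OF clinear_A] clinear_mapD(1,2)[OF clinear_B] clinear_mapD(1,2)[OF clinear_C]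
    clinear_mapD(1,2)[OF clinear_R[OF assms]]
  fix f g a
  show "S z (f + g) = S z f + S z g"
    unfolding S_def lin scaleC_add_right by simp
  show "S z (a *\<^sub>C f) = a *\<^sub>C S z f"
    unfolding S_def lin complex_vector.scale_right_diff_distrib scaleC_scaleC by (simp only: mult.commute)
qed

lemma cinner_S: "cinner (S z f) f' = cinner (A f) f' - complex_of_real z * cinner f f' - cinner (R z (C f)) (C f')"
  by (simp add: S_def cinner_diff_left cinner_scaleC_left cinner_B)

lemma S_symmetric: "z < m \<Longrightarrow> cinner (S z f) f' = cinner f (S z f')"
  unfolding cinner_S
  by (simp add: S_def cinner_diff_right cinner_scaleC_right cinner_A cinner_R cinner_C_left)

text \<open>The second component solves the second row exactly, so an approximate kernel vector of
  \<open>S z\<close> lifts to an approximate eigenvector of \<open>T\<close> with the same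
  residual.\<close>

lemma T_Schur_vector:
  assumes "z < m"
  shows "T (f, - R z (C f)) - complex_of_real z *\<^sub>C (f, - R z (C f)) = (S z f, 0)"
proof -
  have "C f + (D (- R z (C f)) - complex_of_real z *\<^sub>C (- R z (C f))) = 0"
    using D_R[OF assms, of "C f"] by (simp add: clinear_mapD[OF clinear_D] algebra_simps)
  then show ?thesis
    by (simp add: T_eq scaleC_prod_def S_def clinear_mapD[OF clinear_B] algebra_simps)
qed

text \<open>As \<open>D - z\<close> is invertible, the second row determines \<open>snd x\<close>
  from \<open>fst x\<close>; substitution into the first row produces \<open>S z\<close>.\<close>

lemma eigenvector_Schur:
  assumes "z < m" "T x = complex_of_real z *\<^sub>C x" "x \<noteq> 0"
  shows "fst x \<noteq> 0" "S z (fst x) = 0"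
proof -
  have 1: "A (fst x) + B (snd x) = complex_of_real z *\<^sub>C fst x"
    and 2: "C (fst x) + D (snd x) = complex_of_real z *\<^sub>C snd x"
    using assms(2) by (auto simp: T_eq scaleC_prod_def)
  have "D (snd x) - complex_of_real z *\<^sub>C snd x = - C (fst x)"
    unfolding 2[symmetric] by simp
  then have snd: "snd x = - R z (C (fst x))"
    using R_D[OF assms(1), of "snd x"] by (simp add: clinear_mapD[OF clinear_R[OF assms(1)]])
  then show "fst x \<noteq> 0"
    using assms(3) clinear_mapD(3)[OF clinear_C] clinear_mapD(3)[OF clinear_R[OF assms(1)]]
    by (metis minus_zero prod.collapse zero_prod_def)
  show "S z (fst x) = 0"
    using 1 unfolding snd by (simp add: S_def clinear_mapD[OF clinear_B] algebra_simps)
qed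

lemma inner_R_mono:
  assumes "z < z'" "z' < m"
  shows "inner (R z g) g \<le> inner (R z' g) g"
proof -
  have "inner (mult_l2 (\<lambda>p. 1 / (W p - z)) (Rep_l2_sym g)) (Rep_l2_sym g)
      \<le> inner (mult_l2 (\<lambda>p. 1 / (W p - z')) (Rep_l2_sym g)) (Rep_l2_sym g)"
  proof (rule inner_mult_l2_mono)
    show "1 / (W p - z) \<le> 1 / (W p - z')" for p
      using W_ge[of p] assms by (intro divide_left_mono) auto
  qed (use assms in \<open>auto intro!: bounded_measurable_inverse_W\<close>)
  then show ?thesis using assms by (simp add: inner_l2_sym.rep_eq Rep_R)
qed

text \<open>The term \<open>- z\<close> decreases strictly, and the form of \<open>R z\<close>
  increases because \<open>z\<close> stays below all values of \<open>W\<close>.\<close>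

lemma inner_S_strict_antimono:
  assumes "z < z'" "z' < m" "f \<noteq> 0"
  shows "inner (S z' f) f < inner (S z f) f"
proof -
  have eq: "inner (S t f) f = inner (A f) f - t * (norm f)\<^sup>2 - inner (R t (C f)) (C f)" for t
    using arg_cong[OF cinner_S[of t f f], of Re] by (simp add: inner_eq_Re_cinner cinner_self)
  have "z * (norm f)\<^sup>2 < z' * (norm f)\<^sup>2" using assms by simp
  then show ?thesis unfolding eq using inner_R_mono[OF assms(1,2), of "C f"] by simp
qed

text \<open>Completing the square in the second component.\<close>

lemma inner_T_ge:
  assumes "z < m"
  shows "inner (S z (fst x)) (fst x) + z * (norm x)\<^sup>2 \<le> inner (T x) x"
proof -
  define f g where "f = fst x" and "g = snd x"
  define h where "h = R z (C f)"
  have Dh: "D h = C f + complex_of_real z *\<^sub>C h"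
    using D_R[OF assms, of "C f"] by (simp add: h_def algebra_simps)
  have "inner (mult_l2 (\<lambda>p. 0) (Rep_l2_sym (g + h))) (Rep_l2_sym (g + h))
      \<le> inner (mult_l2 (\<lambda>p. W p - z) (Rep_l2_sym (g + h))) (Rep_l2_sym (g + h))"
  proof (rule inner_mult_l2_mono)
    show "0 \<le> W p - z" for p using W_ge[of p] assms by simp
  qed (auto intro!: bounded_measurable_diff bounded_measurable_W)
  then have "0 \<le> inner (D (g + h) - complex_of_real z *\<^sub>C (g + h)) (g + h)"
    unfolding inner_l2_sym.rep_eq Rep_D_minus_z by (simp add: mult_l2_const)
  also have "D (g + h) - complex_of_real z *\<^sub>C (g + h) = D g - z *\<^sub>R g + C f"
    by (simp add: clinear_mapD[OF clinear_D] Dh scaleC_add_right scaleR_scaleC)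
  also have "inner \<dots> (g + h) = inner (D g) g - z * (norm g)\<^sup>2 + inner (C f) g + inner (D g - z *\<^sub>R g) h + inner (C f) h"
    by (simp add: inner_add_left inner_add_right inner_diff_left power2_norm_eq_inner)
  also have "inner (D g - z *\<^sub>R g) h = inner g (C f)"
  proof -
    have "inner (D g) h = inner g (D h)" by (simp add: inner_eq_Re_cinner cinner_D)
    then show ?thesis by (simp add: inner_diff_left Dh inner_add_right scaleR_scaleC[symmetric])
  qed
  finally have 1: "0 \<le> inner (D g) g - z * (norm g)\<^sup>2 + 2 * inner (C f) g + inner (C f) h"
    by (simp add: inner_commute)
  have 2: "inner (S z f) f = inner (A f) f - z * (norm f)\<^sup>2 - inner (C f) h"
    using arg_cong[OF cinner_S[of z f f], of Re]
    by (simp add: inner_eq_Re_cinner[symmetric] power2_norm_eq_inner h_def inner_commute)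
  have 3: "inner (T x) x = inner (A f) f + 2 * inner (C f) g + inner (D g) g"
  proof -
    have "inner (B g) f = inner (C f) g"
      using arg_cong[OF cinner_B[of g f], of Re] by (simp add: inner_eq_Re_cinner[symmetric] inner_commute)
    then show ?thesis by (simp add: T_eq inner_prod_def f_def g_def inner_add_left)
  qed
  have 4: "(norm x)\<^sup>2 = (norm f)\<^sup>2 + (norm g)\<^sup>2"
    by (simp add: power2_norm_eq_inner inner_prod_def f_def g_def)
  show ?thesis unfolding f_def[symmetric] 2 3 4 using 1 by (simp add: algebra_simps)
qed

text \<open>
  The diagonal part of the Schur complement at \<open>z\<close> is multiplication by
  \<open>\<omega> k - \<gamma> - z - \<alpha>\<^sup>2 \<integral> \<bar>\<lambda> q\<bar>\<^sup>2 / (\<omega> k + \<omega> q + \<gamma> - z) dq\<close>, and this depends on \<open>k\<close> and \<open>z\<close> only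
  through \<open>z - \<omega> k\<close>.
\<close>

definition "selfenergy t = (LINT q|lborel. (cmod (lam q))\<^sup>2 / (\<omega> q + \<gamma> - t))"
definition "\<Phi> t = t + \<alpha>\<^sup>2 * selfenergy t"
definition "\<Delta> z k = - \<gamma> - \<Phi> (z - \<omega> k)"
text \<open>Kernel of the off-diagonal part of the Schur complement, up to the factor
  \<open>\<alpha>\<^sup>2\<close>; almost everywhere it equals
  \<open>cnj (lam k) * lam q / (W (k, q) - z)\<close>.\<close>

definition "\<kappa> z = mult_l2 (\<lambda>p. 1 / (W p - z)) (tens u (cnj_l2 u))"

lemma \<tau>_le: "\<tau> \<le> \<omega> q + \<gamma>"
  using \<omega>_ge[of q] by (simp add: \<tau>_def)

lemma m_eq: "m = \<tau> + \<omega>\<^sub>0"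
  by (simp add: m_def \<tau>_def)

lemma integrable_lam: "integrable lborel (\<lambda>q. (cmod (lam q))\<^sup>2)"
  using lam by (simp add: square_integrable_def)

lemma integrable_selfenergy:
  assumes "t < \<tau>"
  shows "integrable lborel (\<lambda>q. (cmod (lam q))\<^sup>2 / (\<omega> q + \<gamma> - t))"
proof (rule Bochner_Integration.integrable_bound)
  show "integrable lborel (\<lambda>q. (cmod (lam q))\<^sup>2 / (\<tau> - t))"
    using integrable_lam by simp
  show "AE q in lborel. norm ((cmod (lam q))\<^sup>2 / (\<omega> q + \<gamma> - t)) \<le> norm ((cmod (lam q))\<^sup>2 / (\<tau> - t))"
  proof (rule AE_I2)
    fix q
    have "(cmod (lam q))\<^sup>2 / (\<omega> q + \<gamma> - t) \<le> (cmod (lam q))\<^sup>2 / (\<tau> - t)"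
      using \<tau>_le[of q] assms by (intro divide_left_mono mult_pos_pos) auto
    moreover have "0 \<le> \<omega> q + \<gamma> - t" using \<tau>_le[of q] assms by simp
    ultimately show "norm ((cmod (lam q))\<^sup>2 / (\<omega> q + \<gamma> - t)) \<le> norm ((cmod (lam q))\<^sup>2 / (\<tau> - t))"
      using assms by simp
  qed
qed measurable

lemma selfenergy_nonneg: "t < \<tau> \<Longrightarrow> 0 \<le> selfenergy t"
  unfolding selfenergy_def
proof (rule integral_nonneg_AE, rule AE_I2)
  fix q assume "t < \<tau>"
  then show "0 \<le> (cmod (lam q))\<^sup>2 / (\<omega> q + \<gamma> - t)" using \<tau>_le[of q] by simp
qed

lemma selfenergy_mono:
  assumes "t \<le> t'" "t' < \<tau>"
  shows "selfenergy t \<le> selfenergy t'"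
  unfolding selfenergy_def
proof (rule integral_mono)
  show "(cmod (lam q))\<^sup>2 / (\<omega> q + \<gamma> - t) \<le> (cmod (lam q))\<^sup>2 / (\<omega> q + \<gamma> - t')" for q
    using \<tau>_le[of q] assms by (intro divide_left_mono mult_pos_pos) auto
qed (use assms in \<open>auto intro!: integrable_selfenergy\<close>)

text \<open>Difference of reciprocals. The constant is uniform only up to some
  \<open>b < \<tau>\<close>, since at \<tau> the denominators have infimum 0.\<close>

lemma selfenergy_lipschitz:
  assumes "t \<le> t'" "t' \<le> b" "b < \<tau>"
  shows "selfenergy t' - selfenergy t \<le> (LINT q|lborel. (cmod (lam q))\<^sup>2) / (\<tau> - b)\<^sup>2 * (t' - t)"
proof -
  have "selfenergy t' - selfenergy t
      = (LINT q|lborel. (cmod (lam q))\<^sup>2 / (\<omega> q + \<gamma> - t') - (cmod (lam q))\<^sup>2 / (\<omega> q + \<gamma> - t))"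
    unfolding selfenergy_def
    by (intro Bochner_Integration.integral_diff[symmetric] integrable_selfenergy) (use assms in auto)
  also have "\<dots> \<le> (LINT q|lborel. (cmod (lam q))\<^sup>2 * ((t' - t) / (\<tau> - b)\<^sup>2))"
  proof (rule integral_mono)
    fix q
    have *: "0 < \<tau> - b" "\<tau> - b \<le> \<omega> q + \<gamma> - t'" "\<tau> - b \<le> \<omega> q + \<gamma> - t"
      using \<tau>_le[of q] assms by auto
    then have "(cmod (lam q))\<^sup>2 / (\<omega> q + \<gamma> - t') - (cmod (lam q))\<^sup>2 / (\<omega> q + \<gamma> - t)
        = (cmod (lam q))\<^sup>2 * ((t' - t) / ((\<omega> q + \<gamma> - t') * (\<omega> q + \<gamma> - t)))"
      by (simp add: field_simps)
    also have "\<dots> \<le> (cmod (lam q))\<^sup>2 * ((t' - t) / (\<tau> - b)\<^sup>2)"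
      unfolding power2_eq_square[of "\<tau> - b"]
      using * assms by (intro mult_left_mono divide_left_mono mult_mono mult_pos_pos) auto
    finally show "(cmod (lam q))\<^sup>2 / (\<omega> q + \<gamma> - t') - (cmod (lam q))\<^sup>2 / (\<omega> q + \<gamma> - t)
        \<le> (cmod (lam q))\<^sup>2 * ((t' - t) / (\<tau> - b)\<^sup>2)" .
  qed (use assms in \<open>auto intro!: integrable_selfenergy Bochner_Integration.integrable_diff integrable_mult_left integrable_lam\<close>)
  finally show ?thesis by simp
qed

lemma continuous_on_selfenergy:
  assumes "b < \<tau>"
  shows "continuous_on {..b} selfenergy"
proof -
  define L where "L = (LINT q|lborel. (cmod (lam q))\<^sup>2) / (\<tau> - b)\<^sup>2"
  have L: "0 \<le> L" by (simp add: L_def)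
  have le: "\<bar>selfenergy t' - selfenergy t\<bar> \<le> L * \<bar>t' - t\<bar>" if "t \<le> t'" "t' \<le> b" for t t'
    using selfenergy_lipschitz[OF that assms] selfenergy_mono[OF that(1)] that assms by (simp add: L_def)
  have "L-lipschitz_on {..b} selfenergy"
  proof (rule lipschitz_onI)
    fix x y assume "x \<in> {..b}" "y \<in> {..b}"
    then show "dist (selfenergy x) (selfenergy y) \<le> L * dist x y"
      using le[of x y] le[of y x] by (cases "x \<le> y") (auto simp: dist_real_def abs_minus_commute)
  qed (rule L)
  then show ?thesis by (rule lipschitz_on_continuous_on)
qed

lemma continuous_on_\<Phi>: "b < \<tau> \<Longrightarrow> continuous_on {..b} \<Phi>"
  unfolding \<Phi>_def[abs_def] by (intro continuous_intros continuous_on_selfenergy)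

text \<open>Slope at least one. This turns \<open>\<omega> k - \<omega>\<^sub>0\<close> into a lower
  bound for \<open>\<Delta> z k\<close> and so leads to the quotient in the integrability condition
  at the bottom.\<close>

lemma \<Phi>_diff_ge: "t \<le> t' \<Longrightarrow> t' < \<tau> \<Longrightarrow> t' - t \<le> \<Phi> t' - \<Phi> t"
  using mult_left_mono[OF selfenergy_mono, of t t' "\<alpha>\<^sup>2"] by (simp add: \<Phi>_def)

text \<open>\<open>\<Phi>\<close> is unbounded below, so a failure of the first alternative yields a root.\<close>

lemma \<Phi>_cases:
  obtains (below) "\<And>t. t < \<tau> \<Longrightarrow> \<Phi> t < - \<gamma>" | (root) t where "t < \<tau>" "\<Phi> t = - \<gamma>"
proof (cases "\<forall>t<\<tau>. \<Phi> t < - \<gamma>")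
  case False
  then obtain t1 where t1: "t1 < \<tau>" "- \<gamma> \<le> \<Phi> t1" by (auto simp: not_less)
  \<comment> \<open>The bound \<open>\<tau> - 1\<close> makes the self-energy at \<open>t0\<close>
    at most that at \<open>\<tau> - 1\<close>; the last entry then forces
    \<open>\<Phi> t0 \<le> - \<gamma>\<close>.\<close>
  define t0 where "t0 = min t1 (min (\<tau> - 1) (- \<gamma> - \<alpha>\<^sup>2 * selfenergy (\<tau> - 1)))"
  have "\<alpha>\<^sup>2 * selfenergy t0 \<le> \<alpha>\<^sup>2 * selfenergy (\<tau> - 1)"
    by (intro mult_left_mono selfenergy_mono) (auto simp: t0_def)
  then have t0: "\<Phi> t0 \<le> - \<gamma>" "t0 \<le> t1" by (auto simp: \<Phi>_def t0_def)
  have "continuous_on {t0..t1} \<Phi>"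
    by (rule continuous_on_subset[OF continuous_on_\<Phi>[OF t1(1)]]) auto
  then obtain t where "t \<le> t1" "\<Phi> t = - \<gamma>"
    using IVT'[of \<Phi> t0 "- \<gamma>" t1] t0 t1 by auto
  then show ?thesis using root[of t] t1 by simp
qed (use below in blast)

section \<open>Bounds and continuity of the multiplier \<open>\<Delta> z\<close>\<close>

lemma z_minus_\<omega>_less: "z < m \<Longrightarrow> z - \<omega> k < \<tau>"
  using \<omega>_ge[of k] by (simp add: m_eq)

lemma \<Delta>_ge: "z < m \<Longrightarrow> - \<gamma> - \<Phi> (z - \<omega>\<^sub>0) + (\<omega> k - \<omega>\<^sub>0) \<le> \<Delta> z k"
  using \<Phi>_diff_ge[of "z - \<omega> k" "z - \<omega>\<^sub>0"] \<omega>_ge[of k] by (simp add: \<Delta>_def m_eq)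

lemma \<Delta>_le: "z < m \<Longrightarrow> \<Delta> z k \<le> - \<gamma> - \<Phi> (z - \<omega>\<^sub>1)"
  using \<Phi>_diff_ge[of "z - \<omega>\<^sub>1" "z - \<omega> k"] \<omega>_le[of k] z_minus_\<omega>_less[of z k] by (simp add: \<Delta>_def)

lemma continuous_on_\<omega>_comp:
  assumes "z < m" "\<And>b. b < \<tau> \<Longrightarrow> continuous_on {..b} F"
  shows "continuous_on UNIV (\<lambda>k. F (z - \<omega> k))"
proof (rule continuous_on_compose2[of "{..z - \<omega>\<^sub>0}" F])
  show "continuous_on {..z - \<omega>\<^sub>0} F" using assms by (simp add: m_eq)
qed (use \<omega>_ge in \<open>auto intro!: continuous_intros cont\<close>)

lemma continuous_on_\<Delta>: "z < m \<Longrightarrow> continuous_on UNIV (\<Delta> z)"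
  unfolding \<Delta>_def[abs_def] by (intro continuous_on_diff continuous_on_const continuous_on_\<omega>_comp continuous_on_\<Phi>)

lemma bounded_measurable_selfenergy:
  assumes "z < m"
  shows "bounded_measurable (\<lambda>k. selfenergy (z - \<omega> k))"
proof (rule bounded_measurableI)
  show "(\<lambda>k. selfenergy (z - \<omega> k)) \<in> borel_measurable borel"
    by (intro borel_measurable_continuous_onI continuous_on_\<omega>_comp continuous_on_selfenergy assms)
  show "\<bar>selfenergy (z - \<omega> k)\<bar> \<le> selfenergy (z - \<omega>\<^sub>0)" for k
    using selfenergy_nonneg[OF z_minus_\<omega>_less[OF assms]] \<omega>_ge[of k] assms
    by (simp add: selfenergy_mono m_eq)
qed

lemma \<Delta>_eq: "\<Delta> z k = (- \<gamma> + \<omega> k) - z - \<alpha>\<^sup>2 * selfenergy (z - \<omega> k)"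
  by (simp add: \<Delta>_def \<Phi>_def)

lemma bounded_measurable_\<Delta>: "z < m \<Longrightarrow> bounded_measurable (\<Delta> z)"
  unfolding \<Delta>_eq[abs_def]
  by (intro bounded_measurable_diff bounded_measurable_add bounded_measurable_cmult bounded_measurable_const
      bounded_measurable_\<omega> bounded_measurable_selfenergy)

text \<open>Integrating out \<open>q\<close> leaves a function of \<open>k\<close> alone, because
  \<open>W (k, q) - z = \<omega> q + \<gamma> - (z - \<omega> k)\<close> and both tensors carry
  \<open>u\<close> in the second variable.\<close>

lemma cinner_mult_tens_diagonal:
  assumes z: "z < m"
  shows "cinner (mult_l2 (\<lambda>p. 1 / (W p - z)) (tens f u)) (tens f' u)
    = cinner (mult_l2 (\<lambda>k. selfenergy (z - \<omega> k)) f) f'"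
proof -
  define h h' where "h = rep_l2 f" and "h' = rep_l2 f'"
  have h: "square_integrable h" "f = abs_l2 h" "square_integrable h'" "f' = abs_l2 h'"
    by (simp_all add: h_def h'_def square_integrable_rep_l2 abs_rep_l2)
  note sqc = square_integrable_cnj[OF lam]
  note bm = bounded_measurable_inverse_W[OF z]
  have sq: "square_integrable (\<lambda>(k, q). h k * cnj (lam q))" "square_integrable (\<lambda>(k, q). h' k * cnj (lam q))"
    using square_integrable_tensor h sqc by blast+
  note sqM = square_integrable_mult_l2[OF bm sq(1)]
  have "cinner (mult_l2 (\<lambda>p. 1 / (W p - z)) (tens f u)) (tens f' u)
      = (LINT p|lborel. complex_of_real (1 / (W p - z)) * (case p of (k, q) \<Rightarrow> h k * cnj (lam q))
          * cnj (case p of (k, q) \<Rightarrow> h' k * cnj (lam q)))"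
    unfolding h(2,4) u_def tens_abs[OF h(1) sqc] tens_abs[OF h(3) sqc] mult_l2_abs[OF bm sq(1)]
    by (rule cinner_abs_l2[OF sqM sq(2)])
  also have "\<dots> = (LINT k|lborel. LINT q|lborel. complex_of_real (1 / (W (k, q) - z)) * (h k * cnj (lam q)) * cnj (h' k * cnj (lam q)))"
    by (subst integral_lborel_prod[OF square_integrable_prod[OF sqM square_integrable_cnj[OF sq(2)]]]) simp
  also have "\<dots> = (LINT k|lborel. complex_of_real (selfenergy (z - \<omega> k)) * (h k * cnj (h' k)))"
  proof (rule Bochner_Integration.integral_cong[OF refl])
    fix k
    have "complex_of_real (1 / (W (k, q) - z)) * (h k * cnj (lam q)) * cnj (h' k * cnj (lam q))
        = complex_of_real ((cmod (lam q))\<^sup>2 / (\<omega> q + \<gamma> - (z - \<omega> k))) * (h k * cnj (h' k))" for q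
    proof -
      have "complex_of_real ((cmod (lam q))\<^sup>2) = lam q * cnj (lam q)" by (rule complex_norm_square)
      moreover have "\<omega> q + \<gamma> - (z - \<omega> k) = W (k, q) - z" by (simp add: W_def)
      ultimately show ?thesis by (simp only: of_real_divide) (simp add: ac_simps)
    qed
    then have "(LINT q|lborel. complex_of_real (1 / (W (k, q) - z)) * (h k * cnj (lam q)) * cnj (h' k * cnj (lam q)))
        = (LINT q|lborel. complex_of_real ((cmod (lam q))\<^sup>2 / (\<omega> q + \<gamma> - (z - \<omega> k)))) * (h k * cnj (h' k))"
      by (simp only: integral_mult_left_zero)
    then show "(LINT q|lborel. complex_of_real (1 / (W (k, q) - z)) * (h k * cnj (lam q)) * cnj (h' k * cnj (lam q)))
        = complex_of_real (selfenergy (z - \<omega> k)) * (h k * cnj (h' k))"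
      by (simp only: selfenergy_def integral_complex_of_real)
  qed
  also have "\<dots> = cinner (mult_l2 (\<lambda>k. selfenergy (z - \<omega> k)) f) f'"
    by (simp add: cinner_mult_l2[OF bounded_measurable_selfenergy[OF z]] h_def h'_def)
  finally show ?thesis .
qed

lemma mult_\<Delta>:
  assumes "z < m"
  shows "mult_l2 (\<Delta> z) f = A f - complex_of_real z *\<^sub>C f
    - complex_of_real (\<alpha>\<^sup>2) *\<^sub>C mult_l2 (\<lambda>k. selfenergy (z - \<omega> k)) f"
proof -
  note bm = bounded_measurable_add[OF bounded_measurable_const bounded_measurable_\<omega>, of "- \<gamma>"]
  show ?thesis
    unfolding \<Delta>_eq[abs_def] A_eq
    by (simp only: mult_l2_diff[OF bounded_measurable_diff[OF bm bounded_measurable_const] bounded_measurable_cmult[OF bounded_measurable_selfenergy[OF assms]]]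
        mult_l2_diff[OF bm bounded_measurable_const] mult_l2_const mult_l2_cmult[OF bounded_measurable_selfenergy[OF assms]])
qed

text \<open>\<open>C f\<close> consists of \<open>tens u f\<close> and \<open>tens f u\<close>, and
  by symmetry the other side may be taken to be \<open>tens f' u\<close>. The second tensor yields
  the self-energy and completes \<open>\<Delta> z\<close>; the first couples different points and
  remains as an integral operator.\<close>

lemma cinner_S_kernel:
  assumes z: "z < m"
  shows "cinner (S z f) f' = cinner (mult_l2 (\<Delta> z) f) f'
    - complex_of_real (\<alpha>\<^sup>2) * cinner (mult_l2 (\<lambda>p. 1 / (W p - z)) (tens u f)) (tens f' u)"
proof -
  note lin = clinear_mapD[OF clinear_mult_l2[OF bounded_measurable_inverse_W[OF z]]]
  have "cinner (R z (C f)) (C f') = complex_of_real (\<alpha>\<^sup>2) *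
      (cinner (mult_l2 (\<lambda>p. 1 / (W p - z)) (tens u f)) (tens f' u) + cinner (mult_l2 (\<lambda>p. 1 / (W p - z)) (tens f u)) (tens f' u))"
    unfolding cinner_C_right Rep_R[OF z] Rep_C lin
    by (simp add: cinner_scaleC_left cinner_add_left lin power2_eq_square mult.assoc)
  then show ?thesis
    unfolding cinner_S mult_\<Delta>[OF z] cinner_mult_tens_diagonal[OF z]
    by (simp add: cinner_diff_left cinner_scaleC_left distrib_left)
qed

text \<open>Regrouping the four factors pointwise separates the fixed kernel, built from
  \<open>u\<close>, from the test functions \<open>f\<close> and \<open>f'\<close>.\<close>

lemma cinner_kernel_tens:
  assumes z: "z < m"
  shows "cinner (mult_l2 (\<lambda>p. 1 / (W p - z)) (tens u f)) (tens f' u) = cinner (\<kappa> z) (tens f' (cnj_l2 f))"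
  unfolding \<kappa>_def cinner_mult_l2[OF bounded_measurable_inverse_W[OF z]]
proof (rule integral_cong_AE)
  have [measurable]: "(\<lambda>p. 1 / (W p - z)) \<in> borel_measurable borel"
    using bounded_measurable_inverse_W[OF z] by (simp add: bounded_measurable_def)
  note [measurable] = square_integrable_measurable[OF square_integrable_cnj[OF square_integrable_rep_l2]]
  show "(\<lambda>p. complex_of_real (1 / (W p - z)) * (rep_l2 (tens u f) p * cnj (rep_l2 (tens f' u) p))) \<in> borel_measurable lborel"
    "(\<lambda>p. complex_of_real (1 / (W p - z)) * (rep_l2 (tens u (cnj_l2 u)) p * cnj (rep_l2 (tens f' (cnj_l2 f)) p))) \<in> borel_measurable lborel"
    by measurable
  show "AE p in lborel. complex_of_real (1 / (W p - z)) * (rep_l2 (tens u f) p * cnj (rep_l2 (tens f' u) p))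
      = complex_of_real (1 / (W p - z)) * (rep_l2 (tens u (cnj_l2 u)) p * cnj (rep_l2 (tens f' (cnj_l2 f)) p))"
    using rep_tens[of u f] rep_tens[of f' u] rep_tens[of u "cnj_l2 u"] rep_tens[of f' "cnj_l2 f"]
      AE_lborel_snd[OF rep_cnj_l2[of u]] AE_lborel_snd[OF rep_cnj_l2[of f]]
    by eventually_elim (simp add: ac_simps)
qed

lemma inner_S_kernel:
  "z < m \<Longrightarrow> inner (S z f) f = inner (mult_l2 (\<Delta> z) f) f - \<alpha>\<^sup>2 * Re (cinner (\<kappa> z) (tens f (cnj_l2 f)))"
  by (simp add: inner_eq_Re_cinner cinner_S_kernel cinner_kernel_tens)

end

section \<open>Points of the spectrum\<close>

text \<open>Dominated convergence: the indicators of the shrinking balls tend to that of a single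
  point, a Lebesgue null set.\<close>

lemma norm_mult_indicator_small:
  fixes h :: "'a::euclidean_space l2" and k\<^sub>0 :: 'a
  shows "(\<lambda>n. norm (mult_l2 (indicat_real (ball k\<^sub>0 (1 / real (Suc n)))) h)) \<longlonglongrightarrow> 0"
proof -
  define E where "E n = ball k\<^sub>0 (1 / real (Suc n))" for n
  have sq: "(norm (mult_l2 (indicat_real (E n)) h))\<^sup>2 = (LINT x|lborel. indicator (E n) x * (cmod (rep_l2 h x))\<^sup>2)" for n
  proof -
    have "bounded_measurable (indicat_real (E n))" by (simp add: E_def)
    from norm_abs_l2[OF square_integrable_mult_l2[OF this square_integrable_rep_l2], of h]
    moreover have "(indicator (E n) x)\<^sup>2 = (indicator (E n) x :: real)" for x
      by (simp add: indicator_def)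
    ultimately show ?thesis by (simp add: mult_l2_def norm_mult power_mult_distrib)
  qed
  have "(\<lambda>n. LINT x|lborel. indicator (E n) x * (cmod (rep_l2 h x))\<^sup>2) \<longlonglongrightarrow> (LINT x|lborel. indicator {k\<^sub>0} x * (cmod (rep_l2 h x))\<^sup>2)"
  proof (rule integral_dominated_convergence)
    show "integrable lborel (\<lambda>x. (cmod (rep_l2 h x))\<^sup>2)"
      using square_integrable_rep_l2[of h] by (simp add: square_integrable_def)
    show "AE x in lborel. (\<lambda>n. indicat_real (E n) x * (cmod (rep_l2 h x))\<^sup>2) \<longlonglongrightarrow> indicat_real {k\<^sub>0} x * (cmod (rep_l2 h x))\<^sup>2"
    proof (intro AE_I2 tendsto_mult_right)
      fix x
      show "(\<lambda>n. indicat_real (E n) x) \<longlonglongrightarrow> indicat_real {k\<^sub>0} x"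
      proof (cases "x = k\<^sub>0")
        case False
        then obtain N where N: "1 / real (Suc N) < dist k\<^sub>0 x"
          using nat_approx_posE[of "dist k\<^sub>0 x"] by (auto simp: dist_pos_lt)
        have "indicat_real (E n) x = 0" if "n \<ge> N" for n
        proof -
          have "1 / real (Suc n) \<le> 1 / real (Suc N)" using that by (simp add: frac_le)
          then show ?thesis using N by (simp add: E_def indicator_def)
        qed
        then have "\<forall>\<^sub>F n in sequentially. indicat_real (E n) x = indicat_real {k\<^sub>0} x"
          using False by (auto simp: eventually_sequentially)
        then show ?thesis by (rule tendsto_eventually)
      qed (simp add: E_def)
    qed
    show "AE x in lborel. norm (indicat_real (E n) x * (cmod (rep_l2 h x))\<^sup>2) \<le> (cmod (rep_l2 h x))\<^sup>2" for n
      by (auto simp: indicator_def)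
    show "(\<lambda>x. indicat_real (E n) x * (cmod (rep_l2 h x))\<^sup>2) \<in> borel_measurable lborel" for n
    proof -
      have [measurable]: "E n \<in> sets borel" by (simp add: E_def)
      have "(\<lambda>x. indicat_real (E n) x * (cmod (rep_l2 h x))\<^sup>2) \<in> borel_measurable borel" by measurable
      then show ?thesis by simp
    qed
    have "(\<lambda>x. indicat_real {k\<^sub>0} x * (cmod (rep_l2 h x))\<^sup>2) \<in> borel_measurable borel" by measurable
    then show "(\<lambda>x. indicat_real {k\<^sub>0} x * (cmod (rep_l2 h x))\<^sup>2) \<in> borel_measurable lborel" by simp
  qed
  also have "(LINT x|lborel. indicator {k\<^sub>0} x * (cmod (rep_l2 h x))\<^sup>2) = 0"
    by (rule integral_eq_zero_AE)
       (use AE_lborel_singleton[of k\<^sub>0] in \<open>auto elim!: eventually_mono\<close>)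
  finally have "(\<lambda>n. sqrt ((norm (mult_l2 (indicat_real (E n)) h))\<^sup>2)) \<longlonglongrightarrow> sqrt 0"
    unfolding sq by (rule tendsto_real_sqrt)
  then show ?thesis by (simp add: E_def)
qed

text \<open>Building block of Weyl sequences: \<open>f\<close> is the indicator of a ball so small
  that \<open>d\<close> is nearly 0 on it and \<open>h\<close> has little mass there. Below,
  \<open>d\<close> is \<open>\<Delta> z\<close> or \<open>\<omega> - \<omega> k\<^sub>0\<close>, and
  \<open>h\<close> is \<open>u\<close>, so that the coupling to \<open>f\<close> is negligible
  too.\<close>

lemma concentrated_function:
  fixes d :: "'a::euclidean_space \<Rightarrow> real" and h :: "'a l2"
  assumes d: "bounded_measurable d" "isCont d k\<^sub>0" "d k\<^sub>0 = 0" and \<epsilon>: "0 < \<epsilon>"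
  shows "\<exists>E f. E \<in> sets borel \<and> f \<noteq> 0 \<and> mult_l2 (indicat_real E) f = f \<and> norm (mult_l2 d f) \<le> \<epsilon> * norm f
    \<and> norm (mult_l2 (indicat_real E) h) \<le> \<epsilon>"
proof -
  obtain \<delta> where \<delta>: "\<delta> > 0" "\<And>x. dist k\<^sub>0 x < \<delta> \<Longrightarrow> \<bar>d x\<bar> < \<epsilon>"
    using d(2) \<epsilon> unfolding continuous_at_eps_delta by (metis d(3) diff_zero dist_commute dist_real_def)
  have "\<forall>\<^sub>F n in sequentially. norm (mult_l2 (indicat_real (ball k\<^sub>0 (1 / real (Suc n)))) h) < \<epsilon>"
    by (rule order_tendstoD(2)[OF norm_mult_indicator_small \<epsilon>])
  moreover have "\<forall>\<^sub>F n in sequentially. 1 / real (Suc n) < \<delta>"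
    using order_tendstoD(2)[OF LIMSEQ_inverse_real_of_nat \<delta>(1)] by (simp add: inverse_eq_divide)
  ultimately have "\<forall>\<^sub>F n in sequentially. norm (mult_l2 (indicat_real (ball k\<^sub>0 (1 / real (Suc n)))) h) < \<epsilon> \<and> 1 / real (Suc n) < \<delta>"
    by (rule eventually_conj)
  then obtain n where n: "norm (mult_l2 (indicat_real (ball k\<^sub>0 (1 / real (Suc n)))) h) < \<epsilon>" "1 / real (Suc n) < \<delta>"
    by (auto simp: eventually_sequentially)
  define E where "E = ball k\<^sub>0 (1 / real (Suc n))"
  have E: "E \<in> sets borel" by (simp add: E_def)
  have pos: "0 < measure lborel E"
    using content_ball_pos[of "1 / real (Suc n)" k\<^sub>0] by (simp add: E_def)
  define i where "i x = complex_of_real (indicat_real E x)" for x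
  have fin: "emeasure lborel E < \<infinity>"
    unfolding E_def by (rule emeasure_lborel_ball_finite)
  have sqi: "square_integrable i"
  proof -
    have "(\<lambda>x. (cmod (i x))\<^sup>2) = indicat_real E" by (auto simp: i_def indicator_def)
    moreover have "integrable lborel (indicat_real E)" using E fin by (simp add: integrable_indicator_iff)
    moreover have "i \<in> borel_measurable borel" unfolding i_def[abs_def] using E by measurable
    ultimately show ?thesis by (simp add: square_integrable_def)
  qed
  define f where "f = abs_l2 i"
  have "(norm f)\<^sup>2 = measure lborel E"
  proof -
    have "(\<lambda>x. (cmod (i x))\<^sup>2) = indicat_real E" by (auto simp: i_def indicator_def)
    then show ?thesis unfolding f_def norm_abs_l2[OF sqi] using E fin by simp
  qed
  then have "f \<noteq> 0" using pos by auto
  moreover have Ef: "mult_l2 (indicat_real E) f = f"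
  proof -
    have "(\<lambda>x. complex_of_real (indicat_real E x) * i x) = i" by (auto simp: i_def indicator_def)
    then show ?thesis unfolding f_def using mult_l2_abs[OF bounded_measurable_indicator[OF E] sqi] by simp
  qed
  moreover have "norm (mult_l2 d f) \<le> \<epsilon> * norm f"
  proof -
    have "mult_l2 d f = mult_l2 (\<lambda>x. d x * indicat_real E x) f"
      using mult_l2_compose[OF d(1) bounded_measurable_indicator[OF E], of f] by (simp add: Ef)
    also have "norm \<dots> \<le> \<epsilon> * norm f"
    proof (rule norm_mult_l2_le[OF bounded_measurable_mult[OF d(1) bounded_measurable_indicator[OF E]]])
      show "\<bar>d x * indicat_real E x\<bar> \<le> \<epsilon>" for x
        using \<delta>(2)[of x] n(2) \<epsilon> by (cases "x \<in> E") (auto simp: E_def)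
    qed
    finally show ?thesis .
  qed
  ultimately show ?thesis using n(1) E by (fold E_def) (intro exI[of _ E] exI[of _ f], simp)
qed

context two_boson
begin

lemma \<omega>_attains:
  assumes "\<omega>\<^sub>0 < s" "s < \<omega>\<^sub>1"
  obtains k where "\<omega> k = s"
proof -
  have bdd': "bdd_below (range \<omega>)" "bdd_above (range \<omega>)"
    using bdd by (simp_all add: bounded_imp_bdd_below bounded_imp_bdd_above)
  obtain k1 k2 where k: "\<omega> k1 < s" "s < \<omega> k2"
    using assms unfolding \<omega>\<^sub>0_def \<omega>\<^sub>1_def
    using cINF_less_iff[OF UNIV_not_empty bdd'(1)] less_cSUP_iff[OF UNIV_not_empty bdd'(2)] by blast
  have "connected (range \<omega>)"
    by (rule connected_continuous_image[OF cont connected_UNIV])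
  then have "s \<in> range \<omega>"
    using k connectedD_interval[of "range \<omega>" "\<omega> k1" "\<omega> k2" s] by (simp add: less_imp_le)
  then show ?thesis using that by blast
qed

text \<open>The indicator reproducing \<open>f\<close> acts on the second variable and commutes with
  the multiplier; by self-adjointness it moves over to \<open>u\<close>, whose mass on
  \<open>E\<close> is small.\<close>

lemma cmod_kernel_concentrated_le:
  assumes z: "z < m" and E: "E \<in> sets borel" and f: "mult_l2 (indicat_real E) f = f"
  shows "cmod (cinner (mult_l2 (\<lambda>p. 1 / (W p - z)) (tens u f)) (tens f' u))
    \<le> 1 / (m - z) * (norm u * norm f) * (norm f' * norm (mult_l2 (indicat_real E) u))"
proof -
  let ?M = "\<lambda>p. 1 / (W p - z)" and ?I = "\<lambda>p :: 'a \<times> 'a. indicat_real E (snd p)"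
  note bm = bounded_measurable_inverse_W[OF z]
  note bE = bounded_measurable_indicator[OF E]
  note bI = bounded_measurable_snd[OF bE]
  have "mult_l2 ?M (tens u f) = mult_l2 ?M (mult_l2 ?I (tens u f))"
    by (simp add: tens_mult_l2_right[OF bE, symmetric] f)
  also have "\<dots> = mult_l2 ?I (mult_l2 ?M (tens u f))"
    by (simp add: mult_l2_compose bm bI mult.commute)
  finally have "cinner (mult_l2 ?M (tens u f)) (tens f' u) = cinner (mult_l2 ?I (mult_l2 ?M (tens u f))) (tens f' u)"
    by (rule arg_cong)
  also have "\<dots> = cinner (mult_l2 ?M (tens u f)) (tens f' (mult_l2 (indicat_real E) u))"
    by (simp add: mult_l2_selfadjoint[OF bI] tens_mult_l2_right[OF bE])
  also have "cmod \<dots> \<le> norm (mult_l2 ?M (tens u f)) * norm (tens f' (mult_l2 (indicat_real E) u))"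
    by (rule cmod_cinner_le)
  also have "\<dots> \<le> (1 / (m - z) * norm (tens u f)) * norm (tens f' (mult_l2 (indicat_real E) u))"
  proof (intro mult_right_mono norm_mult_l2_le[OF bm])
    show "\<bar>1 / (W p - z)\<bar> \<le> 1 / (m - z)" for p
      using W_ge[of p] z by (simp add: frac_le)
  qed simp
  finally show ?thesis by (simp add: norm_tens)
qed

lemma spectrum_root:
  assumes z: "z < m" and k0: "\<Delta> z k\<^sub>0 = 0"
  shows "complex_of_real z \<in> spectrum T"
proof (rule spectrumI)
  fix \<epsilon> :: real assume \<epsilon>: "\<epsilon> > 0"
  \<comment> \<open>The 1 accounts for the multiplier \<open>\<Delta> z\<close>, the rest for the
    kernel term.\<close>
  define c where "c = 1 + \<alpha>\<^sup>2 * (1 / (m - z) * norm u)"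
  have c: "c > 0" using z by (simp add: c_def add_pos_nonneg)
  have "isCont (\<Delta> z) k\<^sub>0"
    using continuous_on_\<Delta>[OF z] by (simp add: continuous_on_eq_continuous_at)
  then obtain E f where E: "E \<in> sets borel" "f \<noteq> 0" "mult_l2 (indicat_real E) f = f"
    "norm (mult_l2 (\<Delta> z) f) \<le> \<epsilon> / c * norm f" "norm (mult_l2 (indicat_real E) u) \<le> \<epsilon> / c"
    using concentrated_function[OF bounded_measurable_\<Delta>[OF z] _ k0, of "\<epsilon> / c" u] c \<epsilon> by auto
  define x where "x = (f, - R z (C f))"
  have "norm (S z f) \<le> \<epsilon> * norm f"
  proof (rule norm_le_cinnerI)
    fix f'
    have "cmod (cinner (S z f) f') \<le> cmod (cinner (mult_l2 (\<Delta> z) f) f')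
        + \<alpha>\<^sup>2 * cmod (cinner (mult_l2 (\<lambda>p. 1 / (W p - z)) (tens u f)) (tens f' u))"
      unfolding cinner_S_kernel[OF z]
      by (rule order_trans[OF norm_triangle_ineq4]) (simp add: norm_mult norm_power)
    also have "cmod (cinner (mult_l2 (\<Delta> z) f) f') \<le> \<epsilon> / c * norm f * norm f'"
      by (rule order_trans[OF cmod_cinner_le]) (intro mult_right_mono E norm_ge_zero)
    also have "cmod (cinner (mult_l2 (\<lambda>p. 1 / (W p - z)) (tens u f)) (tens f' u))
        \<le> 1 / (m - z) * (norm u * norm f) * (norm f' * (\<epsilon> / c))"
      by (rule order_trans[OF cmod_kernel_concentrated_le[OF z E(1,3)]])
         (use z in \<open>intro mult_left_mono E; simp\<close>)
    also have "\<epsilon> / c * norm f * norm f' + \<alpha>\<^sup>2 * (1 / (m - z) * (norm u * norm f) * (norm f' * (\<epsilon> / c)))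
        = c * (\<epsilon> / c) * norm f * norm f'"
    proof -
      have "\<delta> * norm f * norm f' + \<alpha>\<^sup>2 * (1 / (m - z) * (norm u * norm f) * (norm f' * \<delta>))
          = c * \<delta> * norm f * norm f'" for \<delta>
        unfolding c_def by (simp add: algebra_simps)
      then show ?thesis .
    qed
    finally show "cmod (cinner (S z f) f') \<le> \<epsilon> * norm f * norm f'"
      using c by (simp add: mult_left_mono)
  qed (use \<epsilon> in simp)
  also have "\<epsilon> * norm f \<le> \<epsilon> * norm x"
    using \<epsilon> norm_fst_le[of f "- R z (C f)"] by (simp add: x_def)
  finally have "norm (T x - complex_of_real z *\<^sub>C x) \<le> \<epsilon> * norm x"
    unfolding x_def T_Schur_vector[OF z] by simp
  moreover have "x \<noteq> 0" using E(2) by (simp add: x_def zero_prod_def)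
  ultimately show "\<exists>x. x \<noteq> 0 \<and> norm (T x - complex_of_real z *\<^sub>C x) \<le> \<epsilon> * norm x" by blast
qed

text \<open>The test vector is \<open>(0, f \<otimes> f)\<close> with \<open>f\<close> concentrated
  at \<open>k\<^sub>0\<close>: there \<open>W - z\<close> is nearly 0, and \<open>B\<close> only
  sees the overlap of \<open>f\<close> with \<open>u\<close>.\<close>

lemma spectrum_two_particle: "complex_of_real (\<gamma> + 2 * \<omega> k\<^sub>0) \<in> spectrum T"
proof (rule spectrumI)
  fix \<epsilon> :: real assume \<epsilon>: "\<epsilon> > 0"
  define z where "z = \<gamma> + 2 * \<omega> k\<^sub>0"
  \<comment> \<open>\<open>\<bar>\<alpha>\<bar>\<close> accounts for \<open>B\<close>, 2 for the two
    summands of \<open>W - z\<close>, and \<open>sqrt 2\<close> converts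
    \<open>(norm f)\<^sup>2\<close> into \<open>norm g\<close>.\<close>
  define c where "c = sqrt 2 * (\<bar>\<alpha>\<bar> + 2)"
  have c: "c > 0" by (simp add: c_def add_nonneg_pos)
  define d where "d k = \<omega> k - \<omega> k\<^sub>0" for k
  have d: "bounded_measurable d" "isCont d k\<^sub>0" "d k\<^sub>0 = 0"
    using cont bounded_measurable_diff[OF bounded_measurable_\<omega> bounded_measurable_const]
    by (auto simp: d_def[abs_def] continuous_on_eq_continuous_at intro!: continuous_intros)
  obtain E f where E: "E \<in> sets borel" "f \<noteq> 0" "mult_l2 (indicat_real E) f = f"
    "norm (mult_l2 d f) \<le> \<epsilon> / c * norm f" "norm (mult_l2 (indicat_real E) u) \<le> \<epsilon> / c"
    using concentrated_function[OF d, of "\<epsilon> / c" u] c \<epsilon> by auto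
  define g where "g = Abs_l2_sym (tens f f)"
  have Rep_g: "Rep_l2_sym g = tens f f"
    unfolding g_def by (subst Abs_l2_sym_inverse) (simp_all add: symmetric_l2_iff_swap swap_tens)
  have norm_g: "sqrt 2 * norm g = (norm f)\<^sup>2"
    unfolding norm_Rep_l2_sym[symmetric] Rep_g by (simp add: norm_tens power2_eq_square)
  have "norm (B g) \<le> \<bar>\<alpha>\<bar> * (\<epsilon> / c) * (norm f)\<^sup>2"
  proof (rule norm_le_cinnerI)
    fix f'
    have "cinner f u = cinner f (mult_l2 (indicat_real E) u)"
      using mult_l2_selfadjoint[OF bounded_measurable_indicator[OF E(1)], of f u] by (simp add: E(3))
    also have "cmod \<dots> \<le> norm f * (\<epsilon> / c)"
      by (rule order_trans[OF cmod_cinner_le]) (intro mult_left_mono E norm_ge_zero)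
    finally have fu: "cmod (cinner f u) \<le> norm f * (\<epsilon> / c)" .
    have "cmod (cinner (B g) f') = \<bar>\<alpha>\<bar> * (cmod (cinner f f') * cmod (cinner f u))"
      by (simp add: cinner_B cinner_C_right Rep_g cinner_tens norm_mult)
    also have "\<dots> \<le> \<bar>\<alpha>\<bar> * ((norm f * norm f') * (norm f * (\<epsilon> / c)))"
      by (intro mult_left_mono mult_mono cmod_cinner_le fu) auto
    finally show "cmod (cinner (B g) f') \<le> \<bar>\<alpha>\<bar> * (\<epsilon> / c) * (norm f)\<^sup>2 * norm f'"
      by (simp add: power2_eq_square ac_simps)
  qed (use \<epsilon> c in simp)
  moreover have "norm (D g - complex_of_real z *\<^sub>C g) \<le> 2 * (\<epsilon> / c) * (norm f)\<^sup>2"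
  proof -
    have "W p - z = d (fst p) + d (snd p)" for p by (simp add: W_def z_def d_def)
    then have eq: "Rep_l2_sym (D g - complex_of_real z *\<^sub>C g) = tens (mult_l2 d f) f + tens f (mult_l2 d f)"
      unfolding Rep_D_minus_z Rep_g tens_mult_l2_left[OF d(1)] tens_mult_l2_right[OF d(1)]
      by (simp add: mult_l2_add bounded_measurable_fst[OF d(1)] bounded_measurable_snd[OF d(1)])
    have "norm (D g - complex_of_real z *\<^sub>C g) \<le> norm (Rep_l2_sym (D g - complex_of_real z *\<^sub>C g))"
      unfolding norm_Rep_l2_sym by (simp add: mult_le_cancel_right1)
    also have "\<dots> \<le> norm (mult_l2 d f) * norm f + norm f * norm (mult_l2 d f)"
      unfolding eq by (rule order_trans[OF norm_triangle_ineq]) (simp add: norm_tens)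
    also have "\<dots> = 2 * norm f * norm (mult_l2 d f)" by simp
    also have "\<dots> \<le> 2 * norm f * (\<epsilon> / c * norm f)"
      by (intro mult_left_mono E) simp
    finally show ?thesis by (simp add: power2_eq_square ac_simps)
  qed
  ultimately have "norm (B g) + norm (D g - complex_of_real z *\<^sub>C g) \<le> (\<bar>\<alpha>\<bar> + 2) * (\<epsilon> / c) * (norm f)\<^sup>2"
    by (simp add: algebra_simps)
  also have "\<dots> = c * (\<epsilon> / c) * norm g"
    unfolding norm_g[symmetric] by (simp add: c_def)
  also have "\<dots> = \<epsilon> * norm g" using c by simp
  finally have le: "norm (B g) + norm (D g - complex_of_real z *\<^sub>C g) \<le> \<epsilon> * norm g" .
  have "T (0, g) - complex_of_real z *\<^sub>C (0, g) = (B g, D g - complex_of_real z *\<^sub>C g)"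
    by (simp add: T_eq scaleC_prod_def clinear_mapD(3)[OF clinear_A] clinear_mapD(3)[OF clinear_C])
  then have "norm (T (0, g) - complex_of_real z *\<^sub>C (0, g)) \<le> \<epsilon> * norm (0 :: 'a l2, g)"
    using order_trans[OF norm_Pair_le le] by simp
  moreover have "g \<noteq> 0" using norm_g E(2) by auto
  ultimately show "\<exists>x. x \<noteq> 0 \<and> norm (T x - complex_of_real (\<gamma> + 2 * \<omega> k\<^sub>0) *\<^sub>C x) \<le> \<epsilon> * norm x"
    by (intro exI[of _ "(0, g)"]) (simp add: z_def zero_prod_def)
qed

lemma spectrum_interval_not_discrete:
  assumes "\<And>z. a < z \<Longrightarrow> z < b \<Longrightarrow> complex_of_real z \<in> spectrum T" and z: "a < z" "z < b"
  shows "complex_of_real z \<notin> discrete_spectrum T"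
proof
  assume "complex_of_real z \<in> discrete_spectrum T"
  then obtain U where U: "open U" "U \<inter> spectrum T = {complex_of_real z}"
    by (auto simp: discrete_spectrum_def isolated_in_def)
  then obtain r where r: "r > 0" "ball (complex_of_real z) r \<subseteq> U"
    using open_contains_ball by (metis IntD1 insertI1)
  define z' where "z' = z + min (r / 2) ((b - z) / 2)"
  have z': "z < z'" "z' < b" "z' - z < r"
    using r(1) z(2) by (auto simp: z'_def min_def field_simps)
  have "dist (complex_of_real z) (complex_of_real z') = \<bar>z - z'\<bar>"
    by (simp only: dist_norm of_real_diff[symmetric] norm_of_real)
  then have "complex_of_real z' \<in> U \<inter> spectrum T"
    using r(2) z' assms(1)[of z'] z by auto
  then show False using U(2) z'(1) by auto
qed

lemma two_particle_interval_in_spectrum: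
  assumes "m < z" "z < 2 * \<omega>\<^sub>1 + \<gamma>"
  shows "complex_of_real z \<in> spectrum T"
proof -
  obtain k where "\<omega> k = (z - \<gamma>) / 2"
    using \<omega>_attains[of "(z - \<gamma>) / 2"] assms by (auto simp: m_def)
  then have "\<gamma> + 2 * \<omega> k = z" by simp
  then show ?thesis using spectrum_two_particle[of k] by metis
qed

lemma branch_interval_in_spectrum:
  assumes "\<Phi> t = - \<gamma>" "t + \<omega>\<^sub>0 < z" "z < t + \<omega>\<^sub>1" "z < m"
  shows "complex_of_real z \<in> spectrum T"
proof -
  obtain k where "\<omega> k = z - t"
    using \<omega>_attains[of "z - t"] assms by auto
  then show ?thesis
    using spectrum_root[OF assms(4), of k] assms(1) by (simp add: \<Delta>_def)
qed

end

section \<open>Counting eigenvalues\<close>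

lemma norm_l2_mono_AE:
  assumes "AE x in lborel. cmod (rep_l2 f x) \<le> cmod (rep_l2 g x)"
  shows "norm f \<le> norm g"
proof (rule power2_le_imp_le)
  have "ennreal ((norm f)\<^sup>2) \<le> ennreal ((norm g)\<^sup>2)"
    unfolding nn_integral_norm_l2[symmetric]
    by (rule nn_integral_mono_AE) (use assms in \<open>eventually_elim, auto intro: ennreal_leI power_mono\<close>)
  then show "(norm f)\<^sup>2 \<le> (norm g)\<^sup>2" by (simp add: ennreal_le_iff)
qed simp

lemma cnj_mult_l2:
  assumes "bounded_measurable w"
  shows "cnj_l2 (mult_l2 w f) = mult_l2 w (cnj_l2 f)"
  by (rule l2_eqI)
     (use rep_cnj_l2[of "mult_l2 w f"] rep_mult_l2[OF assms, of f] rep_mult_l2[OF assms, of "cnj_l2 f"]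
        rep_cnj_l2[of f] in \<open>eventually_elim, simp\<close>)

lemma span_image_Suc:
  assumes "x \<in> complex_vector.span (f ` {..<Suc n})"
  obtains a y where "y \<in> complex_vector.span (f ` {..<n})" "x = a *\<^sub>C f n + y"
proof -
  have "x \<in> complex_vector.span (insert (f n) (f ` {..<n}))"
    using assms by (simp add: lessThan_Suc)
  then obtain a where "x - a *\<^sub>C f n \<in> complex_vector.span (f ` {..<n})"
    using complex_vector.span_breakdown_eq by blast
  then show ?thesis by (intro that[of "x - a *\<^sub>C f n" a]) simp_all
qed

context two_boson
begin

text \<open>The weight \<open>w\<close> is a positive minorant of the modulus of
  \<open>\<Delta> z\<close>. It will be \<open>\<Delta> z\<close> itself at the bottom and a
  positive constant at an inner edge.\<close>

definition "HS_bound w z = (norm (mult_l2 (\<lambda>p. \<alpha>\<^sup>2 / (sqrt (w (fst p)) * sqrt (w (snd p)))) (\<kappa> z)))\<^sup>2"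

text \<open>
  The hypotheses say that \<open>s (\<Delta> z - \<alpha>\<^sup>2 K)\<close> is negative on an \<open>N\<close>-dimensional space, although
  \<open>s \<Delta> z \<ge> w\<close>; conjugation with \<open>w\<^sup>-\<^sup>1\<^sup>/\<^sup>2\<close> gives a Hilbert--Schmidt kernel.
\<close>

lemma dimension_bound:
  assumes z: "z < m" and w: "bounded_measurable w" and c: "c > 0" "\<And>k. c \<le> w k"
    and s: "s = 1 \<or> s = - 1" and dom: "\<And>k. w k \<le> s * \<Delta> z k"
    and indep: "\<And>n. n < N \<Longrightarrow> f n \<notin> complex_vector.span (f ` {..<n})"
    and neg: "\<And>x. x \<in> complex_vector.span (f ` {..<N}) \<Longrightarrow> x \<noteq> 0 \<Longrightarrow> s * inner (S z x) x < 0"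
  shows "real N \<le> HS_bound w z"
proof -
  obtain K where K: "w \<in> borel_measurable borel" "\<And>k. \<bar>w k\<bar> \<le> K"
    using bounded_measurableE[OF w] by metis
  note [measurable] = K(1)
  have wpos: "0 < w k" for k using c by (meson less_le_trans)
  have bw: "bounded_measurable (\<lambda>k. sqrt (w k))"
  proof (rule bounded_measurableI)
    show "\<bar>sqrt (w k)\<bar> \<le> sqrt K" for k
      using K(2)[of k] wpos[of k] by (simp add: order_trans[OF abs_ge_self])
  qed measurable
  have bi: "bounded_measurable (\<lambda>k. 1 / sqrt (w k))"
  proof (rule bounded_measurableI)
    show "\<bar>1 / sqrt (w k)\<bar> \<le> 1 / sqrt c" for k
      using c(1) c(2)[of k] wpos[of k] by (simp add: frac_le)
  qed measurable
  define H where "H = mult_l2 (\<lambda>k. sqrt (w k))"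
  have linH: "clinear_map H" unfolding H_def by (rule clinear_mult_l2[OF bw])
  have injH: "inj H"
  proof (rule inj_on_inverseI)
    fix x
    have "mult_l2 (\<lambda>k. 1 / sqrt (w k)) (H x) = mult_l2 (\<lambda>k. 1 / sqrt (w k) * sqrt (w k)) x"
      unfolding H_def by (rule mult_l2_compose[OF bi bw])
    also have "(\<lambda>k. 1 / sqrt (w k) * sqrt (w k)) = (\<lambda>k. 1)"
      using wpos by (simp add: less_imp_neq[symmetric])
    finally show "mult_l2 (\<lambda>k. 1 / sqrt (w k)) (H x) = x"
      by (simp add: mult_l2_const scaleR_scaleC[symmetric] del: of_real_1)
  qed
  define \<psi> where "\<psi> p = \<alpha>\<^sup>2 / (sqrt (w (fst p)) * sqrt (w (snd p)))" for p
  have \<psi>: "bounded_measurable \<psi>"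
    using bounded_measurable_cmult[OF bounded_measurable_mult[OF bounded_measurable_fst[OF bi] bounded_measurable_snd[OF bi]], of "\<alpha>\<^sup>2"]
    by (simp add: \<psi>_def[abs_def])
  \<comment> \<open>Being linear and injective, \<open>H\<close> transports both the independence
    and the span to the conjugated problem.\<close>
  have span: "complex_vector.span ((\<lambda>i. H (f i)) ` {..<n}) = H ` complex_vector.span (f ` {..<n})" for n
    using clinear_map_span[OF linH, of "f ` {..<n}"] by (simp add: image_image)
  have "real N \<le> (norm (mult_l2 \<psi> (\<kappa> z)))\<^sup>2"
  proof (rule Hilbert_Schmidt_dimension_bound[where h = "\<lambda>i. H (f i)"])
    show "H (f n) \<notin> complex_vector.span ((\<lambda>i. H (f i)) ` {..<n})" if "n < N" for n
      unfolding span using indep[OF that] injH by (auto dest: injD)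
    fix h assume "h \<in> complex_vector.span ((\<lambda>i. H (f i)) ` {..<N})"
    then obtain x where x: "x \<in> complex_vector.span (f ` {..<N})" "h = H x"
      unfolding span by blast
    have "cinner h h = cinner (mult_l2 (\<lambda>k. sqrt (w k) * sqrt (w k)) x) x"
      unfolding x(2) H_def by (simp only: mult_l2_selfadjoint[OF bw, symmetric] mult_l2_compose[OF bw bw])
    also have "(\<lambda>k. sqrt (w k) * sqrt (w k)) = w" using wpos by (simp add: less_imp_le)
    finally have "(norm h)\<^sup>2 = inner (mult_l2 w x) x"
      by (metis cinner_self inner_eq_Re_cinner Re_complex_of_real)
    also have "\<dots> \<le> inner (mult_l2 (\<lambda>k. s * \<Delta> z k) x) x"
      by (intro inner_mult_l2_mono w bounded_measurable_cmult bounded_measurable_\<Delta> z dom)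
    also have "\<dots> = s * inner (mult_l2 (\<Delta> z) x) x"
      by (simp add: mult_l2_cmult[OF bounded_measurable_\<Delta>[OF z]] scaleR_scaleC[symmetric])
    \<comment> \<open>The first term is nonpositive by \<open>neg\<close>, so the kernel term alone
      must dominate the norm of \<open>h\<close>.\<close>
    also have "\<dots> = s * inner (S z x) x + \<alpha>\<^sup>2 * (s * Re (cinner (\<kappa> z) (tens x (cnj_l2 x))))"
      unfolding inner_S_kernel[OF z] by (simp add: algebra_simps)
    also have "\<dots> \<le> \<alpha>\<^sup>2 * cmod (cinner (\<kappa> z) (tens x (cnj_l2 x)))"
    proof -
      have "s * inner (S z x) x \<le> 0"
        using neg[OF x(1)] clinear_mapD(3)[OF clinear_S[OF z]] by (cases "x = 0") auto
      moreover have "s * Re (cinner (\<kappa> z) (tens x (cnj_l2 x))) \<le> cmod (cinner (\<kappa> z) (tens x (cnj_l2 x)))"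
        using s abs_Re_le_cmod[of "cinner (\<kappa> z) (tens x (cnj_l2 x))"] by auto
      ultimately show ?thesis
        using mult_left_mono[of _ _ "\<alpha>\<^sup>2"] zero_le_power2[of \<alpha>] by (metis add_mono add_0)
    qed
    also have "\<dots> = cmod (cinner (mult_l2 \<psi> (\<kappa> z)) (tens h (cnj_l2 h)))"
    proof -
      note bf = bounded_measurable_fst[OF bw] and bs = bounded_measurable_snd[OF bw]
      have "tens h (cnj_l2 h) = mult_l2 (\<lambda>p. sqrt (w (fst p)) * sqrt (w (snd p))) (tens x (cnj_l2 x))"
        unfolding x(2) H_def cnj_mult_l2[OF bw] tens_mult_l2_left[OF bw] tens_mult_l2_right[OF bw]
        by (simp only: mult_l2_compose[OF bs bf] mult.commute)
      then have "cinner (mult_l2 \<psi> (\<kappa> z)) (tens h (cnj_l2 h))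
          = cinner (mult_l2 (\<lambda>p. (sqrt (w (fst p)) * sqrt (w (snd p))) * \<psi> p) (\<kappa> z)) (tens x (cnj_l2 x))"
        by (simp only: mult_l2_selfadjoint[OF bounded_measurable_mult[OF bf bs], symmetric]
            mult_l2_compose[OF bounded_measurable_mult[OF bf bs] \<psi>])
      also have "(\<lambda>p. (sqrt (w (fst p)) * sqrt (w (snd p))) * \<psi> p) = (\<lambda>p. \<alpha>\<^sup>2)"
        using wpos by (simp add: \<psi>_def less_imp_neq[symmetric])
      finally show ?thesis by (simp add: mult_l2_const cinner_scaleC_left norm_mult norm_power)
    qed
    finally show "(norm h)\<^sup>2 \<le> cmod (cinner (mult_l2 \<psi> (\<kappa> z)) (tens h (cnj_l2 h)))" .
  qed
  then show ?thesis by (simp add: HS_bound_def \<psi>_def[abs_def])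
qed

text \<open>
  Induction along the eigenvalues: adding the kernel at \<open>\<zeta> N\<close> keeps the form of \<open>S (\<zeta> N)\<close> nonpositive, and
  strict monotonicity makes it negative beyond \<open>\<zeta> N\<close>. For \<open>s = - 1\<close> all signs are reversed.
\<close>

lemma Schur_form_on_kernels:
  fixes N :: nat
  assumes s: "s = 1 \<or> s = - 1"
    and ker: "\<And>i. i < N \<Longrightarrow> \<zeta> i < m \<and> f i \<noteq> 0 \<and> S (\<zeta> i) (f i) = 0"
    and sorted: "\<And>i j. i < j \<Longrightarrow> j < N \<Longrightarrow> s * \<zeta> i < s * \<zeta> j"
    and z: "z < m" "\<And>i. i < N \<Longrightarrow> s * \<zeta> i < s * z"
    and x: "x \<in> complex_vector.span (f ` {..<N})" "x \<noteq> 0"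
  shows "s * inner (S z x) x < 0"
  using ker sorted z x
proof (induction N arbitrary: z x)
  case 0
  then show ?case by simp
next
  case (Suc N)
  have anti: "s * inner (S t x) x < s * inner (S t' x) x" if "s * t' < s * t" "t < m" "t' < m" "x \<noteq> 0" for t t' x
    using s inner_S_strict_antimono[of t' t x] inner_S_strict_antimono[of t t' x] that by auto
  have \<zeta>: "\<zeta> N < m" "S (\<zeta> N) (f N) = 0" using Suc.prems(1)[of N] by auto
  obtain a y where y: "y \<in> complex_vector.span (f ` {..<N})" "x = a *\<^sub>C f N + y"
    using span_image_Suc[OF Suc.prems(5)] by blast
  note lin = clinear_mapD[OF clinear_S[OF \<zeta>(1)]]
  have Sx: "S (\<zeta> N) x = S (\<zeta> N) y" by (simp add: y(2) lin \<zeta>(2))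
  \<comment> \<open>As a kernel vector, \<open>f N\<close> contributes neither a diagonal term nor,
    by symmetry, a cross term.\<close>
  have "cinner (S (\<zeta> N) y) (f N) = 0" by (simp add: S_symmetric[OF \<zeta>(1)] \<zeta>(2))
  then have "cinner (S (\<zeta> N) x) x = cinner (S (\<zeta> N) y) y"
    unfolding Sx by (simp add: y(2) cinner_add_right cinner_scaleC_right)
  then have "inner (S (\<zeta> N) x) x = inner (S (\<zeta> N) y) y" by (simp add: inner_eq_Re_cinner)
  moreover have "s * inner (S (\<zeta> N) y) y \<le> 0"
  proof (cases "y = 0")
    case False
    then show ?thesis using Suc.IH[of "\<zeta> N" y] Suc.prems \<zeta> y(1) by (simp add: less_imp_le)
  qed simp
  ultimately show ?case
    using anti[of "\<zeta> N" z x] Suc.prems(3) Suc.prems(4)[of N] \<zeta>(1) Suc.prems(6) by simp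
qed

text \<open>In the span of its predecessors \<open>f n\<close> would make the form of
  \<open>S (\<zeta> n)\<close> strictly negative, yet it lies in the kernel.\<close>

lemma kernels_independent:
  fixes N :: nat
  assumes "s = 1 \<or> s = - 1"
    and "\<And>i. i < N \<Longrightarrow> \<zeta> i < m \<and> f i \<noteq> 0 \<and> S (\<zeta> i) (f i) = 0"
    and "\<And>i j. i < j \<Longrightarrow> j < N \<Longrightarrow> s * \<zeta> i < s * \<zeta> j" and n: "n < N"
  shows "f n \<notin> complex_vector.span (f ` {..<n})"
proof
  assume "f n \<in> complex_vector.span (f ` {..<n})"
  then have "s * inner (S (\<zeta> n) (f n)) (f n) < 0"
    using assms by (intro Schur_form_on_kernels[of s n \<zeta> f]) auto
  then show False using assms(2)[OF n] by simp
qed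

definition "eigenvalues = {t. t < m \<and> (\<exists>x\<noteq>0. T x = complex_of_real t *\<^sub>C x)}"

text \<open>For \<open>s = 1\<close> this counts eigenvalues below \<open>z\<close>, for
  \<open>s = - 1\<close> those in \<open>(z, m)\<close>.\<close>

lemma card_eigenvalues_le:
  assumes z: "z < m" and w: "bounded_measurable w" and c: "c > 0" "\<And>k. c \<le> w k"
    and s: "s = 1 \<or> s = - 1" and dom: "\<And>k. w k \<le> s * \<Delta> z k"
    and G: "finite G" "G \<subseteq> eigenvalues" "\<And>t. t \<in> G \<Longrightarrow> s * t < s * z"
  shows "real (card G) \<le> HS_bound w z"
proof -
  define N where "N = card G"
  have ss: "s * (s * t) = t" for t using s by auto
  \<comment> \<open>Sorting after multiplication by \<open>s\<close> lists the eigenvalues upwards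
    for \<open>s = 1\<close> and downwards for \<open>s = - 1\<close>, in both cases towards
    \<open>z\<close>.\<close>
  define L where "L = sorted_list_of_set (times s ` G)"
  have inj: "inj_on (times s) G" using s by (auto simp: inj_on_def)
  have L: "set L = times s ` G" "sorted_wrt (<) L" "length L = N"
    using G(1) inj by (simp_all add: L_def N_def card_image strict_sorted_list_of_set)
  define \<zeta> where "\<zeta> i = s * L ! i" for i
  have \<zeta>G: "\<zeta> i \<in> G" if "i < N" for i
  proof -
    have "L ! i \<in> times s ` G" using that L by (metis nth_mem)
    then show ?thesis by (auto simp: \<zeta>_def ss)
  qed
  have "\<exists>f. f \<noteq> 0 \<and> S (\<zeta> i) f = 0" if "i < N" for i
    using \<zeta>G[OF that] G(2) eigenvector_Schur[of "\<zeta> i"] unfolding eigenvalues_def by blast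
  then obtain f where f: "\<And>i. i < N \<Longrightarrow> f i \<noteq> 0 \<and> S (\<zeta> i) (f i) = 0" by metis
  have ker: "\<zeta> i < m \<and> f i \<noteq> 0 \<and> S (\<zeta> i) (f i) = 0" if "i < N" for i
    using f[OF that] \<zeta>G[OF that] G(2) by (auto simp: eigenvalues_def)
  have sorted: "s * \<zeta> i < s * \<zeta> j" if "i < j" "j < N" for i j
    using sorted_wrt_nth_less[OF L(2)] that L(3) by (simp add: \<zeta>_def ss)
  have "real N \<le> HS_bound w z"
  proof (rule dimension_bound[OF z w c s dom])
    show "f n \<notin> complex_vector.span (f ` {..<n})" if "n < N" for n
      by (rule kernels_independent[OF s ker sorted that])
    show "s * inner (S z x) x < 0" if "x \<in> complex_vector.span (f ` {..<N})" "x \<noteq> 0" for x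
      by (rule Schur_form_on_kernels[OF s ker sorted z _ that]) (use \<zeta>G G(3) in auto)
  qed
  then show ?thesis by (simp add: N_def)
qed

section \<open>Absence of essential spectrum below a positive Schur complement\<close>

text \<open>
  A maximal \<open>S z\<close>-orthogonal family of negative vectors exists by the dimension bound; removing its components
  leaves a nonnegative form.
\<close>

lemma S_orthogonal_family_negative:
  fixes N :: nat
  assumes z: "z < m"
    and orth: "\<And>i j. i < N \<Longrightarrow> j < N \<Longrightarrow> i \<noteq> j \<Longrightarrow> cinner (S z (f i)) (f j) = 0"
    and neg: "\<And>i. i < N \<Longrightarrow> inner (S z (f i)) (f i) < 0"
    and x: "x \<in> complex_vector.span (f ` {..<N})" "x \<noteq> 0"
  shows "inner (S z x) x < 0"
  using orth neg x
proof (induction N arbitrary: x)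
  case 0
  then show ?case by simp
next
  case (Suc N)
  note lin = clinear_mapD[OF clinear_S[OF z]]
  obtain a y where y: "y \<in> complex_vector.span (f ` {..<N})" "x = a *\<^sub>C f N + y"
    using span_image_Suc[OF Suc.prems(3)] by blast
  have fy: "cinner (S z (f N)) y = 0"
    using y(1)
  proof (induction rule: complex_vector.span_induct_alt)
    case (step c v w)
    then show ?case using Suc.prems(1)[of N] by (auto simp: cinner_add_right cinner_scaleC_right)
  qed simp
  then have yf: "cinner (S z y) (f N) = 0"
    by (subst S_symmetric[OF z], subst cinner_commute) simp
  have "cinner (S z x) x = a * cnj a * cinner (S z (f N)) (f N) + cinner (S z y) y"
    by (simp add: y(2) lin cinner_add_left cinner_add_right cinner_scaleC_left cinner_scaleC_right fy yf)
  then have eq: "inner (S z x) x = (cmod a)\<^sup>2 * inner (S z (f N)) (f N) + inner (S z y) y"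
    by (simp add: inner_eq_Re_cinner complex_norm_square[symmetric])
  have y_le: "inner (S z y) y \<le> 0" and y_less: "y \<noteq> 0 \<Longrightarrow> inner (S z y) y < 0"
    using Suc.IH[of y] Suc.prems y(1) lin(3) by (cases "y = 0"; force)+
  have N: "inner (S z (f N)) (f N) < 0" using Suc.prems(2)[of N] by simp
  show ?case
  proof (cases "a = 0")
    case True
    then show ?thesis using y_less y(2) Suc.prems(4) eq by simp
  next
    case False
    then have "(cmod a)\<^sup>2 * inner (S z (f N)) (f N) < 0" using N by (simp add: mult_pos_neg)
    then show ?thesis using eq y_le by simp
  qed
qed

definition negative_family :: "real \<Rightarrow> nat \<Rightarrow> (nat \<Rightarrow> 'a l2) \<Rightarrow> bool" where
  "negative_family z N f \<longleftrightarrow>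
  (\<forall>i<N. \<forall>j<N. i \<noteq> j \<longrightarrow> cinner (S z (f i)) (f j) = 0) \<and> (\<forall>i<N. inner (S z (f i)) (f i) < 0)"

lemma negative_family_bound:
  assumes z: "z < m" and w: "bounded_measurable w" and c: "c > 0" "\<And>k. c \<le> w k" and dom: "\<And>k. w k \<le> \<Delta> z k"
    and fam: "negative_family z N f"
  shows "real N \<le> HS_bound w z"
proof (rule dimension_bound[OF z w c, of 1])
  have neg: "inner (S z x) x < 0" if "n \<le> N" "x \<in> complex_vector.span (f ` {..<n})" "x \<noteq> 0" for n x
    using fam that by (intro S_orthogonal_family_negative[OF z, of n f x]) (auto simp: negative_family_def)
  show "1 * inner (S z x) x < 0" if "x \<in> complex_vector.span (f ` {..<N})" "x \<noteq> 0" for x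
    using neg[of N x] that by simp
  show "f n \<notin> complex_vector.span (f ` {..<n})" if "n < N" for n
  proof
    \<comment> \<open>Otherwise \<open>f n\<close> would be \<open>S z\<close>-orthogonal to itself,
      although its form is negative.\<close>
    assume *: "f n \<in> complex_vector.span (f ` {..<n})"
    then have "cinner (S z (f n)) (f n) = 0"
    proof (induction rule: complex_vector.span_induct_alt[where h = "\<lambda>v. cinner (S z (f n)) v = 0", consumes 1])
      case (step c v y)
      then show ?case using fam that by (auto simp: cinner_add_right cinner_scaleC_right negative_family_def)
    qed simp
    then show False using fam that by (auto simp: negative_family_def inner_eq_Re_cinner)
  qed
qed (use dom in auto)

lemma not_essential_below:
  assumes z: "z < m" and pos: "\<Phi> (z - \<omega>\<^sub>0) < - \<gamma>" and y: "y < z"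
  shows "complex_of_real y \<notin> essential_spectrum T"
proof -
  define c where "c = - \<gamma> - \<Phi> (z - \<omega>\<^sub>0)"
  have c: "c > 0" "c \<le> \<Delta> z k" for k
    using pos \<Delta>_ge[OF z, of k] \<omega>_ge[of k] by (simp_all add: c_def)
  have bound: "N \<le> nat \<lfloor>HS_bound (\<Delta> z) z\<rfloor>" if "\<exists>f. negative_family z N f" for N
  proof -
    have "real N \<le> HS_bound (\<Delta> z) z"
      using negative_family_bound[OF z bounded_measurable_\<Delta>[OF z] c] that by auto
    then show ?thesis by linarith
  qed
  have "\<exists>f. negative_family z 0 f" by (simp add: negative_family_def)
  then obtain N where N: "\<exists>f. negative_family z N f" "\<And>M. \<exists>f. negative_family z M f \<Longrightarrow> M \<le> N"
    using Nat.ex_has_greatest_nat[of "\<lambda>N. \<exists>f. negative_family z N f" 0 "nat \<lfloor>HS_bound (\<Delta> z) z\<rfloor>"] bound by blast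
  then obtain f where f: "negative_family z N f" by blast
  define \<sigma> where "\<sigma> i = - inner (S z (f i)) (f i)" for i
  have \<sigma>: "0 < \<sigma> i" if "i < N" for i using f that by (simp add: negative_family_def \<sigma>_def)
  note lin = clinear_mapD[OF clinear_S[OF z]]
  have S_diag: "cinner (S z (f i)) (f i) = - complex_of_real (\<sigma> i)" for i
  proof -
    have "Im (cinner (S z (f i)) (f i)) = 0"
      using symmetric_op_Im[of "S z" "f i"] S_symmetric[OF z] by (simp add: symmetric_op_def)
    then show ?thesis by (simp add: complex_eq_iff \<sigma>_def inner_eq_Re_cinner)
  qed
  have form: "- (\<Sum>i<N. (cmod (cinner x (S z (f i))))\<^sup>2 / \<sigma> i) \<le> inner (S z x) x" for x
  proof -
    \<comment> \<open>Coefficients of the \<open>S z\<close>-orthogonal projection onto the family;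
      the minus sign reflects that the form at \<open>f i\<close> is
      \<open>- \<sigma> i\<close>.\<close>
    define a where "a i = - cinner x (S z (f i)) / complex_of_real (\<sigma> i)" for i
    define q where "q = (\<Sum>i<N. a i *\<^sub>C f i)"
    define p where "p = x - q"
    have qj: "cinner q (S z (f j)) = cinner x (S z (f j))" if "j < N" for j
    proof -
      have "cinner q (S z (f j)) = (\<Sum>i<N. if i = j then cinner x (S z (f j)) else 0)"
        unfolding q_def cinner_sum_left
      proof (rule sum.cong[OF refl])
        fix i assume "i \<in> {..<N}"
        then have "cinner (f i) (S z (f j)) = (if i = j then - complex_of_real (\<sigma> j) else 0)"
          unfolding S_symmetric[OF z, symmetric] using f that by (auto simp: S_diag negative_family_def)
        then show "cinner (a i *\<^sub>C f i) (S z (f j)) = (if i = j then cinner x (S z (f j)) else 0)"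
          unfolding cinner_scaleC_left using \<sigma>[OF that] by (simp add: a_def)
      qed
      then show ?thesis using that by simp
    qed
    have pj: "cinner p (S z (f j)) = 0" if "j < N" for j
      using qj[OF that] by (simp add: p_def cinner_diff_left)
    \<comment> \<open>Otherwise \<open>p\<close> would prolong the family, against the maximality of
      \<open>N\<close>.\<close>
    have "0 \<le> inner (S z p) p"
    proof (rule ccontr)
      assume "\<not> 0 \<le> inner (S z p) p"
      moreover have "cinner (S z p) (f j) = 0" "cinner (S z (f j)) p = 0" if "j < N" for j
        using pj[OF that] cinner_commute[of "S z (f j)" p] by (simp_all add: S_symmetric[OF z])
      ultimately have "negative_family z (Suc N) (f(N := p))"
        using f by (auto simp: negative_family_def less_Suc_eq)
      then show False using N(2)[of "Suc N"] by auto
    qed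
    moreover have "inner (S z x) x = inner (S z p) p + inner (S z q) q"
    proof -
      have "cinner p (S z q) = cnj (cinner q (S z p))"
        by (subst cinner_commute) (simp add: S_symmetric[OF z])
      moreover have "cinner (S z p) q = 0"
        unfolding q_def cinner_sum_right
        by (intro sum.neutral ballI) (simp add: cinner_scaleC_right S_symmetric[OF z] pj)
      moreover have "x = p + q" by (simp add: p_def)
      ultimately show ?thesis
        by (simp add: inner_eq_Re_cinner lin cinner_add_left cinner_add_right S_symmetric[OF z])
    qed
    moreover have "inner (S z q) q = - (\<Sum>i<N. (cmod (cinner x (S z (f i))))\<^sup>2 / \<sigma> i)"
    proof -
      have "cinner (S z q) q = (\<Sum>i<N. cnj (a i) * cinner q (S z (f i)))"
        by (subst (2) q_def) (simp add: cinner_sum_right cinner_scaleC_right S_symmetric[OF z])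
      also have "\<dots> = (\<Sum>i<N. complex_of_real (- ((cmod (cinner x (S z (f i))))\<^sup>2 / \<sigma> i)))"
      proof (rule sum.cong[OF refl])
        fix i assume "i \<in> {..<N}"
        then show "cnj (a i) * cinner q (S z (f i)) = complex_of_real (- ((cmod (cinner x (S z (f i))))\<^sup>2 / \<sigma> i))"
          unfolding of_real_minus of_real_divide complex_norm_square by (simp add: qj a_def mult.commute)
      qed
      finally show ?thesis by (simp add: inner_eq_Re_cinner sum_negf)
    qed
    ultimately show ?thesis by simp
  qed
  \<comment> \<open>The scaling makes the squared coefficients equal to the quotients in
    \<open>form\<close>; the second component is 0 because \<open>inner_T_ge\<close> involves
    \<open>S z\<close> at \<open>fst x\<close> only.\<close>
  define e where "e i = (complex_of_real (1 / sqrt (\<sigma> i)) *\<^sub>C S z (f i), 0 :: 'a l2_sym)" for i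
  interpret finite_rank_bounded_below T z N e
  proof (rule finite_rank_bounded_below.intro[OF clinear_T bounded_linear_T symmetric_T])
    show "z * (norm x)\<^sup>2 \<le> inner (T x) x + (\<Sum>i<N. (cmod (cinner x (e i)))\<^sup>2)" for x
    proof -
      have "(\<Sum>i<N. (cmod (cinner x (e i)))\<^sup>2) = (\<Sum>i<N. (cmod (cinner (fst x) (S z (f i))))\<^sup>2 / \<sigma> i)"
      proof (rule sum.cong[OF refl])
        fix i assume "i \<in> {..<N}"
        then show "(cmod (cinner x (e i)))\<^sup>2 = (cmod (cinner (fst x) (S z (f i))))\<^sup>2 / \<sigma> i"
          using \<sigma>[of i] by (simp add: e_def cinner_prod_def cinner_scaleC_right norm_divide power_divide)
      qed
      then show ?thesis using form[of "fst x"] inner_T_ge[OF z, of x] by simp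
    qed
  qed
  show ?thesis by (rule not_essential_spectrum[OF y])
qed

end

section \<open>Accumulation at the edges\<close>

text \<open>The denominator is at least \<open>sqrt (a * b) * (a + b)\<close>, and the
  arithmetic-geometric mean inequality makes this at least \<open>2 * (a * b)\<close>.\<close>

lemma HS_kernel_estimate:
  fixes a b d d' v x y :: real
  assumes "0 < a" "a \<le> d" "0 < b" "b \<le> d'" "a + b \<le> v" "0 \<le> x" "0 \<le> y"
  shows "1 / (sqrt d * sqrt d') * (1 / v * (x * y)) \<le> 1 / 2 * (x / a * (y / b))"
proof -
  have "2 * sqrt (a * b) \<le> v"
    using arith_geo_mean_sqrt[of a b] assms by simp
  then have "sqrt (a * b) * (2 * sqrt (a * b)) \<le> (sqrt d * sqrt d') * v"
    using assms by (intro mult_mono) (auto simp: real_sqrt_mult intro!: mult_mono)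
  moreover have "sqrt (a * b) * (2 * sqrt (a * b)) = 2 * (a * b)"
    using assms real_sqrt_mult_self[of "a * b"] by simp
  ultimately have "1 / ((sqrt d * sqrt d') * v) \<le> 1 / (2 * (a * b))"
    using assms by (intro frac_le) auto
  then have "1 / ((sqrt d * sqrt d') * v) * (x * y) \<le> 1 / (2 * (a * b)) * (x * y)"
    using assms by (intro mult_right_mono) auto
  then show ?thesis by (simp add: field_simps)
qed

context two_boson
begin

text \<open>Without a root, \<open>\<omega> - \<omega>\<^sub>0\<close> minorises
  \<open>\<Delta> z\<close> for every \<open>z < m\<close>. Hence a single square-integrable kernel,
  independent of \<open>z\<close>, majorises all the conjugated ones.\<close>

lemma HS_bound_uniform:
  assumes quot: "quotient_in_L2 lam (\<lambda>k. \<omega> k - \<omega>\<^sub>0)" and below: "\<And>t. t < \<tau> \<Longrightarrow> \<Phi> t < - \<gamma>"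
  shows "\<exists>Q. \<forall>z<m. HS_bound (\<Delta> z) z \<le> Q"
proof -
  define a where "a k = \<omega> k - \<omega>\<^sub>0" for k
  have a: "0 \<le> a k" for k using \<omega>_ge[of k] by (simp add: a_def)
  have [measurable]: "a \<in> borel_measurable borel" unfolding a_def[abs_def] by measurable
  \<comment> \<open>The value 0 where \<open>a\<close> vanishes is harmless: there the quotient is
    infinite unless \<open>lam\<close> is 0, so finiteness of the integral gives
    \<open>lam_zero\<close>.\<close>
  define \<rho> where "\<rho> k = (if a k = 0 then 0 else cmod (lam k) / a k)" for k
  have [measurable]: "\<rho> \<in> borel_measurable borel" unfolding \<rho>_def[abs_def] by measurable
  have fin: "(\<integral>\<^sup>+ k. (ennreal (cmod (lam k)) / ennreal (a k))\<^sup>2 \<partial>lborel) < \<infinity>"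
    using quot by (simp add: quotient_in_L2_def a_def)
  have "(\<integral>\<^sup>+ k. ennreal ((\<rho> k)\<^sup>2) \<partial>lborel) \<le> (\<integral>\<^sup>+ k. (ennreal (cmod (lam k)) / ennreal (a k))\<^sup>2 \<partial>lborel)"
  proof (rule nn_integral_mono)
    fix k
    show "ennreal ((\<rho> k)\<^sup>2) \<le> (ennreal (cmod (lam k)) / ennreal (a k))\<^sup>2"
    proof (cases "a k = 0")
      case False
      then have "0 < a k" using a[of k] by simp
      then show ?thesis by (simp add: \<rho>_def divide_ennreal ennreal_power)
    qed (simp add: \<rho>_def)
  qed
  then have "integrable lborel (\<lambda>k. (\<rho> k)\<^sup>2)"
    using fin by (intro integrableI_bounded) (auto intro: le_less_trans)
  then have sq\<rho>: "square_integrable (\<lambda>k. complex_of_real (\<rho> k))"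
    by (simp add: square_integrable_def)
  have "AE k in lborel. (ennreal (cmod (lam k)) / ennreal (a k))\<^sup>2 \<noteq> \<infinity>"
    using fin by (intro nn_integral_PInf_AE) auto
  then have lam_zero: "AE k in lborel. a k = 0 \<longrightarrow> lam k = 0"
  proof eventually_elim
    case (elim k)
    show ?case
    proof
      assume "a k = 0"
      then show "lam k = 0" using elim by (cases "lam k = 0") (auto simp: ennreal_divide_zero power2_eq_square ennreal_top_mult)
    qed
  qed
  define P where "P = abs_l2 (\<lambda>k. complex_of_real (\<rho> k))"
  have "HS_bound (\<Delta> z) z \<le> (norm (complex_of_real (\<alpha>\<^sup>2 / 2) *\<^sub>C tens P P))\<^sup>2" if z: "z < m" for z
  proof -
    define c where "c = - \<gamma> - \<Phi> (z - \<omega>\<^sub>0)"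
    have "c > 0" using below[of "z - \<omega>\<^sub>0"] z by (simp add: c_def m_eq)
    then have \<Delta>: "a k \<le> \<Delta> z k" "c \<le> \<Delta> z k" "0 < \<Delta> z k" for k
      using \<Delta>_ge[OF z, of k] a[of k] by (simp_all add: c_def a_def)
    define \<psi> where "\<psi> p = \<alpha>\<^sup>2 / (sqrt (\<Delta> z (fst p)) * sqrt (\<Delta> z (snd p)))" for p
    have bi: "bounded_measurable (\<lambda>k. 1 / sqrt (\<Delta> z k))"
    proof (rule bounded_measurableI)
      have [measurable]: "\<Delta> z \<in> borel_measurable borel"
        using bounded_measurable_\<Delta>[OF z] by (simp add: bounded_measurable_def)
      show "(\<lambda>k. 1 / sqrt (\<Delta> z k)) \<in> borel_measurable borel" by measurable
      show "\<bar>1 / sqrt (\<Delta> z k)\<bar> \<le> 1 / sqrt c" for k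
        using \<open>c > 0\<close> \<Delta>(2,3)[of k] by (simp add: frac_le)
    qed
    have \<psi>: "bounded_measurable \<psi>"
      using bounded_measurable_cmult[OF bounded_measurable_mult[OF bounded_measurable_fst[OF bi] bounded_measurable_snd[OF bi]], of "\<alpha>\<^sup>2"]
      by (simp add: \<psi>_def[abs_def])
    have "AE p in lborel. cmod (rep_l2 (mult_l2 \<psi> (\<kappa> z)) p) \<le> cmod (rep_l2 (complex_of_real (\<alpha>\<^sup>2 / 2) *\<^sub>C tens P P) p)"
      using rep_mult_l2[OF \<psi>, of "\<kappa> z"] rep_mult_l2[OF bounded_measurable_inverse_W[OF z], of "tens u (cnj_l2 u)", folded \<kappa>_def]
        rep_tens[of u "cnj_l2 u"] AE_lborel_fst[OF rep_abs_l2[OF square_integrable_cnj[OF lam], folded u_def]]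
        AE_lborel_snd[OF rep_abs_l2[OF square_integrable_cnj[OF lam], folded u_def]] AE_lborel_snd[OF rep_cnj_l2[of u]]
        rep_l2_scaleC[of "complex_of_real (\<alpha>\<^sup>2 / 2)" "tens P P"] rep_tens[of P P]
        AE_lborel_fst[OF rep_abs_l2[OF sq\<rho>, folded P_def]] AE_lborel_snd[OF rep_abs_l2[OF sq\<rho>, folded P_def]]
        AE_lborel_fst[OF lam_zero] AE_lborel_snd[OF lam_zero]
    proof eventually_elim
      \<comment> \<open>Facts 1 to 6 evaluate the kernel at \<open>p\<close>, facts 7 to 10 the
        majorant, and facts 11 and 12 are \<open>lam_zero\<close> in either variable.\<close>
      case (elim p)
      obtain k q where p: "p = (k, q)" by (cases p)
      \<comment> \<open>Indeed \<open>W p - z = a k + a q + (m - z)\<close>.\<close>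
      have W: "a k + a q \<le> W p - z" "0 < W p - z"
        using z W_ge[of p] by (simp_all add: W_def p a_def m_def)
      have r: "0 \<le> \<rho> k" "0 \<le> \<rho> q" using a by (auto simp: \<rho>_def)
      have "cmod (complex_of_real (W p) - complex_of_real z) = W p - z"
        using W(2) by (simp only: of_real_diff[symmetric] norm_of_real)
      note W = W this[unfolded p]
      have "cmod (rep_l2 (mult_l2 \<psi> (\<kappa> z)) p)
          = \<alpha>\<^sup>2 * (1 / (sqrt (\<Delta> z k) * sqrt (\<Delta> z q)) * (1 / (W p - z) * (cmod (lam k) * cmod (lam q))))"
        using elim(1-6) W(2,3) \<Delta>(3)[of k] \<Delta>(3)[of q]
        by (simp add: p norm_mult norm_divide norm_power \<psi>_def)
      also have "\<dots> \<le> \<alpha>\<^sup>2 * (1 / 2 * (\<rho> k * \<rho> q))"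
      proof (intro mult_left_mono zero_le_power2)
        show "1 / (sqrt (\<Delta> z k) * sqrt (\<Delta> z q)) * (1 / (W p - z) * (cmod (lam k) * cmod (lam q))) \<le> 1 / 2 * (\<rho> k * \<rho> q)"
        proof (cases "a k = 0 \<or> a q = 0")
          case True
          then have "lam k = 0 \<or> lam q = 0" using elim(11,12) by (auto simp: p)
          then show ?thesis using r by auto
        next
          case False
          then show ?thesis
            using HS_kernel_estimate[OF _ \<Delta>(1) _ \<Delta>(1) W(1), of "cmod (lam k)" "cmod (lam q)"] a[of k] a[of q]
            by (simp add: \<rho>_def less_le)
        qed
      qed
      also have "\<dots> = cmod (rep_l2 (complex_of_real (\<alpha>\<^sup>2 / 2) *\<^sub>C tens P P) p)"
        unfolding elim(7) elim(8) elim(9) elim(10) using r by (simp add: p norm_mult norm_divide norm_power)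
      finally show ?case .
    qed
    then have "norm (mult_l2 \<psi> (\<kappa> z)) \<le> norm (complex_of_real (\<alpha>\<^sup>2 / 2) *\<^sub>C tens P P)"
      by (rule norm_l2_mono_AE)
    then show ?thesis unfolding HS_bound_def \<psi>_def by (intro power_mono) simp_all
  qed
  then show ?thesis by blast
qed

section \<open>From finitely many eigenvalues on the left to absence of accumulation\<close>

lemma discrete_spectrum_eigenvector:
  assumes "z \<in> discrete_spectrum T"
  obtains x where "x \<noteq> 0" "T x = z *\<^sub>C x"
proof -
  have "0 \<in> eigenspace T z" by (simp add: eigenspace_def clinear_mapD(3)[OF clinear_T])
  then show ?thesis using assms that by (auto simp: discrete_spectrum_def eigenspace_def)
qed

lemma discrete_spectrum_below:
  assumes "complex_of_real t \<in> discrete_spectrum T" "t < m"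
  shows "t \<in> eigenvalues"
proof -
  obtain x where "x \<noteq> 0" "T x = complex_of_real t *\<^sub>C x"
    using discrete_spectrum_eigenvector[OF assms(1)] .
  then show ?thesis using assms(2) unfolding eigenvalues_def by blast
qed

text \<open>Discrete eigenvalues are real, and just to the right of \<open>m\<close> lies an
  interval of spectrum, which contains none. So near \<open>m\<close> only those on the left, and
  possibly \<open>m\<close> itself, remain.\<close>

lemma not_islimpt_discrete_spectrum:
  assumes \<omega>: "\<omega>\<^sub>0 < \<omega>\<^sub>1" and b: "b < m" and fin: "finite {t. b < t \<and> t < m \<and> complex_of_real t \<in> discrete_spectrum T}"
  shows "\<not> complex_of_real m islimpt discrete_spectrum T"
proof
  define F where "F = {t. b < t \<and> t < m \<and> complex_of_real t \<in> discrete_spectrum T}"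
  define r where "r = min (m - b) (2 * \<omega>\<^sub>1 + \<gamma> - m)"
  have r: "0 < r" using \<omega> b by (simp add: r_def m_def)
  assume "complex_of_real m islimpt discrete_spectrum T"
  then have "infinite (discrete_spectrum T \<inter> ball (complex_of_real m) r)"
    using r by (simp add: islimpt_eq_infinite_ball)
  moreover have "discrete_spectrum T \<inter> ball (complex_of_real m) r \<subseteq> complex_of_real ` insert m F"
  proof
    fix z assume z: "z \<in> discrete_spectrum T \<inter> ball (complex_of_real m) r"
    obtain x where x: "x \<noteq> 0" "T x = z *\<^sub>C x" using discrete_spectrum_eigenvector z by blast
    define t where "t = Re z"
    have zt: "z = complex_of_real t"
      using symmetric_op_eigenvalue_real[OF symmetric_T x(2,1)] by (simp add: complex_eq_iff t_def)
    have "dist (complex_of_real m) z = \<bar>m - t\<bar>"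
      unfolding zt by (simp only: dist_norm of_real_diff[symmetric] norm_of_real)
    then have d: "\<bar>m - t\<bar> < r" using z by simp
    have "\<not> m < t"
      using spectrum_interval_not_discrete[of m "2 * \<omega>\<^sub>1 + \<gamma>" t] two_particle_interval_in_spectrum d z zt
      by (auto simp: r_def)
    then have "t = m \<or> t \<in> F" using d z zt by (auto simp: F_def r_def)
    then show "z \<in> complex_of_real ` insert m F" using zt by blast
  qed
  ultimately show False using fin finite_subset by (auto simp: F_def[symmetric])
qed

lemma bottom_not_accumulation:
  assumes \<omega>: "\<omega>\<^sub>0 < \<omega>\<^sub>1" and bot: "is_bottom m (real_essential_spectrum T)"
    and quot: "quotient_in_L2 lam (\<lambda>k. \<omega> k - \<omega>\<^sub>0)"
  shows "\<not> complex_of_real m islimpt discrete_spectrum T"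
proof (cases rule: \<Phi>_cases)
  case below
  obtain Q where Q: "\<And>z. z < m \<Longrightarrow> HS_bound (\<Delta> z) z \<le> Q"
    using HS_bound_uniform[OF quot below] by blast
  have "card G \<le> nat \<lfloor>Q\<rfloor>" if G: "G \<subseteq> eigenvalues" "finite G" for G
  proof -
    \<comment> \<open>\<open>z\<close> depends on \<open>G\<close> and may come arbitrarily close to
      \<open>m\<close>; this is why \<open>Q\<close> has to be uniform.\<close>
    have "\<exists>z<m. \<forall>t\<in>G. t < z"
    proof (cases "G = {}")
      case False
      then have "Max G < m" using G by (auto simp: eigenvalues_def)
      then obtain z where "Max G < z" "z < m" using dense by blast
      then show ?thesis using G(2) False by (auto intro!: exI[of _ z])
    qed (use lt_ex in auto)
    then obtain z where z: "z < m" "\<And>t. t \<in> G \<Longrightarrow> t < z" by blast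
    define c where "c = - \<gamma> - \<Phi> (z - \<omega>\<^sub>0)"
    have c: "c > 0" "c \<le> \<Delta> z k" for k
      using below[of "z - \<omega>\<^sub>0"] z(1) \<Delta>_ge[OF z(1), of k] \<omega>_ge[of k] by (simp_all add: c_def m_eq)
    have "real (card G) \<le> HS_bound (\<Delta> z) z"
      by (rule card_eigenvalues_le[OF z(1) bounded_measurable_\<Delta>[OF z(1)] c, of 1]) (use G z in auto)
    then have "real (card G) \<le> Q" using Q[OF z(1)] by linarith
    then show ?thesis by linarith
  qed
  then have "finite eigenvalues"
    using finite_if_finite_subsets_card_bdd by blast
  then have "finite {t. m - 1 < t \<and> t < m \<and> complex_of_real t \<in> discrete_spectrum T}"
    by (rule finite_subset[rotated]) (auto intro: discrete_spectrum_below)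
  then show ?thesis by (intro not_islimpt_discrete_spectrum[OF \<omega>, of "m - 1"]) auto
next
  case (root t)
  \<comment> \<open>Since \<open>t < \<tau>\<close>, the branch of roots starts below
    \<open>m\<close>; the essential spectrum on it contradicts \<open>bot\<close>.\<close>
  have "t + \<omega>\<^sub>0 < min (t + \<omega>\<^sub>1) m" using root \<omega> by (simp add: m_eq)
  then obtain z where z: "t + \<omega>\<^sub>0 < z" "z < min (t + \<omega>\<^sub>1) m" using dense by blast
  have sp: "complex_of_real z' \<in> spectrum T" if "t + \<omega>\<^sub>0 < z'" "z' < min (t + \<omega>\<^sub>1) m" for z'
    using branch_interval_in_spectrum[OF root(2)] that by simp
  have "z \<in> real_essential_spectrum T"
    using sp[OF z] spectrum_interval_not_discrete[OF sp z]
    by (simp add: real_essential_spectrum_def essential_spectrum_def)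
  then have "m \<le> z" using bot by (simp add: is_bottom_def)
  then show ?thesis using z by simp
qed

text \<open>
  If the branch of roots reaches up to \<open>m\<close>, a left neighbourhood of \<open>m\<close> consists of spectrum; if it ends
  before, \<open>S z\<close> has finitely many positive directions at some \<open>z\<close> in between, and these bound the number of
  eigenvalues in \<open>(z, m)\<close>, because \<open>S\<close> decreases.
\<close>

lemma inner_edge_not_accumulation:
  assumes \<omega>: "\<omega>\<^sub>0 < \<omega>\<^sub>1" and mem: "m \<in> real_essential_spectrum T"
    and nbot: "\<not> is_bottom m (real_essential_spectrum T)"
  shows "\<not> complex_of_real m islimpt discrete_spectrum T"
proof (cases rule: \<Phi>_cases)
  \<comment> \<open>This case is contradictory: a point of the essential spectrum that is not its
    bottom has essential spectrum below it.\<close>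
  case below
  obtain y where y: "y \<in> real_essential_spectrum T" "y < m"
    using mem nbot by (auto simp: is_bottom_def not_le)
  obtain z where z: "y < z" "z < m" using dense[OF y(2)] by blast
  have "complex_of_real y \<notin> essential_spectrum T"
    using not_essential_below[OF z(2) below z(1)] z(2) by (simp add: m_eq)
  then show ?thesis using y(1) by (simp add: real_essential_spectrum_def)
next
  case (root t)
  show ?thesis
  proof (cases "m \<le> t + \<omega>\<^sub>1")
    case True
    have empty: "{s. t + \<omega>\<^sub>0 < s \<and> s < m \<and> complex_of_real s \<in> discrete_spectrum T} = {}"
      using spectrum_interval_not_discrete[OF branch_interval_in_spectrum[OF root(2)], of "t + \<omega>\<^sub>0" m] True by auto
    show ?thesis
    proof (rule not_islimpt_discrete_spectrum[OF \<omega>])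
      show "t + \<omega>\<^sub>0 < m" using root(1) by (simp add: m_eq)
      show "finite {s. t + \<omega>\<^sub>0 < s \<and> s < m \<and> complex_of_real s \<in> discrete_spectrum T}"
        unfolding empty by (rule finite.emptyI)
    qed
  next
    case False
    then obtain z where z: "t + \<omega>\<^sub>1 < z" "z < m" using dense[of "t + \<omega>\<^sub>1" m] by auto
    \<comment> \<open>\<open>- c\<close> bounds \<open>\<Delta> z\<close> from above, and
      \<open>c\<close> is positive because \<open>z - \<omega>\<^sub>1\<close> lies to the right of
      the root \<open>t\<close>.\<close>
    define c where "c = \<gamma> + \<Phi> (z - \<omega>\<^sub>1)"
    have "z - \<omega>\<^sub>1 < \<tau>" using z(2) \<omega> by (simp add: m_eq)
    then have c: "c > 0"
      using \<Phi>_diff_ge[of t "z - \<omega>\<^sub>1"] z(1) root(2) by (simp add: c_def)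
    have dom: "c \<le> - 1 * \<Delta> z k" for k using \<Delta>_le[OF z(2), of k] by (simp add: c_def)
    have "card G \<le> nat \<lfloor>HS_bound (\<lambda>k. c) z\<rfloor>" if G: "G \<subseteq> {s \<in> eigenvalues. z < s}" "finite G" for G
    proof -
      have "real (card G) \<le> HS_bound (\<lambda>k. c) z"
        by (rule card_eigenvalues_le[OF z(2) bounded_measurable_const c order_refl, of "- 1"]) (use G dom in auto)
      then show ?thesis by linarith
    qed
    then have "finite {s \<in> eigenvalues. z < s}"
      using finite_if_finite_subsets_card_bdd by blast
    then have "finite {s. z < s \<and> s < m \<and> complex_of_real s \<in> discrete_spectrum T}"
      by (rule finite_subset[rotated]) (auto intro: discrete_spectrum_below)
    then show ?thesis by (rule not_islimpt_discrete_spectrum[OF \<omega> z(2)])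
  qed
qed

end

section \<open>Reflection\<close>

text \<open>\<open>V\<close> is an isometric involution, so the relation is symmetric in
  \<open>T\<close> and \<open>T'\<close>; each implication is proved in one direction and its
  converse obtained by exchanging them.\<close>

locale reflected_operators =
  fixes V T T' :: "'h::complex_inner \<Rightarrow> 'h"
  assumes clinear_V: "clinear_map V" and norm_V: "\<And>x. norm (V x) = norm x" and V_V: "\<And>x. V (V x) = x"
    and T_eq: "\<And>x. T x = - V (T' (V x))"
begin

lemma reflected_operators_swap: "reflected_operators V T' T"
proof
  show "T' x = - V (T (V x))" for x
    by (simp add: T_eq V_V clinear_mapD[OF clinear_V])
qed (rule clinear_V norm_V V_V)+

lemma resolvent_set_reflected:
  assumes "- z \<in> resolvent_set T'"
  shows "z \<in> resolvent_set T"
proof -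
  define S S' where "S x = T x - z *\<^sub>C x" and "S' x = T' x - (- z) *\<^sub>C x" for x
  have S': "bij S'" "bounded_linear (inv S')"
    using assms by (auto simp: resolvent_set_def S'_def[abs_def])
  note V = clinear_mapD[OF clinear_V]
  define J where "J y = V (inv S' (- V y))" for y
  have S_eq: "S x = - V (S' (V x))" for x
    by (simp add: S_def S'_def T_eq V V_V)
  have bl: "bounded_linear V"
    by (rule clinear_map_bounded_linear[OF clinear_V, of 1]) (simp add: norm_V)

  have S'I: "S' (inv S' y) = y" "inv S' (S' y) = y" for y
    using S'(1) by (simp_all add: bij_is_surj surj_f_inv_f bij_is_inj inv_f_f)
  have "S (J y) = y" "J (S x) = x" for x y
    by (simp_all add: J_def S_eq V V_V S'I)
  then have "bij S" "inv S = J"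
    by (auto intro!: o_bij[of J S] inv_unique_comp)
  moreover have "bounded_linear J"
    unfolding J_def[abs_def] by (intro bounded_linear_compose[OF bl] bounded_linear_compose[OF S'(2)] bounded_linear_minus bl)
  ultimately show ?thesis by (simp add: resolvent_set_def S_def[abs_def])
qed

lemma eigenspace_reflected: "eigenspace T z = V ` eigenspace T' (- z)"
proof -
  note V = clinear_mapD[OF clinear_V]
  have "T (V y) = z *\<^sub>C V y \<longleftrightarrow> T' y = (- z) *\<^sub>C y" for y
  proof -
    have "T (V y) = z *\<^sub>C V y \<longleftrightarrow> V (- T' y) = V (z *\<^sub>C y)"
      by (simp add: T_eq V_V V)
    also have "\<dots> \<longleftrightarrow> - T' y = z *\<^sub>C y" by (metis V_V)
    also have "\<dots> \<longleftrightarrow> T' y = (- z) *\<^sub>C y" by (metis complex_vector.scale_minus_left minus_minus)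
    finally show ?thesis .
  qed
  then have iff: "y \<in> eigenspace T' (- z) \<longleftrightarrow> V y \<in> eigenspace T z" for y by (simp add: eigenspace_def)
  show ?thesis
  proof (intro equalityI subsetI)
    fix x assume "x \<in> eigenspace T z"
    then have "V x \<in> eigenspace T' (- z)" by (simp add: iff V_V)
    then show "x \<in> V ` eigenspace T' (- z)" by (rule image_eqI[rotated]) (simp add: V_V)
  qed (use iff in blast)
qed

end

lemma (in reflected_operators) spectrum_reflected: "z \<in> spectrum T \<longleftrightarrow> - z \<in> spectrum T'"
  using resolvent_set_reflected[of z] reflected_operators.resolvent_set_reflected[OF reflected_operators_swap, of "- z"]
  by (auto simp: spectrum_def)

lemma (in reflected_operators) discrete_spectrum_imp_reflected:
  assumes "- z \<in> discrete_spectrum T'"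
  shows "z \<in> discrete_spectrum T"
proof -
  note V = clinear_mapD[OF clinear_V]
  obtain U where U: "open U" "U \<inter> spectrum T' = {- z}"
    using assms by (auto simp: discrete_spectrum_def isolated_in_def)
  have sp: "z \<in> spectrum T" using assms by (auto simp: spectrum_reflected discrete_spectrum_def isolated_in_def)
  have "open (uminus ` U)" by (rule open_negations[OF U(1)])
  moreover have "uminus ` U \<inter> spectrum T = {z}"
  proof (intro equalityI subsetI)
    fix x assume x: "x \<in> uminus ` U \<inter> spectrum T"
    then have "- x \<in> U \<inter> spectrum T'" by (auto simp: spectrum_reflected)
    then show "x \<in> {z}" using U(2) by auto
  next
    fix x assume "x \<in> {z}"
    then show "x \<in> uminus ` U \<inter> spectrum T" using U(2) sp by (auto intro!: image_eqI[of _ _ "- z"])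
  qed
  ultimately have "z isolated_in spectrum T" using sp by (auto simp: isolated_in_def)
  moreover have "eigenspace T z \<noteq> {0}"
  proof
    assume "eigenspace T z = {0}"
    then have "V ` V ` eigenspace T' (- z) = V ` {0}" by (simp add: eigenspace_reflected)
    then show False using assms by (simp add: image_image V_V V discrete_spectrum_def)
  qed
  moreover have "finite_dimensional (eigenspace T z)"
  proof -
    obtain X where X: "finite X" "eigenspace T' (- z) \<subseteq> complex_vector.span X"
      using assms by (auto simp: discrete_spectrum_def finite_dimensional_def)
    have "eigenspace T z \<subseteq> complex_vector.span (V ` X)"
      using X(2) unfolding eigenspace_reflected clinear_map_span[OF clinear_V] by (rule image_mono)
    then show ?thesis using X(1) unfolding finite_dimensional_def by blast
  qed
  ultimately show ?thesis by (simp add: discrete_spectrum_def)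
qed

context reflected_operators
begin

lemma discrete_spectrum_reflected: "z \<in> discrete_spectrum T \<longleftrightarrow> - z \<in> discrete_spectrum T'"
  using discrete_spectrum_imp_reflected[of z]
    reflected_operators.discrete_spectrum_imp_reflected[OF reflected_operators_swap, of "- z"] by auto

lemma real_essential_spectrum_reflected: "x \<in> real_essential_spectrum T \<longleftrightarrow> - x \<in> real_essential_spectrum T'"
  by (simp add: real_essential_spectrum_def essential_spectrum_def spectrum_reflected discrete_spectrum_reflected)

lemma is_top_reflected: "is_top x (real_essential_spectrum T) \<longleftrightarrow> is_bottom (- x) (real_essential_spectrum T')"
  unfolding is_top_def is_bottom_def
  using real_essential_spectrum_reflected by (metis minus_minus neg_le_iff_le)

lemma islimpt_reflected:
  assumes "complex_of_real x islimpt discrete_spectrum T"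
  shows "complex_of_real (- x) islimpt discrete_spectrum T'"
  unfolding islimpt_approachable
proof (intro allI impI)
  fix e :: real assume "0 < e"
  then obtain z where z: "z \<in> discrete_spectrum T" "z \<noteq> complex_of_real x" "dist z (complex_of_real x) < e"
    using assms by (auto simp: islimpt_approachable)
  then show "\<exists>z'\<in>discrete_spectrum T'. z' \<noteq> complex_of_real (- x) \<and> dist z' (complex_of_real (- x)) < e"
    by (intro bexI[of _ "- z"]) (auto simp: discrete_spectrum_reflected dist_norm norm_minus_commute)
qed

end

text \<open>Negating the parameters reverses the diagonal blocks, and changing the sign of the
  second component reverses the off-diagonal ones; together they reverse the whole matrix.\<close>

lemma block_op_reflected:
  fixes \<omega> :: "'a::euclidean_space \<Rightarrow> real"
  assumes "two_boson \<omega> lam"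
  shows "reflected_operators (\<lambda>(f, g). (f, - g)) (block_op \<gamma> \<alpha> \<omega> lam) (block_op (- \<gamma>) \<alpha> (\<lambda>k. - \<omega> k) lam)"
proof
  interpret two_boson \<gamma> \<alpha> \<omega> lam by (rule assms)
  interpret refl: two_boson "- \<gamma>" \<alpha> "\<lambda>k. - \<omega> k" lam
  proof
    show "continuous_on UNIV (\<lambda>k. - \<omega> k)" by (intro continuous_intros cont)
    show "bounded (range (\<lambda>k. - \<omega> k))"
      using bdd by (auto simp: bounded_iff)
  qed (rule lam)
  show "clinear_map (\<lambda>(f, g). (f, - g :: 'a l2_sym) :: 'a l2 \<times> 'a l2_sym)"
    by (auto simp: clinear_map_def scaleC_prod_def)
  fix x :: "'a l2 \<times> 'a l2_sym"
  show "norm ((\<lambda>(f, g). (f, - g)) x) = norm x"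
    by (simp add: case_prod_unfold norm_prod_def)
  show "(\<lambda>(f, g). (f, - g)) ((\<lambda>(f, g). (f, - g)) x) = x"
    by (simp add: case_prod_unfold)
  have A: "block_A (- \<gamma>) (\<lambda>k. - \<omega> k) f = - A f" for f
  proof -
    have "(\<lambda>k. - (- \<gamma>) + - \<omega> k) = (\<lambda>k. (- 1) * (- \<gamma> + \<omega> k))" by auto
    then show ?thesis
      unfolding A_eq refl.A_eq
      by (simp only: mult_l2_cmult[OF bounded_measurable_add[OF bounded_measurable_const bounded_measurable_\<omega>]]) simp
  qed
  have D: "block_D (- \<gamma>) (\<lambda>k. - \<omega> k) g = - D g" for g
  proof (rule Rep_l2_sym_eqI)
    have "refl.W = (\<lambda>p. (- 1) * W p)" by (auto simp: W_def refl.W_def)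
    then show "Rep_l2_sym (block_D (- \<gamma>) (\<lambda>k. - \<omega> k) g) = Rep_l2_sym (- D g)"
      unfolding refl.Rep_D by (simp only: uminus_l2_sym.rep_eq Rep_D mult_l2_cmult[OF bounded_measurable_W]) simp
  qed
  show "block_op \<gamma> \<alpha> \<omega> lam x
      = - (\<lambda>(f, g). (f, - g)) (block_op (- \<gamma>) \<alpha> (\<lambda>k. - \<omega> k) lam ((\<lambda>(f, g). (f, - g)) x))"
    by (simp add: block_op_def case_prod_unfold A D clinear_mapD[OF clinear_B] clinear_mapD[OF clinear_D])
qed

lemma is_edge_imp_mem:
  assumes "is_edge x S"
  shows "x \<in> S"
proof -
  obtain a b where ab: "a \<le> b" "{a..b} \<in> components S" "x = a \<or> x = b"
    using assms[unfolded is_edge_def] by (elim exE conjE)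
  have "{a..b} \<subseteq> S" by (rule in_components_subset[OF ab(2)])
  moreover have "x \<in> {a..b}" using ab(1,3) by (elim disjE) simp_all
  ultimately show ?thesis by (rule subsetD)
qed

theorem theorem2p4:
  fixes \<omega> :: "real ^ 'n \<Rightarrow> real" and lam :: "real ^ 'n \<Rightarrow> complex"
    and \<gamma> \<alpha> \<omega>\<^sub>0 \<omega>\<^sub>1 :: real
  assumes omega_nonneg: "\<forall>k. 0 \<le> \<omega> k"
    and omega_nonconstant: "\<not> \<omega> constant_on UNIV"
    and omega_bounded: "bounded (range \<omega>)"
    and omega_continuous: "continuous_on UNIV \<omega>"
    and lam_L2: "square_integrable lam"
    and lam_nonzero: "\<not> (AE k in lborel. lam k = 0)"
    and omega0: "\<omega>\<^sub>0 = (INF k. \<omega> k)"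
    and omega1: "\<omega>\<^sub>1 = (SUP k. \<omega> k)"
    and alpha_pos: "\<alpha> > 0"
  shows
    "(is_bottom (2 * \<omega>\<^sub>0 + \<gamma>) (real_essential_spectrum (block_op \<gamma> \<alpha> \<omega> lam))
        \<and> quotient_in_L2 lam (\<lambda>k. \<omega> k - \<omega>\<^sub>0)
        \<longrightarrow> \<not> complex_of_real (2 * \<omega>\<^sub>0 + \<gamma>) islimpt discrete_spectrum (block_op \<gamma> \<alpha> \<omega> lam))
     \<and> (is_top (2 * \<omega>\<^sub>1 + \<gamma>) (real_essential_spectrum (block_op \<gamma> \<alpha> \<omega> lam))
        \<and> quotient_in_L2 lam (\<lambda>k. \<omega>\<^sub>1 - \<omega> k)
        \<longrightarrow> \<not> complex_of_real (2 * \<omega>\<^sub>1 + \<gamma>) islimpt discrete_spectrum (block_op \<gamma> \<alpha> \<omega> lam))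
     \<and> (is_edge (2 * \<omega>\<^sub>0 + \<gamma>) (real_essential_spectrum (block_op \<gamma> \<alpha> \<omega> lam))
        \<and> \<not> is_bottom (2 * \<omega>\<^sub>0 + \<gamma>) (real_essential_spectrum (block_op \<gamma> \<alpha> \<omega> lam))
        \<and> quotient_in_L2 lam (\<lambda>k. sqrt ((\<omega> k - \<omega>\<^sub>0) * (\<omega>\<^sub>1 - \<omega> k)))
        \<longrightarrow> \<not> complex_of_real (2 * \<omega>\<^sub>0 + \<gamma>) islimpt discrete_spectrum (block_op \<gamma> \<alpha> \<omega> lam))
     \<and> (is_edge (2 * \<omega>\<^sub>1 + \<gamma>) (real_essential_spectrum (block_op \<gamma> \<alpha> \<omega> lam))
        \<and> \<not> is_top (2 * \<omega>\<^sub>1 + \<gamma>) (real_essential_spectrum (block_op \<gamma> \<alpha> \<omega> lam))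
        \<and> quotient_in_L2 lam (\<lambda>k. sqrt ((\<omega> k - \<omega>\<^sub>0) * (\<omega>\<^sub>1 - \<omega> k)))
        \<longrightarrow> \<not> complex_of_real (2 * \<omega>\<^sub>1 + \<gamma>) islimpt discrete_spectrum (block_op \<gamma> \<alpha> \<omega> lam))"
proof -
  interpret lower: two_boson \<gamma> \<alpha> \<omega> lam
    by (rule two_boson.intro[OF omega_continuous omega_bounded lam_L2])
  \<comment> \<open>The lower threshold of this instance is minus the upper threshold of the
    original operator.\<close>
  interpret upper: two_boson "- \<gamma>" \<alpha> "\<lambda>k. - \<omega> k" lam
    by (rule two_boson.intro) (use omega_continuous omega_bounded lam_L2 in
      \<open>auto intro!: continuous_intros simp: bounded_iff\<close>)
  define T where "T = block_op \<gamma> \<alpha> \<omega> lam"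
  define T' where "T' = block_op (- \<gamma>) \<alpha> (\<lambda>k. - \<omega> k) lam"
  interpret refl: reflected_operators "\<lambda>(f, g). (f, - g)" T T'
    unfolding T_def T'_def by (rule block_op_reflected) (rule lower.two_boson_axioms)
  have T: "lower.T = T" "upper.T = T'"
    by (simp_all add: lower.T_def upper.T_def T_def T'_def)
  have lower: "lower.\<omega>\<^sub>0 = \<omega>\<^sub>0" "lower.\<omega>\<^sub>1 = \<omega>\<^sub>1" "lower.m = 2 * \<omega>\<^sub>0 + \<gamma>"
    by (simp_all add: lower.\<omega>\<^sub>0_def lower.\<omega>\<^sub>1_def lower.m_def omega0 omega1)
  have upper: "upper.\<omega>\<^sub>0 = - \<omega>\<^sub>1" "upper.\<omega>\<^sub>1 = - \<omega>\<^sub>0"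
    unfolding upper.\<omega>\<^sub>0_def upper.\<omega>\<^sub>1_def omega0 omega1
    \<comment> \<open>\<open>Inf_real_def\<close> expresses the infimum as minus the supremum of the
      negatives.\<close>
    by (simp_all add: Inf_real_def image_image)
  have upper_m: "upper.m = - (2 * \<omega>\<^sub>1 + \<gamma>)"
    by (simp add: upper.m_def upper)
  have less: "\<omega>\<^sub>0 < \<omega>\<^sub>1"
  proof -
    obtain k1 k2 where "\<omega> k1 < \<omega> k2"
      using omega_nonconstant unfolding constant_on_def by (metis linorder_less_linear)
    then show ?thesis
      using lower.\<omega>_ge[of k1] lower.\<omega>_le[of k2] by (simp add: lower)
  qed
  then have less': "- \<omega>\<^sub>1 < - \<omega>\<^sub>0" by simp

  have 1: "\<not> complex_of_real (2 * \<omega>\<^sub>0 + \<gamma>) islimpt discrete_spectrum T"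
    if "is_bottom (2 * \<omega>\<^sub>0 + \<gamma>) (real_essential_spectrum T)" "quotient_in_L2 lam (\<lambda>k. \<omega> k - \<omega>\<^sub>0)"
    by (rule lower.bottom_not_accumulation[unfolded lower T, OF less that])
  have 2: "\<not> complex_of_real (2 * \<omega>\<^sub>1 + \<gamma>) islimpt discrete_spectrum T"
    if "is_top (2 * \<omega>\<^sub>1 + \<gamma>) (real_essential_spectrum T)" "quotient_in_L2 lam (\<lambda>k. \<omega>\<^sub>1 - \<omega> k)"
  proof
    \<comment> \<open>For the reflected symbol, the distance to its infimum
      \<open>- \<omega>\<^sub>1\<close> is \<open>\<omega>\<^sub>1 - \<omega> k\<close>.\<close>
    have "quotient_in_L2 lam (\<lambda>k. - \<omega> k - - \<omega>\<^sub>1)" using that(2) by simp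
    then have "\<not> complex_of_real (- (2 * \<omega>\<^sub>1 + \<gamma>)) islimpt discrete_spectrum T'"
      by (rule upper.bottom_not_accumulation[unfolded upper upper_m T, OF less' that(1)[unfolded refl.is_top_reflected]])
    moreover assume "complex_of_real (2 * \<omega>\<^sub>1 + \<gamma>) islimpt discrete_spectrum T"
    ultimately show False using refl.islimpt_reflected by blast
  qed
  have 3: "\<not> complex_of_real (2 * \<omega>\<^sub>0 + \<gamma>) islimpt discrete_spectrum T"
    if "is_edge (2 * \<omega>\<^sub>0 + \<gamma>) (real_essential_spectrum T)" "\<not> is_bottom (2 * \<omega>\<^sub>0 + \<gamma>) (real_essential_spectrum T)"
    by (rule lower.inner_edge_not_accumulation[unfolded lower T, OF less is_edge_imp_mem[OF that(1)] that(2)])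
  have 4: "\<not> complex_of_real (2 * \<omega>\<^sub>1 + \<gamma>) islimpt discrete_spectrum T"
    if "is_edge (2 * \<omega>\<^sub>1 + \<gamma>) (real_essential_spectrum T)" "\<not> is_top (2 * \<omega>\<^sub>1 + \<gamma>) (real_essential_spectrum T)"
  proof
    have "- (2 * \<omega>\<^sub>1 + \<gamma>) \<in> real_essential_spectrum T'"
      using is_edge_imp_mem[OF that(1)] by (simp only: refl.real_essential_spectrum_reflected)
    then have "\<not> complex_of_real (- (2 * \<omega>\<^sub>1 + \<gamma>)) islimpt discrete_spectrum T'"
      by (rule upper.inner_edge_not_accumulation[unfolded upper upper_m T, OF less' _ that(2)[unfolded refl.is_top_reflected]])
    moreover assume "complex_of_real (2 * \<omega>\<^sub>1 + \<gamma>) islimpt discrete_spectrum T"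
    ultimately show False using refl.islimpt_reflected by blast
  qed
  show ?thesis
    unfolding T_def[symmetric] using 1 2 3 4 by blast
qed

end
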